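(* Let $F$ be a local field of characteristic zero and $\pi\in\Pi_F(n)$. For $\xi\in\mathcal{S}_{\rm std}(\mathrm{GL}_n(F))$ and $\varphi_\pi\in\mathcal{C}(\pi)$, the fiber integration $$\phi_{\xi,\varphi_\pi}(x)=\int_{\det g=x}\xi(g)\varphi_\pi(g)\,\mathrm{d}_xg$$ is absolutely convergent for all $x\in F^\times$, and the function $\phi_{\xi,\varphi_\pi}(x)$ is smooth over $F^\times$.
   Context: $|\cdot|_F$ is the normalized absolute value ($|z|_{\mathbb{C}}=z\bar z$). $\Pi_F(n)$ is the set of equivalence classes of irreducible smooth representations of $\mathrm{GL}_n(F)$ if $F$ is non-Archimedean, and of irreducible Casselman-Wallach representations if $F$ is Archimedean. $\mathcal{C}(\pi)$ is the space of smooth matrix coefficients of $\pi$. $\mathcal{S}_{\rm std}(\mathrm{GL}_n(F))=\{\xi\in C^\infty(\mathrm{GL}_n(F)):|\det g|_F^{-n/2}\xi(g)\in\mathcal{S}(\mathrm{M}_n(F))\}$, where $\mathcal{S}(\mathrm{M}_n(F))$ is the space of Schwartz-Bruhat functions on $n\times n$ matrices (the condition means being the restriction to $\mathrm{GL}_n(F)$ of such a function). $\mathrm{d}_xg$ is the $\mathrm{SL}_n(F)$-invariant measure on the fiber $\{g\in\mathrm{GL}_n(F):\det g=x\}$ (an $\mathrm{SL}_n(F)$-torsor) induced from a normalized Haar measure on $\mathrm{SL}_n(F)$. Smooth means locally constant when $F$ is non-Archimedean. *)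

theory Defs
  imports "HOL-Analysis.Analysis" "HOL-Library.Function_Algebras"
begin

section \<open>Local fields of characteristic zero\<close>

class field_with_topology = field_char_0 + topological_space
begin

text \<open>An isomorphism of topological fields onto the real line or the complex plane, both viewed
  inside the complex numbers; injectivity is automatic.\<close>

definition is_arch_emb :: "('a \<Rightarrow> complex) \<Rightarrow> bool" where
  "is_arch_emb \<iota> \<longleftrightarrow>
     (\<forall>x y. \<iota> (x + y) = \<iota> x + \<iota> y) \<and> (\<forall>x y. \<iota> (x * y) = \<iota> x * \<iota> y) \<and> \<iota> 1 = 1 \<and>
     (range \<iota> = \<real> \<or> range \<iota> = UNIV) \<and>
     (\<forall>U. open U \<longleftrightarrow> openin (top_of_set (range \<iota>)) (\<iota> ` U))"

text \<open>Of a valuation only the values at nonzero arguments matter; \<open>val_ge v N\<close> is the fractional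
  ideal of elements of valuation at least \<open>N\<close>.\<close>

definition val_ge :: "('a \<Rightarrow> int) \<Rightarrow> int \<Rightarrow> 'a set" where
  "val_ge v N = {x. x = 0 \<or> v x \<ge> N}"

definition residue_classes :: "('a \<Rightarrow> int) \<Rightarrow> 'a set set" where
  "residue_classes v =
     val_ge v 0 // {(x, y). x \<in> val_ge v 0 \<and> y \<in> val_ge v 0 \<and> x - y \<in> val_ge v 1}"

text \<open>A normalized discrete valuation inducing the given topology, complete, and with finite
  residue field.\<close>

definition is_nonarch_val :: "('a \<Rightarrow> int) \<Rightarrow> bool" where
  "is_nonarch_val v \<longleftrightarrow>
     (\<forall>x y. x \<noteq> 0 \<longrightarrow> y \<noteq> 0 \<longrightarrow> v (x * y) = v x + v y) \<and>
     (\<forall>x y. x \<noteq> 0 \<longrightarrow> y \<noteq> 0 \<longrightarrow> x + y \<noteq> 0 \<longrightarrow> v (x + y) \<ge> min (v x) (v y)) \<and>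
     (\<exists>x. x \<noteq> 0 \<and> v x = 1) \<and>
     (\<forall>U. open U \<longleftrightarrow> (\<forall>x\<in>U. \<exists>N. \<forall>y. y - x \<in> val_ge v N \<longrightarrow> y \<in> U)) \<and>
     (\<forall>X::nat \<Rightarrow> 'a. (\<forall>N. \<exists>M. \<forall>i\<ge>M. \<forall>j\<ge>M. X i - X j \<in> val_ge v N) \<longrightarrow>
        (\<exists>l. \<forall>N. \<exists>M. \<forall>i\<ge>M. X i - l \<in> val_ge v N)) \<and>
     finite (residue_classes v)"

end

class local_field_char_0 = field_with_topology +
  assumes local_field: "(\<exists>\<iota>. is_arch_emb \<iota>) \<or> (\<exists>v. is_nonarch_val v)"

instance real :: field_with_topology ..

instance complex :: field_with_topology ..

instance real :: local_field_char_0
proof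
  have "openin (top_of_set (range complex_of_real)) (complex_of_real ` U)" if "open U" for U
  proof -
    have "openin (top_of_set (range complex_of_real)) (range complex_of_real \<inter> Re -` U)"
      by (rule continuous_openin_preimage_gen) (auto intro!: continuous_intros that)
    moreover have "range complex_of_real \<inter> Re -` U = complex_of_real ` U" by auto
    ultimately show ?thesis by simp
  qed
  moreover have "open U" if "openin (top_of_set (range complex_of_real)) (complex_of_real ` U)" for U
  proof -
    obtain S where S: "open S" "complex_of_real ` U = range complex_of_real \<inter> S"
      using \<open>openin _ _\<close> by (auto simp: openin_open)
    then have "x \<in> U \<longleftrightarrow> complex_of_real x \<in> S" for x
      by (metis Int_iff inj_image_mem_iff inj_of_real rangeI)
    then have "U = complex_of_real -` S" by auto
    moreover have "open (complex_of_real -` S)"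
      by (rule open_vimage[OF S(1)]) (intro continuous_intros)
    ultimately show ?thesis by simp
  qed
  ultimately have "is_arch_emb complex_of_real"
    by (auto simp: is_arch_emb_def Reals_def)
  then show "(\<exists>\<iota>::real \<Rightarrow> complex. is_arch_emb \<iota>) \<or> (\<exists>v::real \<Rightarrow> int. is_nonarch_val v)"
    by blast
qed

instance complex :: local_field_char_0
proof
  have "is_arch_emb (\<lambda>x::complex. x)" by (simp add: is_arch_emb_def)
  then show "(\<exists>\<iota>::complex \<Rightarrow> complex. is_arch_emb \<iota>) \<or> (\<exists>v::complex \<Rightarrow> int. is_nonarch_val v)"
    by blast
qed

definition archimedean :: "'a::local_field_char_0 itself \<Rightarrow> bool" where
  "archimedean _ \<longleftrightarrow> (\<exists>\<iota>::'a \<Rightarrow> complex. is_arch_emb \<iota>)"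

text \<open>The embedding is unique for a real field and unique up to complex conjugation for a complex
  one; nothing below depends on the choice.  The valuation is determined by the topology.\<close>

definition arch_emb :: "'a::local_field_char_0 \<Rightarrow> complex" where
  "arch_emb = (SOME \<iota>. is_arch_emb \<iota>)"

definition nonarch_val :: "'a::local_field_char_0 \<Rightarrow> int" where
  "nonarch_val = (SOME v. is_nonarch_val v)"

text \<open>The normalized absolute value; \<open>\<bar>z\<bar>\<^sup>2\<close> on a complex field.\<close>

definition absF :: "'a::local_field_char_0 \<Rightarrow> real" where
  "absF x =
     (if archimedean TYPE('a) then
        (if range (arch_emb :: 'a \<Rightarrow> complex) = \<real> then cmod (arch_emb x) else (cmod (arch_emb x))\<^sup>2)
      else if x = 0 then 0
      else real (card (residue_classes (nonarch_val :: 'a \<Rightarrow> int))) powi (- nonarch_val x))"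

text \<open>For Archimedean fields: the inclusion of the real numbers, and the conjugation
  (trivial on a real field).\<close>

definition real_emb :: "real \<Rightarrow> 'a::local_field_char_0" where
  "real_emb r = inv arch_emb (complex_of_real r)"

definition conjF :: "'a::local_field_char_0 \<Rightarrow> 'a" where
  "conjF x = inv arch_emb (cnj (arch_emb x))"

definition scaleF :: "real \<Rightarrow> 'a::local_field_char_0 \<Rightarrow> 'a" where
  "scaleF r x = real_emb r * x"

definition scaleM :: "real \<Rightarrow> 'a::local_field_char_0^'n^'n \<Rightarrow> 'a^'n^'n" where
  "scaleM r A = (\<chi> i j. real_emb r * A $ i $ j)"


section \<open>The groups\<close>

definition GL :: "('a::local_field_char_0^'n^'n) set" where
  "GL = {g. invertible g}"

definition SL :: "('a::local_field_char_0^'n^'n) set" where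
  "SL = {g. det g = 1}"

text \<open>The standard maximal compact subgroup in the Archimedean case: the orthogonal or the unitary
  group.\<close>

definition max_compact :: "('a::local_field_char_0^'n^'n) set" where
  "max_compact = {k. transpose (\<chi> i j. conjF (k $ i $ j)) ** k = mat 1}"

definition gl_norm :: "'a::local_field_char_0^'n^'n \<Rightarrow> real" where
  "gl_norm g = 1 + (\<Sum>i\<in>UNIV. \<Sum>j\<in>UNIV. absF (g $ i $ j) + absF (matrix_inv g $ i $ j))"

text \<open>A Haar measure on \<open>SL\<^sub>n(F)\<close>, as a measure on its Borel sets.  Regularity is automatic, because
  the group is locally compact and second countable.\<close>

definition haar_measure_SL :: "('a::local_field_char_0^'n^'n) measure \<Rightarrow> bool" where
  "haar_measure_SL \<mu> \<longleftrightarrow>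
     space \<mu> = SL \<and> sets \<mu> = sets (restrict_space borel SL) \<and>
     (\<forall>h\<in>SL. \<forall>A\<in>sets \<mu>. emeasure \<mu> ((\<lambda>g. h ** g) ` A) = emeasure \<mu> A) \<and>
     (\<forall>K. compact K \<longrightarrow> K \<subseteq> SL \<longrightarrow> K \<in> sets \<mu> \<longrightarrow> emeasure \<mu> K < \<infinity>) \<and>
     emeasure \<mu> SL \<noteq> 0"

text \<open>The measure on the torsor \<open>det g = x\<close>, transported from \<open>SL\<^sub>n(F)\<close> along \<open>g \<mapsto> h g\<close> for a
  point \<open>h\<close> of the torsor.  By left invariance of \<open>\<mu>\<close> it does not depend on \<open>h\<close>, and since \<open>SL\<^sub>n(F)\<close>
  is unimodular it is invariant under both translation actions.\<close>

definition fiber_measure ::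
    "('a::local_field_char_0^'n^'n) measure \<Rightarrow> 'a \<Rightarrow> ('a^'n^'n) measure" where
  "fiber_measure \<mu> x =
     distr \<mu> (restrict_space borel {g. det g = x}) (\<lambda>g. (SOME h. det h = x) ** g)"


section \<open>Smooth functions\<close>

text \<open>Smoothness over an Archimedean field refers to the underlying real structure: all iterated
  directional derivatives exist and are continuous.  The values lie in a complex vector space with
  scalar multiplication \<open>s\<close> and topology \<open>T\<close> on a subspace; \<open>sc\<close> is the multiplication by real
  scalars on the domain.\<close>

definition has_dirderiv ::
    "(real \<Rightarrow> 'e \<Rightarrow> 'e) \<Rightarrow> (complex \<Rightarrow> 'v \<Rightarrow> 'v) \<Rightarrow> 'v topology \<Rightarrow> ('e::ab_group_add \<Rightarrow> 'v::ab_group_add)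
      \<Rightarrow> 'e \<Rightarrow> 'e \<Rightarrow> 'v \<Rightarrow> bool" where
  "has_dirderiv sc s T f X x d \<longleftrightarrow>
     limitin T (\<lambda>t. s (complex_of_real (1 / t)) (f (x + sc t X) - f x)) d (at 0)"

definition dirderiv ::
    "(real \<Rightarrow> 'e \<Rightarrow> 'e) \<Rightarrow> (complex \<Rightarrow> 'v \<Rightarrow> 'v) \<Rightarrow> 'v topology \<Rightarrow> 'e::ab_group_add
      \<Rightarrow> ('e \<Rightarrow> 'v::ab_group_add) \<Rightarrow> 'e \<Rightarrow> 'v" where
  "dirderiv sc s T X f = (\<lambda>x. THE d. has_dirderiv sc s T f X x d)"

definition iter_dirderiv ::
    "(real \<Rightarrow> 'e \<Rightarrow> 'e) \<Rightarrow> (complex \<Rightarrow> 'v \<Rightarrow> 'v) \<Rightarrow> 'v topology \<Rightarrow> 'e::ab_group_add list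
      \<Rightarrow> ('e \<Rightarrow> 'v::ab_group_add) \<Rightarrow> 'e \<Rightarrow> 'v" where
  "iter_dirderiv sc s T Xs f = foldr (dirderiv sc s T) Xs f"

definition cinf_on ::
    "(real \<Rightarrow> 'e \<Rightarrow> 'e) \<Rightarrow> (complex \<Rightarrow> 'v \<Rightarrow> 'v) \<Rightarrow> 'v topology \<Rightarrow> 'e set
      \<Rightarrow> ('e::{ab_group_add,topological_space} \<Rightarrow> 'v::ab_group_add) \<Rightarrow> bool" where
  "cinf_on sc s T U f \<longleftrightarrow>
     (\<forall>Xs. continuous_map (top_of_set U) T (iter_dirderiv sc s T Xs f) \<and>
           (\<forall>X. \<forall>x\<in>U. \<exists>d. has_dirderiv sc s T (iter_dirderiv sc s T Xs f) X x d))"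

definition locally_constant_on :: "'e::topological_space set \<Rightarrow> ('e \<Rightarrow> 'b) \<Rightarrow> bool" where
  "locally_constant_on U f \<longleftrightarrow> (\<forall>x\<in>U. \<exists>N. open N \<and> x \<in> N \<and> (\<forall>y\<in>N \<inter> U. f y = f x))"

text \<open>Complex-valued smooth functions on an open subset of the field or of the matrix space.\<close>

definition smooth_onF :: "'a::local_field_char_0 set \<Rightarrow> ('a \<Rightarrow> complex) \<Rightarrow> bool" where
  "smooth_onF U f \<longleftrightarrow>
     (if archimedean TYPE('a) then cinf_on scaleF (*) euclidean U f else locally_constant_on U f)"

definition smooth_onM ::
    "('a::local_field_char_0^'n^'n) set \<Rightarrow> ('a^'n^'n \<Rightarrow> complex) \<Rightarrow> bool" where
  "smooth_onM U f \<longleftrightarrow>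
     (if archimedean TYPE('a) then cinf_on scaleM (*) euclidean U f else locally_constant_on U f)"

definition schwartz_bruhat :: "('a::local_field_char_0^'n^'n \<Rightarrow> complex) set" where
  "schwartz_bruhat =
     {f. smooth_onM UNIV f \<and>
         (if archimedean TYPE('a) then
            \<forall>Xs N. \<exists>C. \<forall>x. (1 + (\<Sum>i\<in>UNIV. \<Sum>j\<in>UNIV. absF (x $ i $ j))) ^ N *
                           cmod (iter_dirderiv scaleM (*) euclidean Xs f x) \<le> C
          else \<exists>K. compact K \<and> (\<forall>x. x \<notin> K \<longrightarrow> f x = 0))}"

text \<open>Functions on \<open>GL\<^sub>n(F)\<close> are functions on all matrices whose values off \<open>GL\<^sub>n(F)\<close> are
  irrelevant.\<close>

definition schwartz_std :: "('a::local_field_char_0^'n^'n \<Rightarrow> complex) set" where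
  "schwartz_std =
     {\<xi>. smooth_onM GL \<xi> \<and>
         (\<exists>f\<in>schwartz_bruhat. \<forall>g\<in>GL.
            complex_of_real (absF (det g) powr (- real CARD('n) / 2)) * \<xi> g = f g)}"


section \<open>Representations\<close>

text \<open>Representations act on a subspace \<open>V\<close> of a complex vector space with scalar multiplication
  \<open>s\<close>; the operators \<open>\<pi> g\<close> matter only for \<open>g\<close> in \<open>GL\<^sub>n(F)\<close> and on \<open>V\<close>.\<close>

definition lin_on ::
    "(complex \<Rightarrow> 'v \<Rightarrow> 'v) \<Rightarrow> (complex \<Rightarrow> 'w \<Rightarrow> 'w) \<Rightarrow> 'v set \<Rightarrow>
      ('v::ab_group_add \<Rightarrow> 'w::ab_group_add) \<Rightarrow> bool" where
  "lin_on s s' V f \<longleftrightarrow>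
     (\<forall>v\<in>V. \<forall>w\<in>V. f (v + w) = f v + f w) \<and> (\<forall>c. \<forall>v\<in>V. f (s c v) = s' c (f v))"

definition is_rep ::
    "(complex \<Rightarrow> 'v \<Rightarrow> 'v) \<Rightarrow> 'v set \<Rightarrow> ('a::local_field_char_0^'n^'n \<Rightarrow> 'v \<Rightarrow> 'v::ab_group_add)
      \<Rightarrow> bool" where
  "is_rep s V \<pi> \<longleftrightarrow>
     vector_space s \<and> module.subspace s V \<and>
     (\<forall>g\<in>GL. \<pi> g ` V \<subseteq> V \<and> lin_on s s V (\<pi> g)) \<and>
     (\<forall>v\<in>V. \<pi> (mat 1) v = v) \<and>
     (\<forall>g\<in>GL. \<forall>h\<in>GL. \<forall>v\<in>V. \<pi> (g ** h) v = \<pi> g (\<pi> h v))"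

definition invariant_subspace ::
    "(complex \<Rightarrow> 'v \<Rightarrow> 'v) \<Rightarrow> 'v set \<Rightarrow> ('a^'n^'n) set \<Rightarrow>
      ('a::local_field_char_0^'n^'n \<Rightarrow> 'v \<Rightarrow> 'v::ab_group_add) \<Rightarrow> 'v set \<Rightarrow> bool" where
  "invariant_subspace s V H \<pi> W \<longleftrightarrow>
     W \<subseteq> V \<and> module.subspace s W \<and> (\<forall>h\<in>H. \<pi> h ` W \<subseteq> W)"

definition irreducible_smooth_rep ::
    "(complex \<Rightarrow> 'v \<Rightarrow> 'v) \<Rightarrow> 'v set \<Rightarrow> ('a::local_field_char_0^'n^'n \<Rightarrow> 'v \<Rightarrow> 'v::ab_group_add)
      \<Rightarrow> bool" where
  "irreducible_smooth_rep s V \<pi> \<longleftrightarrow>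
     is_rep s V \<pi> \<and>
     (\<forall>v\<in>V. open {g \<in> GL. \<pi> g v = v}) \<and>
     V \<noteq> {0} \<and> (\<forall>W. invariant_subspace s V GL \<pi> W \<longrightarrow> W = {0} \<or> W = V)"

subsection \<open>Casselman-Wallach representations\<close>

definition seminorm_on ::
    "(complex \<Rightarrow> 'v \<Rightarrow> 'v) \<Rightarrow> 'v set \<Rightarrow> ('v::ab_group_add \<Rightarrow> real) \<Rightarrow> bool" where
  "seminorm_on s V p \<longleftrightarrow>
     (\<forall>v\<in>V. 0 \<le> p v) \<and> (\<forall>v\<in>V. \<forall>w\<in>V. p (v + w) \<le> p v + p w) \<and>
     (\<forall>c. \<forall>v\<in>V. p (s c v) = cmod c * p v)"

definition frechet_space ::
    "(complex \<Rightarrow> 'v \<Rightarrow> 'v) \<Rightarrow> 'v set \<Rightarrow> 'v::ab_group_add topology \<Rightarrow> bool" where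
  "frechet_space s V T \<longleftrightarrow>
     vector_space s \<and> module.subspace s V \<and>
     (\<exists>p :: nat \<Rightarrow> 'v \<Rightarrow> real.
        (\<forall>k. seminorm_on s V (p k)) \<and>
        (\<forall>v\<in>V. (\<forall>k. p k v = 0) \<longrightarrow> v = 0) \<and>
        (\<forall>U. openin T U \<longleftrightarrow>
           U \<subseteq> V \<and> (\<forall>v\<in>U. \<exists>N. \<exists>\<epsilon>>0. \<forall>w\<in>V. (\<forall>k\<le>N. p k (w - v) < \<epsilon>) \<longrightarrow> w \<in> U)) \<and>
        (\<forall>X. (\<forall>i. X i \<in> V) \<longrightarrow>
             (\<forall>k. \<forall>\<epsilon>>0. \<exists>M. \<forall>i\<ge>M. \<forall>j\<ge>M. p k (X i - X j) < \<epsilon>) \<longrightarrow>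
             (\<exists>v. limitin T X v sequentially)))"

definition moderate_growth ::
    "(complex \<Rightarrow> 'v \<Rightarrow> 'v) \<Rightarrow> 'v set \<Rightarrow> 'v topology \<Rightarrow>
      ('a::local_field_char_0^'n^'n \<Rightarrow> 'v \<Rightarrow> 'v::ab_group_add) \<Rightarrow> bool" where
  "moderate_growth s V T \<pi> \<longleftrightarrow>
     (\<forall>p. seminorm_on s V p \<and> continuous_map T euclideanreal p \<longrightarrow>
        (\<exists>q N. seminorm_on s V q \<and> continuous_map T euclideanreal q \<and>
           (\<forall>g\<in>GL. \<forall>v\<in>V. p (\<pi> g v) \<le> gl_norm g ^ N * q v)))"

definition finite_dim :: "(complex \<Rightarrow> 'v \<Rightarrow> 'v) \<Rightarrow> 'v::ab_group_add set \<Rightarrow> bool" where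
  "finite_dim s W \<longleftrightarrow> (\<exists>B. finite B \<and> W \<subseteq> module.span s B)"

definition K_finite ::
    "(complex \<Rightarrow> 'v \<Rightarrow> 'v) \<Rightarrow> 'v set \<Rightarrow> ('a::local_field_char_0^'n^'n \<Rightarrow> 'v \<Rightarrow> 'v::ab_group_add)
      \<Rightarrow> 'v set" where
  "K_finite s V \<pi> = {v \<in> V. finite_dim s ((\<lambda>k. \<pi> k v) ` max_compact)}"

definition K_isomorphic ::
    "(complex \<Rightarrow> 'v \<Rightarrow> 'v) \<Rightarrow> ('a::local_field_char_0^'n^'n \<Rightarrow> 'v \<Rightarrow> 'v::ab_group_add)
      \<Rightarrow> 'v set \<Rightarrow> 'v set \<Rightarrow> bool" where
  "K_isomorphic s \<pi> E E' \<longleftrightarrow>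
     (\<exists>f. lin_on s s E f \<and> bij_betw f E E' \<and> (\<forall>k\<in>max_compact. \<forall>v\<in>E. f (\<pi> k v) = \<pi> k (f v)))"

text \<open>Every irreducible representation of the maximal compact subgroup occurs with finite
  multiplicity, that is, every isotypic component is finite-dimensional.\<close>

definition admissible ::
    "(complex \<Rightarrow> 'v \<Rightarrow> 'v) \<Rightarrow> 'v set \<Rightarrow> ('a::local_field_char_0^'n^'n \<Rightarrow> 'v \<Rightarrow> 'v::ab_group_add)
      \<Rightarrow> bool" where
  "admissible s V \<pi> \<longleftrightarrow>
     (\<forall>E. invariant_subspace s V max_compact \<pi> E \<and> finite_dim s E \<and> E \<noteq> {0} \<and>
          (\<forall>W. invariant_subspace s E max_compact \<pi> W \<longrightarrow> W = {0} \<or> W = E) \<longrightarrow>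
        finite_dim s (\<Union>{E'. invariant_subspace s V max_compact \<pi> E' \<and> K_isomorphic s \<pi> E E'}))"

text \<open>Submodules of the Harish-Chandra module of \<open>K\<close>-finite vectors; an element \<open>X\<close> of the Lie
  algebra acts by the derivative of the representation at the identity in the direction \<open>X\<close>.\<close>

definition HC_submodule ::
    "(complex \<Rightarrow> 'v \<Rightarrow> 'v) \<Rightarrow> 'v set \<Rightarrow> 'v topology \<Rightarrow>
      ('a::local_field_char_0^'n^'n \<Rightarrow> 'v \<Rightarrow> 'v::ab_group_add) \<Rightarrow> 'v set \<Rightarrow> bool" where
  "HC_submodule s V T \<pi> M \<longleftrightarrow>
     invariant_subspace s (K_finite s V \<pi>) max_compact \<pi> M \<and>
     (\<forall>X. \<forall>v\<in>M. dirderiv scaleM s T X (\<lambda>g. \<pi> g v) (mat 1) \<in> M)"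

definition HC_finite_length ::
    "(complex \<Rightarrow> 'v \<Rightarrow> 'v) \<Rightarrow> 'v set \<Rightarrow> 'v topology \<Rightarrow>
      ('a::local_field_char_0^'n^'n \<Rightarrow> 'v \<Rightarrow> 'v::ab_group_add) \<Rightarrow> bool" where
  "HC_finite_length s V T \<pi> \<longleftrightarrow>
     (\<exists>(l::nat) M. M 0 = {0} \<and> M l = K_finite s V \<pi> \<and> (\<forall>i\<le>l. HC_submodule s V T \<pi> (M i)) \<and>
        (\<forall>i<l. M i \<subset> M (Suc i) \<and>
           (\<forall>N. HC_submodule s V T \<pi> N \<longrightarrow> M i \<subseteq> N \<longrightarrow> N \<subseteq> M (Suc i) \<longrightarrow>
                N = M i \<or> N = M (Suc i))))"

definition casselman_wallach ::
    "(complex \<Rightarrow> 'v \<Rightarrow> 'v) \<Rightarrow> 'v set \<Rightarrow> 'v topology \<Rightarrow>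
      ('a::local_field_char_0^'n^'n \<Rightarrow> 'v \<Rightarrow> 'v::ab_group_add) \<Rightarrow> bool" where
  "casselman_wallach s V T \<pi> \<longleftrightarrow>
     is_rep s V \<pi> \<and> frechet_space s V T \<and>
     continuous_map (prod_topology (top_of_set GL) T) T (\<lambda>(g, v). \<pi> g v) \<and>
     (\<forall>v\<in>V. cinf_on scaleM s T GL (\<lambda>g. \<pi> g v)) \<and>
     moderate_growth s V T \<pi> \<and> admissible s V \<pi> \<and> HC_finite_length s V T \<pi>"

definition irreducible_casselman_wallach ::
    "(complex \<Rightarrow> 'v \<Rightarrow> 'v) \<Rightarrow> 'v set \<Rightarrow> 'v topology \<Rightarrow>
      ('a::local_field_char_0^'n^'n \<Rightarrow> 'v \<Rightarrow> 'v::ab_group_add) \<Rightarrow> bool" where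
  "irreducible_casselman_wallach s V T \<pi> \<longleftrightarrow>
     casselman_wallach s V T \<pi> \<and> V \<noteq> {0} \<and>
     (\<forall>W. invariant_subspace s V GL \<pi> W \<and> closedin T W \<longrightarrow> W = {0} \<or> W = V)"

text \<open>\<open>(s, V, T, \<pi>)\<close> represents a class in \<open>\<Pi>\<^sub>F(n)\<close>.  The topology \<open>T\<close> is part of the data only
  over an Archimedean field.\<close>

definition in_PiF ::
    "(complex \<Rightarrow> 'v \<Rightarrow> 'v) \<Rightarrow> 'v set \<Rightarrow> 'v topology \<Rightarrow>
      ('a::local_field_char_0^'n^'n \<Rightarrow> 'v \<Rightarrow> 'v::ab_group_add) \<Rightarrow> bool" where
  "in_PiF s V T \<pi> \<longleftrightarrow>
     (if archimedean TYPE('a) then irreducible_casselman_wallach s V T \<pi>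
      else irreducible_smooth_rep s V \<pi>)"

subsection \<open>Smooth contragredient and matrix coefficients\<close>

definition fun_scale :: "complex \<Rightarrow> ('v \<Rightarrow> complex) \<Rightarrow> 'v \<Rightarrow> complex" where
  "fun_scale c l = (\<lambda>v. c * l v)"

text \<open>Linear functionals on \<open>V\<close>, extended by zero outside \<open>V\<close>.\<close>

definition dual_space ::
    "(complex \<Rightarrow> 'v \<Rightarrow> 'v) \<Rightarrow> 'v set \<Rightarrow> ('v::ab_group_add \<Rightarrow> complex) set" where
  "dual_space s V = {l. lin_on s (*) V l \<and> (\<forall>v. v \<notin> V \<longrightarrow> l v = 0)}"

definition dual_rep ::
    "'v set \<Rightarrow> ('a::local_field_char_0^'n^'n \<Rightarrow> 'v \<Rightarrow> 'v::ab_group_add)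
      \<Rightarrow> 'a^'n^'n \<Rightarrow> ('v \<Rightarrow> complex) \<Rightarrow> 'v \<Rightarrow> complex" where
  "dual_rep V \<pi> g l = (\<lambda>v. if v \<in> V then l (\<pi> (matrix_inv g) v) else 0)"

definition cont_dual ::
    "(complex \<Rightarrow> 'v \<Rightarrow> 'v) \<Rightarrow> 'v set \<Rightarrow> 'v::ab_group_add topology \<Rightarrow> ('v \<Rightarrow> complex) set" where
  "cont_dual s V T = {l \<in> dual_space s V. continuous_map T euclidean l}"

text \<open>Over an Archimedean field the smooth contragredient is the Casselman-Wallach globalization of
  the contragredient Harish-Chandra module.  The latter consists of the \<open>K\<close>-finite continuous
  functionals, and the globalization is realized inside the continuous dual; it is unique by the
  Casselman-Wallach theorem, so the union below has one member.\<close>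

definition smooth_contragredient ::
    "(complex \<Rightarrow> 'v \<Rightarrow> 'v) \<Rightarrow> 'v set \<Rightarrow> 'v topology \<Rightarrow>
      ('a::local_field_char_0^'n^'n \<Rightarrow> 'v \<Rightarrow> 'v::ab_group_add) \<Rightarrow> ('v \<Rightarrow> complex) set" where
  "smooth_contragredient s V T \<pi> =
     (if archimedean TYPE('a) then
        \<Union>{W. W \<subseteq> cont_dual s V T \<and>
            K_finite fun_scale W (dual_rep V \<pi>) = K_finite fun_scale (cont_dual s V T) (dual_rep V \<pi>) \<and>
            (\<exists>T'. casselman_wallach fun_scale W T' (dual_rep V \<pi>) \<and>
                  (\<forall>v\<in>V. continuous_map T' euclidean (\<lambda>l. l v)))}
      else {l \<in> dual_space s V. open {g \<in> GL. dual_rep V \<pi> g l = l}})"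

text \<open>The span of the functions \<open>g \<mapsto> l (\<pi> g v)\<close> on \<open>GL\<^sub>n(F)\<close>.\<close>

definition matrix_coeffs ::
    "(complex \<Rightarrow> 'v \<Rightarrow> 'v) \<Rightarrow> 'v set \<Rightarrow> 'v topology \<Rightarrow>
      ('a::local_field_char_0^'n^'n \<Rightarrow> 'v \<Rightarrow> 'v::ab_group_add) \<Rightarrow> ('a^'n^'n \<Rightarrow> complex) set" where
  "matrix_coeffs s V T \<pi> =
     {\<phi>. \<exists>(m::nat) v l. (\<forall>i<m. v i \<in> V \<and> l i \<in> smooth_contragredient s V T \<pi>) \<and>
          (\<forall>g\<in>GL. \<phi> g = (\<Sum>i<m. l i (\<pi> g (v i))))}"

end

theory Submission
  imports Defs
begin

text \<open>Write \<open>d(x)\<close> for the diagonal matrix with entries \<open>x, 1, \<dots>, 1\<close>. It has determinant \<open>x\<close>, so by left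
  invariance of \<open>\<mu>\<close> the measure on the fiber \<open>det g = x\<close> is the image of \<open>\<mu>\<close> under \<open>g \<mapsto> d(x) g\<close>
  (\<open>fiber_measure_diag_one\<close>). Thus the fiber integral is \<open>\<integral> \<Phi>(d(x) g) d\<mu>(g)\<close> over \<open>SL\<^sub>n(F)\<close> with
  \<open>\<Phi> = \<xi> \<phi>\<close>: the domain of integration and the measure no longer depend on \<open>x\<close>.
  
  If \<open>F\<close> is non-Archimedean, \<open>\<xi>\<close> vanishes on \<open>GL\<^sub>n(F)\<close> outside a compact set of matrices, and a fiber is
  closed in the space of all matrices; hence \<open>\<Phi>\<close> restricted to a fiber is continuous with compact
  support. The function \<open>\<Phi>\<close> and the Schwartz-Bruhat function behind \<open>\<xi>\<close> are locally constant, so by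
  compactness neither changes on a given fiber when \<open>g\<close> is replaced by \<open>d(t) g\<close> with \<open>t\<close> close to \<open>1\<close>
  (\<open>eventually_diag_one_invariant_on_compact\<close>, \<open>eventually_diag_one_invariant\<close>). So the integral
  is locally constant in \<open>x\<close>.
  
  If \<open>F\<close> is Archimedean, compactness is replaced by growth estimates. A matrix coefficient is bounded by a
  power of the norms of \<open>g\<close> and \<open>g\<^sup>-\<^sup>1\<close>, and the same holds for all its derivatives: by
  \<open>\<pi>(g + t X) = \<pi>(g) \<pi>(1 + t g\<^sup>-\<^sup>1 X)\<close>, a derivative of \<open>g \<mapsto> l(\<pi>(g) v)\<close> is a combination of the
  coefficients \<open>l(\<pi>(g) v\<^sub>e)\<close>, where \<open>v\<^sub>e\<close> are the derivatives of \<open>v\<close> along a basis of the Lie algebra and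
  the factors are real and imaginary parts of entries of \<open>g\<^sup>-\<^sup>1 X\<close> (\<open>matrix_coeff_Ck\<close>). Therefore
  \<open>\<Phi>\<close> and all its derivatives decay faster than any power of \<open>g\<close>, locally uniformly in \<open>det g\<close>
  (\<open>schwartz_std_Ck\<close>, \<open>Ck_in_mult\<close>).
  
  Such functions are integrable over \<open>SL\<^sub>n(F)\<close> because the Haar measure of a ball grows polynomially in
  the radius: a ball is covered by polynomially many translates of one compact set, found by rounding the
  matrix entries to a sufficiently fine grid (\<open>haar_ball_le\<close>, \<open>integrable_inverse_entry_norm\<close>). This
  gives absolute convergence and allows differentiation under the integral sign. The derivative of
  \<open>\<Phi>(d(x) g)\<close> in \<open>x\<close> is again the value at \<open>d(x) g\<close> of a function of the same kind
  (\<open>slice_integral_dirderiv\<close>), and induction gives smoothness.\<close>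

section \<open>Local fields as topological fields\<close>

lemma is_arch_emb_D:
  assumes "is_arch_emb \<iota>"
  shows "\<iota> (x + y) = \<iota> x + \<iota> y" "\<iota> (x * y) = \<iota> x * \<iota> y" "\<iota> 1 = 1" "\<iota> 0 = 0" "\<iota> (- x) = - \<iota> x"
    "\<iota> (x - y) = \<iota> x - \<iota> y" "\<iota> x = 0 \<longleftrightarrow> x = 0" "inj \<iota>"
    "range \<iota> = \<real> \<or> range \<iota> = UNIV" "open U \<longleftrightarrow> openin (top_of_set (range \<iota>)) (\<iota> ` U)"
proof -
  show 1: "\<iota> (x + y) = \<iota> x + \<iota> y" "\<iota> 1 = 1" "range \<iota> = \<real> \<or> range \<iota> = UNIV"
    "open U \<longleftrightarrow> openin (top_of_set (range \<iota>)) (\<iota> ` U)" for x y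
    using assms by (auto simp: is_arch_emb_def)
  show 2: "\<iota> (x * y) = \<iota> x * \<iota> y" for x y
    using assms by (auto simp: is_arch_emb_def)
  show 3: "\<iota> 0 = 0" using 1(1)[of 0 0] by simp
  show 4: "\<iota> (- x) = - \<iota> x" for x using 1(1)[of x "-x"] 3 by (simp add: eq_neg_iff_add_eq_0 add.commute)
  show 5: "\<iota> (x - y) = \<iota> x - \<iota> y" for x y using 1(1)[of x "-y"] 4 by simp
  show 6: "\<iota> x = 0 \<longleftrightarrow> x = 0" for x
  proof -
    have "\<iota> x \<noteq> 0" if "x \<noteq> 0"
      using 2[of x "inverse x"] that 1(2) by auto
    then show ?thesis using 3 by auto
  qed
  show "inj \<iota>"
    by (rule injI) (metis 5 6 eq_iff_diff_eq_0)
qed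

lemma arch_emb_open_vimage:
  assumes "is_arch_emb (\<iota> :: 'a::field_with_topology \<Rightarrow> complex)" "open S"
  shows "open (\<iota> -` S)"
proof -
  have "\<iota> ` (\<iota> -` S) = range \<iota> \<inter> S" by auto
  then show ?thesis
    unfolding is_arch_emb_D(10)[OF assms(1)] using assms(2) by (auto simp: openin_open_Int)
qed

text \<open>An embedding is a homeomorphism onto its image, so that convergence can be tested after embedding.\<close>

lemma arch_emb_tendsto_iff:
  assumes "is_arch_emb (\<iota> :: 'a::field_with_topology \<Rightarrow> complex)"
  shows "(f \<longlongrightarrow> l) F \<longleftrightarrow> ((\<lambda>x. \<iota> (f x)) \<longlongrightarrow> \<iota> l) F"
proof
  assume f: "(f \<longlongrightarrow> l) F"
  show "((\<lambda>x. \<iota> (f x)) \<longlongrightarrow> \<iota> l) F"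
  proof (rule topological_tendstoI)
    fix S :: "complex set" assume S: "open S" "\<iota> l \<in> S"
    have "open (\<iota> -` S)" by (rule arch_emb_open_vimage[OF assms S(1)])
    then show "eventually (\<lambda>x. \<iota> (f x) \<in> S) F"
      using topological_tendstoD[OF f, of "\<iota> -` S"] S by auto
  qed
next
  note D = is_arch_emb_D[OF assms]
  assume f: "((\<lambda>x. \<iota> (f x)) \<longlongrightarrow> \<iota> l) F"
  show "(f \<longlongrightarrow> l) F"
  proof (rule topological_tendstoI)
    fix S assume S: "open S" "l \<in> S"
    then obtain O' where O': "open O'" "\<iota> ` S = range \<iota> \<inter> O'"
      unfolding D(10) by (auto simp: openin_open)
    have "eventually (\<lambda>x. \<iota> (f x) \<in> O') F"
      using topological_tendstoD[OF f, of O'] O' S by auto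
    then show "eventually (\<lambda>x. f x \<in> S) F"
      by eventually_elim (use O' D(8) in \<open>metis IntI inj_image_mem_iff rangeI\<close>)
  qed
qed

context
  fixes v :: "'a::field_with_topology \<Rightarrow> int"
  assumes v: "is_nonarch_val v"
begin

lemma nonarch_val_mult: "x \<noteq> 0 \<Longrightarrow> y \<noteq> 0 \<Longrightarrow> v (x * y) = v x + v y"
  using v by (auto simp: is_nonarch_val_def)

lemma nonarch_val_one: "v 1 = 0"
  using nonarch_val_mult[of 1 1] by simp

lemma nonarch_val_minus: "v (- x) = v x"
proof -
  have "v (- 1) = 0" using nonarch_val_mult[of "-1" "-1"] nonarch_val_one by simp
  then show ?thesis using nonarch_val_mult[of "-1" x] by (cases "x = 0") auto
qed

lemma val_ge_zero [simp]: "0 \<in> val_ge v N"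
  by (simp add: val_ge_def)

lemma val_ge_add: "x \<in> val_ge v N \<Longrightarrow> y \<in> val_ge v N \<Longrightarrow> x + y \<in> val_ge v N"
  using v unfolding val_ge_def is_nonarch_val_def
  by (smt (verit, best) add_0 add_0_right mem_Collect_eq)

lemma val_ge_minus: "x \<in> val_ge v N \<Longrightarrow> - x \<in> val_ge v N"
  by (auto simp: val_ge_def nonarch_val_minus)

lemma val_ge_mult: "x \<in> val_ge v N \<Longrightarrow> y \<in> val_ge v M \<Longrightarrow> x * y \<in> val_ge v (N + M)"
  using nonarch_val_mult by (force simp: val_ge_def)

lemma val_ge_mono: "N \<le> M \<Longrightarrow> x \<in> val_ge v M \<Longrightarrow> x \<in> val_ge v N"
  by (auto simp: val_ge_def)

lemma open_iff_val_ge: "open U \<longleftrightarrow> (\<forall>x\<in>U. \<exists>N. \<forall>y. y - x \<in> val_ge v N \<longrightarrow> y \<in> U)"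
  using v by (auto simp: is_nonarch_val_def)

text \<open>By the ultrametric inequality every point of a ball is a center of it.\<close>

lemma open_val_ball: "open {y. y - l \<in> val_ge v N}"
  unfolding open_iff_val_ge
proof (intro ballI exI[of _ N] allI impI)
  fix x y assume "x \<in> {y. y - l \<in> val_ge v N}" "y - x \<in> val_ge v N"
  then have "(y - x) + (x - l) \<in> val_ge v N" by (intro val_ge_add) auto
  then show "y \<in> {y. y - l \<in> val_ge v N}" by simp
qed

lemma nonarch_tendsto_iff:
  "(f \<longlongrightarrow> l) F \<longleftrightarrow> (\<forall>N. eventually (\<lambda>x. f x - l \<in> val_ge v N) F)"
proof
  show "\<forall>N. eventually (\<lambda>x. f x - l \<in> val_ge v N) F" if "(f \<longlongrightarrow> l) F"
    using topological_tendstoD[OF that open_val_ball] by simp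
  show "(f \<longlongrightarrow> l) F" if *: "\<forall>N. eventually (\<lambda>x. f x - l \<in> val_ge v N) F"
  proof (rule topological_tendstoI)
    fix S assume "open S" "l \<in> S"
    then obtain N where N: "\<forall>y. y - l \<in> val_ge v N \<longrightarrow> y \<in> S"
      using open_iff_val_ge[of S] by blast
    show "eventually (\<lambda>x. f x \<in> S) F"
      using *[rule_format, of N] by eventually_elim (use N in auto)
  qed
qed

lemma nonarch_tendsto_mult:
  fixes a b :: 'a
  assumes "(f \<longlongrightarrow> a) F" "(g \<longlongrightarrow> b) F"
  shows "((\<lambda>x. f x * g x) \<longlongrightarrow> a * b) F"
  unfolding nonarch_tendsto_iff
proof
  fix N
  \<comment> \<open>Fixes the fractional ideal in which \<open>a\<close>, \<open>b\<close> and all nearby values lie.\<close>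
  define c where "c = min (v a) (v b)"
  have c: "a \<in> val_ge v c" "b \<in> val_ge v c" by (auto simp: val_ge_def c_def)
  have "eventually (\<lambda>x. f x - a \<in> val_ge v (max (N - c) c)) F"
       "eventually (\<lambda>x. g x - b \<in> val_ge v (N - c)) F"
    using assms unfolding nonarch_tendsto_iff by auto
  then show "eventually (\<lambda>x. f x * g x - a * b \<in> val_ge v N) F"
  proof eventually_elim
    case (elim x)
    have "(f x - a) + a \<in> val_ge v c"
      using elim(1) c by (intro val_ge_add) (auto intro: val_ge_mono[of c "max (N-c) c"])
    then have "f x * (g x - b) \<in> val_ge v (c + (N - c))"
      using elim(2) by (intro val_ge_mult) auto
    moreover have "(f x - a) * b \<in> val_ge v ((N - c) + c)"
      using elim(1) c(2) by (intro val_ge_mult) (auto intro: val_ge_mono[of "N-c" "max (N-c) c"])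
    ultimately have "f x * (g x - b) + (f x - a) * b \<in> val_ge v N"
      by (intro val_ge_add) auto
    then show ?case by (simp add: algebra_simps)
  qed
qed

lemma nonarch_tendsto_add:
  fixes a b :: 'a
  assumes "(f \<longlongrightarrow> a) F" "(g \<longlongrightarrow> b) F"
  shows "((\<lambda>x. f x + g x) \<longlongrightarrow> a + b) F"
  unfolding nonarch_tendsto_iff
proof
  fix N
  have "eventually (\<lambda>x. f x - a \<in> val_ge v N) F" "eventually (\<lambda>x. g x - b \<in> val_ge v N) F"
    using assms unfolding nonarch_tendsto_iff by auto
  then show "eventually (\<lambda>x. f x + g x - (a + b) \<in> val_ge v N) F"
    by eventually_elim (use val_ge_add in \<open>fastforce simp: algebra_simps\<close>)
qed

lemma nonarch_hausdorff:
  fixes x y :: 'a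
  assumes "x \<noteq> y"
  shows "\<exists>U V. open U \<and> open V \<and> x \<in> U \<and> y \<in> V \<and> U \<inter> V = {}"
proof -
  define N where "N = v (x - y) + 1"
  have "{z. z - x \<in> val_ge v N} \<inter> {z. z - y \<in> val_ge v N} = {}"
  proof (rule ccontr)
    assume "\<not> ?thesis"
    then obtain z where "z - x \<in> val_ge v N" "z - y \<in> val_ge v N" by auto
    then have "- (z - x) + (z - y) \<in> val_ge v N" by (intro val_ge_add val_ge_minus)
    then show False using assms by (auto simp: val_ge_def N_def)
  qed
  then show ?thesis
    using open_val_ball by (intro exI[of _ "{z. z - x \<in> val_ge v N}"] exI[of _ "{z. z - y \<in> val_ge v N}"]) auto
qed

end

lemma local_field_cases:
  obtains (arch) \<iota> where "is_arch_emb (\<iota> :: 'a::local_field_char_0 \<Rightarrow> complex)"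
    | (nonarch) v where "is_nonarch_val (v :: 'a \<Rightarrow> int)"
  using local_field by blast

lemma tendsto_add_F:
  fixes a :: "'a::local_field_char_0"
  assumes "(f \<longlongrightarrow> a) F" "(g \<longlongrightarrow> b) F"
  shows "((\<lambda>x. f x + g x) \<longlongrightarrow> a + b) F"
proof (cases rule: local_field_cases[where 'a='a])
  case (arch \<iota>)
  then show ?thesis using assms by (auto simp: arch_emb_tendsto_iff[OF arch] is_arch_emb_D(1)[OF arch] intro: tendsto_add)
next
  case (nonarch v)
  then show ?thesis using assms by (rule nonarch_tendsto_add)
qed

lemma tendsto_mult_F:
  fixes a :: "'a::local_field_char_0"
  assumes "(f \<longlongrightarrow> a) F" "(g \<longlongrightarrow> b) F"
  shows "((\<lambda>x. f x * g x) \<longlongrightarrow> a * b) F"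
proof (cases rule: local_field_cases[where 'a='a])
  case (arch \<iota>)
  then show ?thesis using assms by (auto simp: arch_emb_tendsto_iff[OF arch] is_arch_emb_D(2)[OF arch] intro: tendsto_mult)
next
  case (nonarch v)
  then show ?thesis using assms by (rule nonarch_tendsto_mult)
qed

lemma filterlim_nhds_prod:
  "filterlim fst (nhds a) (nhds a \<times>\<^sub>F nhds b)" "filterlim snd (nhds b) (nhds a \<times>\<^sub>F nhds b)"
  by (simp_all add: filterlim_fst filterlim_snd)

text \<open>These instances make the library's results on continuity of sums and products available over any
  local field, without choosing a metric on it.\<close>

instance local_field_char_0 \<subseteq> t2_space
proof
  fix x y :: 'a assume ne: "x \<noteq> y"
  show "\<exists>U V. open U \<and> open V \<and> x \<in> U \<and> y \<in> V \<and> U \<inter> V = {}"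
  proof (cases rule: local_field_cases[where 'a='a])
    case (arch \<iota>)
    note D = is_arch_emb_D[OF arch]
    have "\<iota> x \<noteq> \<iota> y" using ne injD[OF D(8)] by metis
    then obtain U V where UV: "open U" "open V" "\<iota> x \<in> U" "\<iota> y \<in> V" "U \<inter> V = {}"
      using hausdorff by metis
    then show ?thesis using arch_emb_open_vimage[OF arch]
      by (intro exI[of _ "\<iota> -` U"] exI[of _ "\<iota> -` V"]) auto
  next
    case (nonarch v)
    then show ?thesis using ne by (rule nonarch_hausdorff)
  qed
qed

instance local_field_char_0 \<subseteq> topological_ab_group_add
proof
  fix a b :: 'a
  show "LIM x (nhds a \<times>\<^sub>F nhds b). fst x + snd x :> nhds (a + b)"
    by (intro tendsto_add_F filterlim_nhds_prod)
  have "((\<lambda>x. (-1) * x) \<longlongrightarrow> (-1) * a) (nhds a)"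
    by (intro tendsto_mult_F tendsto_const) (simp add: filterlim_ident)
  then show "(uminus \<longlongrightarrow> - a) (nhds a)" by simp
qed

instance local_field_char_0 \<subseteq> topological_comm_monoid_mult
proof
  fix a b :: 'a
  show "LIM x (nhds a \<times>\<^sub>F nhds b). fst x * snd x :> nhds (a * b)"
    by (intro tendsto_mult_F filterlim_nhds_prod)
qed

section \<open>Matrices and the measures on the fibers of the determinant\<close>

text \<open>Compact sets of matrices have to be closed, in order to be measurable; hence the separation axioms for
  spaces of vectors.\<close>

instance vec :: (t0_space, finite) t0_space
proof
  fix x y :: "'a^'b" assume "x \<noteq> y"
  then obtain i where "x $ i \<noteq> y $ i" by (auto simp: vec_eq_iff)
  then obtain U where U: "open U" "\<not> (x $ i \<in> U \<longleftrightarrow> y $ i \<in> U)"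
    by (meson separation_t0)
  then show "\<exists>U. open U \<and> \<not> (x \<in> U \<longleftrightarrow> y \<in> U)"
    by (intro exI[of _ "(\<lambda>z. z $ i) -` U"]) (auto intro!: open_vimage_vec_nth)
qed

instance vec :: (t1_space, finite) t1_space
proof
  fix x y :: "'a^'b" assume "x \<noteq> y"
  then obtain i where "x $ i \<noteq> y $ i" by (auto simp: vec_eq_iff)
  then obtain U where U: "open U" "x $ i \<in> U" "y $ i \<notin> U"
    by (meson separation_t1)
  then show "\<exists>U. open U \<and> x \<in> U \<and> y \<notin> U"
    by (intro exI[of _ "(\<lambda>z. z $ i) -` U"]) (auto intro!: open_vimage_vec_nth)
qed

instance vec :: (t2_space, finite) t2_space
proof
  fix x y :: "'a^'b" assume "x \<noteq> y"
  then obtain i where "x $ i \<noteq> y $ i" by (auto simp: vec_eq_iff)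
  then obtain U V where UV: "open U" "open V" "x $ i \<in> U" "y $ i \<in> V" "U \<inter> V = {}"
    using hausdorff by metis
  show "\<exists>U V. open U \<and> open V \<and> x \<in> U \<and> y \<in> V \<and> U \<inter> V = {}"
    using UV by (intro exI[of _ "(\<lambda>z. z $ i) -` U"] exI[of _ "(\<lambda>z. z $ i) -` V"])
      (auto intro!: open_vimage_vec_nth)
qed

lemma continuous_on_matrix_mult [continuous_intros]:
  fixes f g :: "'b::topological_space \<Rightarrow> 'a::local_field_char_0^'n^'n"
  assumes "continuous_on S f" "continuous_on S g"
  shows "continuous_on S (\<lambda>x. f x ** g x)"
  unfolding matrix_matrix_mult_def using assms by (intro continuous_intros)

lemma continuous_on_det [continuous_intros]:
  fixes f :: "'b::topological_space \<Rightarrow> 'a::local_field_char_0^'n^'n"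
  assumes "continuous_on S f"
  shows "continuous_on S (\<lambda>x. det (f x))"
  unfolding det_def using assms by (intro continuous_intros)

lemma GL_iff_det: "g \<in> GL \<longleftrightarrow> det g \<noteq> 0"
  by (simp add: GL_def invertible_det_nz)

lemma open_GL: "open (GL :: ('a::local_field_char_0^'n^'n) set)"
proof -
  have "open {g :: 'a^'n^'n. det g \<noteq> 0}"
    by (rule open_Collect_neq) (intro continuous_intros)+
  moreover have "GL = {g :: 'a^'n^'n. det g \<noteq> 0}" by (auto simp: GL_iff_det)
  ultimately show ?thesis by simp
qed

lemma closed_det_fiber: "closed {g :: 'a::local_field_char_0^'n^'n. det g = x}"
  by (rule closed_Collect_eq) (intro continuous_intros)+

lemma SL_subset_GL: "SL \<subseteq> GL"
  by (auto simp: SL_def GL_iff_det)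

lemma matrix_inv_GL:
  assumes "g \<in> GL"
  shows "g ** matrix_inv g = mat 1" "matrix_inv g ** g = mat 1"
proof -
  have "\<exists>h. g ** h = mat 1 \<and> h ** g = mat 1" using assms by (simp add: GL_def invertible_def)
  from someI_ex[OF this] show "g ** matrix_inv g = mat 1" "matrix_inv g ** g = mat 1"
    by (auto simp: matrix_inv_def)
qed

text \<open>The place of the nontrivial entry of the diagonal matrices below; any index would do.\<close>

definition distinguished_index :: "'n" where
  "distinguished_index = (SOME i. True)"

definition diag_one :: "'a::local_field_char_0 \<Rightarrow> 'a^'n^'n" where
  "diag_one x = (\<chi> i j. if i = j then (if i = distinguished_index then x else 1) else 0)"

lemma diag_one_mult_entry:
  "(diag_one x ** g) $ i $ j = (if i = distinguished_index then x * g $ i $ j else g $ i $ j)"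
proof -
  have "(diag_one x ** g) $ i $ j = (\<Sum>k\<in>UNIV. if i = k then (if i = distinguished_index then x else 1) * g $ k $ j else 0)"
    unfolding matrix_matrix_mult_def diag_one_def vec_lambda_beta by (rule sum.cong) auto
  then show ?thesis by simp
qed

lemma det_diag_one [simp]: "det (diag_one x :: 'a::local_field_char_0^'n^'n) = x"
proof -
  have "det (diag_one x :: 'a^'n^'n) = (\<Prod>i\<in>UNIV. if i = (distinguished_index :: 'n) then x else 1)"
    by (subst det_diagonal) (auto simp: diag_one_def intro!: prod.cong)
  then show ?thesis by simp
qed

lemma diag_one_mult: "diag_one (x * y) = diag_one x ** diag_one y"
  by (simp add: vec_eq_iff diag_one_mult_entry) (simp add: diag_one_def)

lemma diag_one_one [simp]: "diag_one 1 = mat 1"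
  by (simp add: vec_eq_iff diag_one_def mat_def)

lemma det_diag_one_mult [simp]: "det (diag_one x ** g) = x * det g"
  by (simp add: det_mul)

lemma haar_left_mult_measurable:
  assumes "haar_measure_SL \<mu>" "det h = x"
  shows "(\<lambda>g. h ** g) \<in> measurable \<mu> (restrict_space borel {g. det g = x})"
proof -
  have s: "sets \<mu> = sets (restrict_space borel SL)" using assms by (auto simp: haar_measure_SL_def)
  have "(\<lambda>g. h ** g) \<in> borel_measurable (restrict_space borel SL)"
    by (intro borel_measurable_continuous_on_restrict continuous_intros)
  then have "(\<lambda>g. h ** g) \<in> measurable (restrict_space borel SL) (restrict_space borel {g. det g = x})"
    using assms(2) by (intro measurable_restrict_space2) (auto simp: space_restrict_space SL_def det_mul)
  then show ?thesis using measurable_cong_sets[OF s refl] by blast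
qed

text \<open>Invariance is assumed for the measure of translated sets; under the image measure it becomes invariance
  under \<open>g \<mapsto> k g\<close>, by passing to the inverse translation.\<close>

lemma haar_distr_left_mult:
  assumes \<mu>: "haar_measure_SL \<mu>" and k: "k \<in> SL"
  shows "distr \<mu> \<mu> (\<lambda>g. k ** g) = \<mu>"
proof (rule measure_eqI)
  have s: "sets \<mu> = sets (restrict_space borel {g. det g = 1})" "space \<mu> = SL"
    using \<mu> by (auto simp: haar_measure_SL_def SL_def)
  have m: "(\<lambda>g. h ** g) \<in> measurable \<mu> \<mu>" if "h \<in> SL" for h
    using haar_left_mult_measurable[OF \<mu>, of h 1] that measurable_cong_sets[OF refl s(1), of \<mu>] by (auto simp: SL_def)
  fix A assume "A \<in> sets (distr \<mu> \<mu> (\<lambda>g. k ** g))"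
  then have A: "A \<in> sets \<mu>" by simp
  then have "A \<subseteq> SL" using sets.sets_into_space s(2) by blast
  have kinv: "k ** matrix_inv k = mat 1" "matrix_inv k ** k = mat 1"
    using k SL_subset_GL by (auto intro!: matrix_inv_GL)
  have kS: "matrix_inv k \<in> SL"
    using arg_cong[OF kinv(1), of det] k by (simp add: SL_def det_mul)
  have eq: "(\<lambda>g. k ** g) -` A \<inter> space \<mu> = (\<lambda>g. matrix_inv k ** g) ` A"
  proof (intro equalityI subsetI)
    fix g assume "g \<in> (\<lambda>g. k ** g) -` A \<inter> space \<mu>"
    then show "g \<in> (\<lambda>g. matrix_inv k ** g) ` A"
      by (intro image_eqI[of _ _ "k ** g"]) (auto simp: matrix_mul_assoc kinv)
  next
    fix g assume "g \<in> (\<lambda>g. matrix_inv k ** g) ` A"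
    then obtain a where a: "a \<in> A" "g = matrix_inv k ** a" by auto
    have "k ** g = a" using a by (simp add: matrix_mul_assoc kinv)
    moreover have "g \<in> SL" using a \<open>A \<subseteq> SL\<close> kS by (auto simp: SL_def det_mul)
    ultimately show "g \<in> (\<lambda>g. k ** g) -` A \<inter> space \<mu>" using a s by auto
  qed
  have "emeasure (distr \<mu> \<mu> (\<lambda>g. k ** g)) A = emeasure \<mu> ((\<lambda>g. matrix_inv k ** g) ` A)"
    using A m[OF k] by (simp add: emeasure_distr eq)
  also have "\<dots> = emeasure \<mu> A" using \<mu> A kS by (auto simp: haar_measure_SL_def)
  finally show "emeasure (distr \<mu> \<mu> (\<lambda>g. k ** g)) A = emeasure \<mu> A" .
qed simp

text \<open>Two base points of the fiber differ by right multiplication by an element \<open>k\<close> of \<open>SL\<^sub>n(F)\<close>, which acts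
  on \<open>\<mu>\<close> from the left.\<close>

lemma fiber_measure_diag_one:
  fixes x :: "'a::local_field_char_0"
  assumes \<mu>: "haar_measure_SL (\<mu> :: ('a^'n^'n) measure)" and x: "x \<noteq> 0"
  shows "fiber_measure \<mu> x = distr \<mu> (restrict_space borel {g. det g = x}) (\<lambda>g. diag_one x ** g)"
proof -
  define h where "h = (SOME h :: 'a^'n^'n. det h = x)"
  have h: "det h = x" unfolding h_def by (rule someI[of "\<lambda>h. det h = x" "diag_one x"]) simp
  \<comment> \<open>The element of \<open>SL\<^sub>n(F)\<close> relating the chosen base point \<open>h\<close> to \<open>d(x)\<close>.\<close>
  define k where "k = diag_one (inverse x) ** h"
  have k: "k \<in> SL" using x h by (simp add: k_def SL_def)
  have hk: "h = diag_one x ** k"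
    using x by (simp add: k_def matrix_mul_assoc flip: diag_one_mult)
  have "measurable \<mu> \<mu> = measurable \<mu> (restrict_space borel {g. det g = 1})"
    using \<mu> by (intro measurable_cong_sets) (auto simp: haar_measure_SL_def SL_def)
  then have m: "(\<lambda>g. k ** g) \<in> measurable \<mu> \<mu>"
    using haar_left_mult_measurable[OF \<mu>, of k 1] k by (auto simp: SL_def)
  have "fiber_measure \<mu> x = distr \<mu> (restrict_space borel {g. det g = x}) (\<lambda>g. h ** g)"
    by (simp add: fiber_measure_def h_def)
  also have "(\<lambda>g. h ** g) = (\<lambda>g. diag_one x ** g) \<circ> (\<lambda>g. k ** g)"
    by (simp add: hk fun_eq_iff matrix_mul_assoc)
  also have "distr \<mu> (restrict_space borel {g. det g = x}) \<dots> =
      distr (distr \<mu> \<mu> (\<lambda>g. k ** g)) (restrict_space borel {g. det g = x}) (\<lambda>g. diag_one x ** g)"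
    using m haar_left_mult_measurable[OF \<mu>, of "diag_one x" x] by (subst distr_distr) simp_all
  also have "\<dots> = distr \<mu> (restrict_space borel {g. det g = x}) (\<lambda>g. diag_one x ** g)"
    by (simp add: haar_distr_left_mult[OF \<mu> k])
  finally show ?thesis .
qed

lemma fiber_integral_eq:
  fixes x :: "'a::local_field_char_0" and \<Phi> :: "'a^'n^'n \<Rightarrow> complex"
  assumes \<mu>: "haar_measure_SL \<mu>" and x: "x \<noteq> 0" and \<Phi>: "continuous_on GL \<Phi>"
  shows "integrable (fiber_measure \<mu> x) \<Phi> \<longleftrightarrow> integrable \<mu> (\<lambda>g. \<Phi> (diag_one x ** g))"
    "(\<integral>g. \<Phi> g \<partial>fiber_measure \<mu> x) = (\<integral>g. \<Phi> (diag_one x ** g) \<partial>\<mu>)"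
proof -
  have "continuous_on {g. det g = x} \<Phi>"
    by (rule continuous_on_subset[OF \<Phi>]) (use x in \<open>auto simp: GL_iff_det\<close>)
  then have "\<Phi> \<in> borel_measurable (restrict_space borel {g. det g = x})"
    by (rule borel_measurable_continuous_on_restrict)
  moreover have "(\<lambda>g. diag_one x ** g) \<in> measurable \<mu> (restrict_space borel {g. det g = x})"
    by (rule haar_left_mult_measurable[OF \<mu>]) simp
  ultimately show "integrable (fiber_measure \<mu> x) \<Phi> \<longleftrightarrow> integrable \<mu> (\<lambda>g. \<Phi> (diag_one x ** g))"
    "(\<integral>g. \<Phi> g \<partial>fiber_measure \<mu> x) = (\<integral>g. \<Phi> (diag_one x ** g) \<partial>\<mu>)"
    unfolding fiber_measure_diag_one[OF \<mu> x] by (simp_all add: integrable_distr_eq integral_distr)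
qed

lemma haar_borel_measurable:
  assumes \<mu>: "haar_measure_SL \<mu>" and "continuous_on SL f"
  shows "f \<in> borel_measurable \<mu>"
proof -
  have s: "sets \<mu> = sets (restrict_space borel SL)" using assms by (auto simp: haar_measure_SL_def)
  show ?thesis using borel_measurable_continuous_on_restrict[OF assms(2)] measurable_cong_sets[OF s refl] by blast
qed

lemma haar_compact:
  assumes \<mu>: "haar_measure_SL \<mu>" and "compact K" "K \<subseteq> SL"
  shows "K \<in> sets \<mu>" "emeasure \<mu> K < \<infinity>"
proof -
  have "closed K" using assms by (intro compact_imp_closed)
  then show 1: "K \<in> sets \<mu>"
    using assms unfolding haar_measure_SL_def by (auto simp: sets_restrict_space image_iff intro!: bexI[of _ K])
  show "emeasure \<mu> K < \<infinity>" using \<mu> 1 assms unfolding haar_measure_SL_def by blast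
qed

section \<open>The non-Archimedean case\<close>

lemma continuous_on_diag_one [continuous_intros]:
  assumes "continuous_on S f"
  shows "continuous_on S (\<lambda>x. diag_one (f x) :: 'a::local_field_char_0^'n^'n)"
proof -
  have "continuous_on S (\<lambda>x. if i = j then if i = distinguished_index then f x else 1 else 0)" for i j :: 'n
    using assms by (cases "i = j"; cases "i = distinguished_index") auto
  then show ?thesis unfolding diag_one_def by (intro continuous_on_vec_lambda)
qed

lemma nonarchimedean_valuation:
  assumes "\<not> archimedean TYPE('a::local_field_char_0)"
  obtains v where "is_nonarch_val (v :: 'a \<Rightarrow> int)"
  using local_field[where 'a='a] assms by (auto simp: archimedean_def)

lemma absF_pos_nonarch:
  assumes "\<not> archimedean TYPE('a::local_field_char_0)" "(x::'a) \<noteq> 0"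
  shows "absF x > 0"
proof -
  obtain v where "is_nonarch_val (v :: 'a \<Rightarrow> int)" using nonarchimedean_valuation[OF assms(1)] .
  then have v: "is_nonarch_val (nonarch_val :: 'a \<Rightarrow> int)" unfolding nonarch_val_def by (rule someI[of is_nonarch_val])
  then have "finite (residue_classes (nonarch_val :: 'a \<Rightarrow> int))" by (simp add: is_nonarch_val_def)
  moreover have "residue_classes (nonarch_val :: 'a \<Rightarrow> int) \<noteq> {}"
    using val_ge_zero[OF v, of 0] by (auto simp: residue_classes_def quotient_def)
  ultimately have "card (residue_classes (nonarch_val :: 'a \<Rightarrow> int)) > 0" by (simp add: card_gt_0_iff)
  then show ?thesis using assms by (simp add: absF_def)
qed

lemma locally_constant_imp_continuous:
  assumes "locally_constant_on U f"
  shows "continuous_on U f"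
  unfolding continuous_on_topological
proof (intro ballI allI impI)
  fix x B assume "x \<in> U" "open B" "f x \<in> B"
  then show "\<exists>A. open A \<and> x \<in> A \<and> (\<forall>y\<in>U. y \<in> A \<longrightarrow> f y \<in> B)"
    using assms unfolding locally_constant_on_def by (metis IntI)
qed

lemma locally_constant_on_combine:
  assumes "locally_constant_on U f" "locally_constant_on U g"
  shows "locally_constant_on U (\<lambda>x. h (f x) (g x))"
  unfolding locally_constant_on_def
proof
  fix x assume "x \<in> U"
  then obtain M N where "open M" "x \<in> M" "\<forall>y\<in>M \<inter> U. f y = f x" "open N" "x \<in> N" "\<forall>y\<in>N \<inter> U. g y = g x"
    using assms unfolding locally_constant_on_def by meson
  then show "\<exists>N. open N \<and> x \<in> N \<and> (\<forall>y\<in>N \<inter> U. h (f y) (g y) = h (f x) (g x))"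
    by (intro exI[of _ "M \<inter> N"]) auto
qed

lemma locally_constant_on_sum:
  assumes "finite I" "\<And>i. i \<in> I \<Longrightarrow> locally_constant_on U (f i)"
  shows "locally_constant_on U (\<lambda>x. \<Sum>i\<in>I. f i x)"
  using assms
proof (induction I rule: finite_induct)
  case empty then show ?case by (auto simp: locally_constant_on_def)
next
  case (insert i I)
  then show ?case using locally_constant_on_combine[of U "f i" "\<lambda>x. \<Sum>i\<in>I. f i x" "(+)"] by simp
qed

lemma locally_constant_on_cong:
  assumes "locally_constant_on U f" "\<And>x. x \<in> U \<Longrightarrow> g x = f x"
  shows "locally_constant_on U g"
  using assms unfolding locally_constant_on_def by (metis IntD2)

text \<open>The coefficient is constant on the left coset of \<open>g\<^sub>0\<close> with respect to the open stabilizer of \<open>v\<close>.\<close>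

lemma smooth_matrix_coeff_locally_constant:
  fixes \<pi> :: "'a::local_field_char_0^'n^'n \<Rightarrow> 'v \<Rightarrow> 'v::ab_group_add"
  assumes "irreducible_smooth_rep s V \<pi>" "v \<in> V"
  shows "locally_constant_on GL (\<lambda>g. l (\<pi> g v))"
  unfolding locally_constant_on_def
proof
  fix g0 :: "'a^'n^'n" assume g0: "g0 \<in> GL"
  define S where "S = {g \<in> GL. \<pi> g v = v}"
  have rep: "is_rep s V \<pi>" and S: "open S"
    using assms unfolding irreducible_smooth_rep_def S_def by auto
  define N where "N = (\<lambda>g. matrix_inv g0 ** g) -` S"
  have "open N" unfolding N_def
    by (rule open_vimage[OF S]) (intro continuous_intros)
  moreover have "g0 \<in> N"
    using rep assms(2) g0 by (auto simp: N_def S_def matrix_inv_GL is_rep_def GL_iff_det)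
  moreover have "l (\<pi> g v) = l (\<pi> g0 v)" if "g \<in> N" for g
  proof -
    have "g0 ** (matrix_inv g0 ** g) = g" by (simp add: matrix_mul_assoc matrix_inv_GL[OF g0])
    moreover have "\<pi> (g0 ** (matrix_inv g0 ** g)) v = \<pi> g0 (\<pi> (matrix_inv g0 ** g) v)"
    proof -
      have "matrix_inv g0 ** g \<in> GL" using that by (simp add: N_def S_def)
      then show ?thesis using rep assms(2) g0 by (simp add: is_rep_def)
    qed
    ultimately have "\<pi> g v = \<pi> g0 (\<pi> (matrix_inv g0 ** g) v)" by simp
    then show ?thesis using that by (auto simp: N_def S_def)
  qed
  ultimately have "open N \<and> g0 \<in> N \<and> (\<forall>g\<in>N \<inter> GL. l (\<pi> g v) = l (\<pi> g0 v))" by blast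
  then show "\<exists>N. open N \<and> g0 \<in> N \<and> (\<forall>g\<in>N \<inter> GL. l (\<pi> g v) = l (\<pi> g0 v))" ..
qed

text \<open>Near each point \<open>(1, z)\<close> the function \<open>(t, w) \<mapsto> f(d(t) w)\<close> is constant on a product neighbourhood;
  finitely many of these cover \<open>{1} \<times> C\<close>.\<close>

lemma eventually_diag_one_invariant_on_compact:
  fixes f :: "'a::local_field_char_0^'n^'n \<Rightarrow> 'b"
  assumes "compact C" "C \<subseteq> U" "open U" "locally_constant_on U f"
  shows "eventually (\<lambda>t. \<forall>z\<in>C. f (diag_one t ** z) = f z) (nhds 1)"
proof -
  define Q where "Q z A B \<longleftrightarrow> open A \<and> 1 \<in> A \<and> open B \<and> z \<in> B \<and>
    (\<forall>t\<in>A. \<forall>w\<in>B. f (diag_one t ** w) = f w)" for z A B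
  have "\<exists>A B. Q z A B" if z: "z \<in> C" for z
  proof -
    have "z \<in> U" using z assms(2) by auto
    then obtain N where N: "open N" "z \<in> N" "\<forall>y\<in>N \<inter> U. f y = f z"
      using assms(4) unfolding locally_constant_on_def by meson
    define W where "W = (\<lambda>p :: 'a \<times> ('a^'n^'n). diag_one (fst p) ** snd p) -` (N \<inter> U)"
    have "open W" unfolding W_def
      by (rule open_vimage) (use N assms(3) in \<open>auto intro!: continuous_intros\<close>)
    moreover have "(1, z) \<in> W" using N \<open>z \<in> U\<close> by (simp add: W_def)
    ultimately obtain A B where AB: "open A" "open B" "(1, z) \<in> A \<times> B" "A \<times> B \<subseteq> W"
      by (rule open_prod_elim)
    have *: "f (diag_one t ** w) = f z" if "t \<in> A" "w \<in> B" for t w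
    proof -
      have "(t, w) \<in> W" using AB that by auto
      then show ?thesis using N(3) by (simp add: W_def)
    qed
    have "f (diag_one t ** w) = f w" if "t \<in> A" "w \<in> B" for t w
      using *[of t w] *[of 1 w] that AB by simp
    then show ?thesis using AB unfolding Q_def by (intro exI[of _ A] exI[of _ B]) auto
  qed
  then obtain A B where "\<And>z. z \<in> C \<Longrightarrow> Q z (A z) (B z)" by metis
  then have AB: "\<And>z. z \<in> C \<Longrightarrow> open (A z)" "\<And>z. z \<in> C \<Longrightarrow> 1 \<in> A z" "\<And>z. z \<in> C \<Longrightarrow> open (B z)"
     "\<And>z. z \<in> C \<Longrightarrow> z \<in> B z" "\<And>z t w. z \<in> C \<Longrightarrow> t \<in> A z \<Longrightarrow> w \<in> B z \<Longrightarrow> f (diag_one t ** w) = f w"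
    by (simp_all add: Q_def)
  obtain D where D: "D \<subseteq> C" "finite D" "C \<subseteq> (\<Union>z\<in>D. B z)"
  proof (rule compactE_image[OF assms(1), of C B])
    show "C \<subseteq> (\<Union>z\<in>C. B z)" using AB(4) by auto
  qed (use AB(3) in auto)
  have "eventually (\<lambda>t. t \<in> (\<Inter>z\<in>D. A z)) (nhds 1)"
    using D AB by (intro eventually_nhds_in_open open_INT) auto
  then show ?thesis
  proof eventually_elim
    case (elim t)
    show ?case
    proof
      fix z assume "z \<in> C"
      then obtain y where y: "y \<in> D" "z \<in> B y" using D by auto
      then show "f (diag_one t ** z) = f z" using AB(5)[of y t z] elim D(1) by auto
    qed
  qed
qed

text \<open>For \<open>m \<ge> 1\<close> the subgroups \<open>1 + P\<^sup>m\<close> of the unit group, \<open>P\<close> the maximal ideal, form a basis of neighbourhoods of \<open>1\<close>. Closure under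
  inverses comes from \<open>1/t - 1 = -(t - 1)/t\<close>, as \<open>t\<close> is a unit.\<close>

lemma nonarch_eventually_inverse:
  assumes v: "is_nonarch_val (v :: 'a::local_field_char_0 \<Rightarrow> int)" and P: "eventually P (nhds (1::'a))"
  shows "eventually (\<lambda>t. t \<noteq> 0 \<and> P (inverse t)) (nhds 1)"
proof -
  obtain S where S: "open S" "1 \<in> S" "\<forall>t\<in>S. P t" using P by (auto simp: eventually_nhds)
  have "\<exists>m. \<forall>y. y - 1 \<in> val_ge v m \<longrightarrow> y \<in> S"
    using S v unfolding is_nonarch_val_def by blast
  then obtain m0 where m0: "\<forall>y. y - 1 \<in> val_ge v m0 \<longrightarrow> y \<in> S" ..
  define m where "m = max 1 m0"
  have "eventually (\<lambda>t. t - 1 \<in> val_ge v m) (nhds 1)"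
    using nonarch_tendsto_iff[OF v, of "\<lambda>x. x" 1 "nhds 1"] by (simp add: filterlim_ident)
  then show ?thesis
  proof eventually_elim
    case (elim t)
    have 1: "1 \<notin> val_ge v 1" using nonarch_val_one[OF v] by (auto simp: val_ge_def)
    have t1: "t - 1 \<in> val_ge v 1" using elim by (rule val_ge_mono[OF v, rotated]) (simp add: m_def)
    have "t \<notin> val_ge v 1"
    proof
      assume "t \<in> val_ge v 1"
      then have "t + - (t - 1) \<in> val_ge v 1" using t1 by (intro val_ge_add[OF v] val_ge_minus[OF v])
      then show False using 1 by simp
    qed
    then have t: "t \<noteq> 0" "v t \<le> 0" by (auto simp: val_ge_def)
    have "v t + v (inverse t) = 0"
      using nonarch_val_mult[OF v, of t "inverse t"] nonarch_val_one[OF v] t by simp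
    then have "inverse t \<in> val_ge v 0" using t by (auto simp: val_ge_def)
    then have "- ((t - 1) * inverse t) \<in> val_ge v (m + 0)"
      using elim by (intro val_ge_mult[OF v] val_ge_minus[OF v])
    moreover have "- ((t - 1) * inverse t) = inverse t - 1" using t by (simp add: algebra_simps)
    ultimately have "inverse t - 1 \<in> val_ge v m0" by (auto intro: val_ge_mono[OF v, of m0 m] simp: m_def)
    then show ?case using m0 S t by auto
  qed
qed

text \<open>Compactness of \<open>K\<close> controls \<open>f(d(t) z)\<close> for \<open>z\<close> in \<open>K\<close>. A point \<open>z\<close> outside \<open>K\<close> could be moved into
  \<open>K\<close> by \<open>d(t)\<close>; then the invariance is applied to \<open>d(t) z\<close> and the inverse of \<open>t\<close>.\<close>

lemma eventually_diag_one_invariant: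
  fixes f :: "'a::local_field_char_0^'n^'n \<Rightarrow> complex"
  assumes v: "is_nonarch_val (v :: 'a \<Rightarrow> int)" 
    and "compact K" "locally_constant_on UNIV f" "\<And>z. z \<notin> K \<Longrightarrow> f z = 0"
  shows "eventually (\<lambda>t. \<forall>z. f (diag_one t ** z) = f z) (nhds 1)"
proof -
  have ev: "eventually (\<lambda>t. \<forall>z\<in>K. f (diag_one t ** z) = f z) (nhds 1)"
    using eventually_diag_one_invariant_on_compact[of K UNIV f] assms by simp
  show ?thesis
    using ev nonarch_eventually_inverse[OF v ev]
  proof eventually_elim
    case (elim t)
    show ?case
    proof
      fix z :: "'a^'n^'n"
      have id: "diag_one (inverse t) ** (diag_one t ** z) = z"
        using elim(2) by (simp add: matrix_mul_assoc flip: diag_one_mult)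
      show "f (diag_one t ** z) = f z"
      proof (cases "diag_one t ** z \<in> K")
        case True
        then show ?thesis using elim(2) id by metis
      next
        case False
        then show ?thesis using elim(1) assms(4) by (cases "z \<in> K") auto
      qed
    qed
  qed
qed

text \<open>The coefficient \<open>\<phi>\<close> is locally constant only on invertible matrices, so the invariance of \<open>\<Phi>\<close> under
  \<open>d(t)\<close> is available only on the compact part \<open>K \<inter> {det z = x}\<close> of a fiber. On the rest of the fiber
  \<open>\<Phi>\<close> vanishes together with \<open>f\<close>, both at \<open>z\<close> and at \<open>d(t) z\<close>, because \<open>f\<close> is invariant at all matrices.\<close>

lemma nonarch_fiber_integral:
  fixes s :: "complex \<Rightarrow> 'v \<Rightarrow> 'v::ab_group_add"
    and V :: "'v set" and T :: "'v topology"
    and \<pi> :: "'a::local_field_char_0^'n^'n \<Rightarrow> 'v \<Rightarrow> 'v"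
    and \<mu> :: "('a^'n^'n) measure"
    and \<xi> \<phi> :: "'a^'n^'n \<Rightarrow> complex"
  assumes na: "\<not> archimedean TYPE('a)"
    and \<pi>: "in_PiF s V T \<pi>"
    and \<mu>: "haar_measure_SL \<mu>"
    and \<xi>: "\<xi> \<in> schwartz_std"
    and \<phi>: "\<phi> \<in> matrix_coeffs s V T \<pi>"
  shows "(\<forall>x. x \<noteq> 0 \<longrightarrow> integrable (fiber_measure \<mu> x) (\<lambda>g. \<xi> g * \<phi> g)) \<and>
         smooth_onF {x. x \<noteq> 0} (\<lambda>x. \<integral>g. \<xi> g * \<phi> g \<partial>fiber_measure \<mu> x)"
proof -
  obtain v where v: "is_nonarch_val (v :: 'a \<Rightarrow> int)" using nonarchimedean_valuation[OF na] .
  have \<pi>': "irreducible_smooth_rep s V \<pi>" using \<pi> na by (simp add: in_PiF_def)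
  obtain f where f: "f \<in> schwartz_bruhat"
      "\<And>g. g \<in> GL \<Longrightarrow> complex_of_real (absF (det g) powr (- real CARD('n) / 2)) * \<xi> g = f g"
    and \<xi>lc: "locally_constant_on GL \<xi>"
    using \<xi> na by (auto simp: schwartz_std_def smooth_onM_def)
  obtain K where K: "compact K" "\<And>x. x \<notin> K \<Longrightarrow> f x = 0" and flc: "locally_constant_on UNIV f"
    using f(1) na by (auto simp: schwartz_bruhat_def smooth_onM_def)
  have \<xi>0: "\<xi> g = 0" if "g \<in> GL" "f g = 0" for g
    using f(2)[OF that(1)] that absF_pos_nonarch[OF na, of "det g"] by (simp add: GL_iff_det)
  obtain m :: nat and w l where wl': "\<forall>i<m. w i \<in> V \<and> l i \<in> smooth_contragredient s V T \<pi>"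
      "\<forall>g\<in>GL. \<phi> g = (\<Sum>i<m. l i (\<pi> g (w i)))"
    using \<phi> unfolding matrix_coeffs_def by blast
  then have wl: "\<And>i. i < m \<Longrightarrow> w i \<in> V" "\<And>g. g \<in> GL \<Longrightarrow> \<phi> g = (\<Sum>i<m. l i (\<pi> g (w i)))"
    by auto
  have "locally_constant_on GL (\<lambda>g. \<Sum>i<m. l i (\<pi> g (w i)))"
    using smooth_matrix_coeff_locally_constant[OF \<pi>'] wl(1) by (intro locally_constant_on_sum) auto
  then have \<phi>lc: "locally_constant_on GL \<phi>" using wl(2) by (rule locally_constant_on_cong)
  define \<Phi> where "\<Phi> = (\<lambda>g. \<xi> g * \<phi> g)"
  have \<Phi>lc: "locally_constant_on GL \<Phi>"
    unfolding \<Phi>_def using \<xi>lc \<phi>lc by (rule locally_constant_on_combine)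
  have \<Phi>c: "continuous_on GL \<Phi>" using \<Phi>lc by (rule locally_constant_imp_continuous)
  have cmp: "compact (K \<inter> {z. det z = x})" for x
    using K(1) closed_det_fiber by (rule compact_Int_closed)
  have int: "integrable (fiber_measure \<mu> x) \<Phi>" if x: "x \<noteq> 0" for x
  proof -
    define C where "C = (\<lambda>z. diag_one (inverse x) ** z) ` (K \<inter> {z. det z = x})"
    have C: "compact C" unfolding C_def
      by (intro compact_continuous_image cmp continuous_intros)
    have CS: "C \<subseteq> SL" using x by (auto simp: C_def SL_def)
    have cont: "continuous_on SL (\<lambda>g. \<Phi> (diag_one x ** g))"
      by (rule continuous_on_compose2[OF \<Phi>c]) (use x in \<open>auto intro!: continuous_intros simp: SL_def GL_iff_det\<close>)
    have "compact ((\<lambda>g. \<Phi> (diag_one x ** g)) ` C)"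
      by (intro compact_continuous_image C continuous_on_subset[OF cont CS])
    then obtain B where B: "\<And>g. g \<in> C \<Longrightarrow> norm (\<Phi> (diag_one x ** g)) \<le> B"
      by (metis bounded_iff compact_imp_bounded imageI)
    have "\<Phi> (diag_one x ** g) = 0" if g: "g \<in> SL" "g \<notin> C" for g
    proof -
      have id: "diag_one (inverse x) ** (diag_one x ** g) = g"
        using x by (simp add: matrix_mul_assoc flip: diag_one_mult)
      have "diag_one x ** g \<notin> K"
      proof
        assume "diag_one x ** g \<in> K"
        then have "diag_one (inverse x) ** (diag_one x ** g) \<in> C"
          unfolding C_def using g(1) by (intro imageI) (simp add: SL_def)
        then show False using id g(2) by simp
      qed
      moreover have "diag_one x ** g \<in> GL" using x g by (simp add: GL_iff_det SL_def)
      ultimately show ?thesis using K(2) \<xi>0 by (simp add: \<Phi>_def)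
    qed
    then have "integrable \<mu> (\<lambda>g. \<Phi> (diag_one x ** g))"
      using haar_compact[OF \<mu> C CS] haar_borel_measurable[OF \<mu> cont] B \<mu>
      by (intro integrableI_bounded_set[of C _ _ B]) (auto intro!: AE_I2 simp: haar_measure_SL_def)
    then show ?thesis using fiber_integral_eq(1)[OF \<mu> x \<Phi>c] by simp
  qed
  moreover have "locally_constant_on {x. x \<noteq> 0} (\<lambda>x. \<integral>g. \<Phi> g \<partial>fiber_measure \<mu> x)"
    unfolding locally_constant_on_def
  proof
    fix x :: 'a assume "x \<in> {x. x \<noteq> 0}"
    then have x: "x \<noteq> 0" by simp
    have "eventually (\<lambda>t. t \<noteq> 0) (nhds (1::'a))"
      by (rule eventually_nhds_in_open[of "- {0}", simplified]) auto
    moreover have "eventually (\<lambda>t. \<forall>z. f (diag_one t ** z) = f z) (nhds 1)"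
      using v K(1) flc K(2) by (rule eventually_diag_one_invariant)
    moreover have "eventually (\<lambda>t. \<forall>z\<in>K \<inter> {z. det z = x}. \<Phi> (diag_one t ** z) = \<Phi> z) (nhds 1)"
      by (rule eventually_diag_one_invariant_on_compact[OF cmp _ open_GL \<Phi>lc]) (use x in \<open>auto simp: GL_iff_det\<close>)
    ultimately have "eventually (\<lambda>t. (\<integral>g. \<Phi> g \<partial>fiber_measure \<mu> (t * x)) = (\<integral>g. \<Phi> g \<partial>fiber_measure \<mu> x)) (nhds 1)"
    proof eventually_elim
      case (elim t)
      have eq: "\<Phi> (diag_one t ** z) = \<Phi> z" if z: "det z = x" for z
      proof (cases "z \<in> K")
        case True then show ?thesis using elim(3) z by auto
      next
        case False
        then have "f z = 0" "f (diag_one t ** z) = 0" using elim(2) K(2) by auto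
        then show ?thesis using \<xi>0 z x elim(1) by (simp add: \<Phi>_def GL_iff_det)
      qed
      have "(\<integral>g. \<Phi> (diag_one (t * x) ** g) \<partial>\<mu>) = (\<integral>g. \<Phi> (diag_one x ** g) \<partial>\<mu>)"
      proof (rule Bochner_Integration.integral_cong[OF refl])
        fix g assume "g \<in> space \<mu>"
        then have "det g = 1" using \<mu> by (simp add: haar_measure_SL_def SL_def)
        then show "\<Phi> (diag_one (t * x) ** g) = \<Phi> (diag_one x ** g)"
          using eq[of "diag_one x ** g"] by (simp add: diag_one_mult matrix_mul_assoc)
      qed
      then show ?case using fiber_integral_eq(2)[OF \<mu> _ \<Phi>c] x elim(1) by simp
    qed
    then obtain S where S: "open S" "1 \<in> S" "\<And>t. t \<in> S \<Longrightarrow> (\<integral>g. \<Phi> g \<partial>fiber_measure \<mu> (t * x)) = (\<integral>g. \<Phi> g \<partial>fiber_measure \<mu> x)"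
      by (auto simp: eventually_nhds)
    define N where "N = (\<lambda>y. y * inverse x) -` S"
    have "open N" unfolding N_def by (rule open_vimage[OF S(1)]) (intro continuous_intros)
    moreover have "x \<in> N" using S x by (simp add: N_def)
    moreover have "(\<integral>g. \<Phi> g \<partial>fiber_measure \<mu> y) = (\<integral>g. \<Phi> g \<partial>fiber_measure \<mu> x)" if "y \<in> N" for y
      using S(3)[of "y * inverse x"] that x by (simp add: N_def mult.assoc)
    ultimately show "\<exists>N. open N \<and> x \<in> N \<and> (\<forall>y\<in>N \<inter> {x. x \<noteq> 0}. (\<integral>g. \<Phi> g \<partial>fiber_measure \<mu> y) = (\<integral>g. \<Phi> g \<partial>fiber_measure \<mu> x))"
      by blast
  qed
  ultimately show ?thesis using na by (simp add: \<Phi>_def smooth_onF_def)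
qed

section \<open>Archimedean fields inside the complex numbers\<close>

locale archimedean_local_field =
  fixes F :: "'a::local_field_char_0 itself"
  assumes arch: "archimedean TYPE('a)"
begin

abbreviation emb :: "'a \<Rightarrow> complex" where "emb \<equiv> arch_emb"

lemma emb_is_arch_emb: "is_arch_emb emb"
  unfolding arch_emb_def using arch unfolding archimedean_def by (rule someI_ex)

lemmas emb_simps [simp] = is_arch_emb_D(1-7)[OF emb_is_arch_emb]

lemma inj_emb: "inj emb"
  by (rule is_arch_emb_D(8)[OF emb_is_arch_emb])

lemma emb_range: "range emb = \<real> \<or> range emb = UNIV"
  by (rule is_arch_emb_D(9)[OF emb_is_arch_emb])

lemma inv_emb [simp]: "inv emb (emb x) = x"
  by (rule inv_f_f[OF inj_emb])

lemma emb_inv: "z \<in> range emb \<Longrightarrow> emb (inv emb z) = z"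
  by (rule f_inv_into_f)

lemma of_real_in_range_emb: "complex_of_real r \<in> range emb"
  using emb_range by auto

lemma emb_real_emb [simp]: "emb (real_emb r) = complex_of_real r"
  unfolding real_emb_def by (rule emb_inv[OF of_real_in_range_emb])

lemma emb_eq_iff: "emb x = emb y \<longleftrightarrow> x = y"
  using inj_emb by (rule inj_eq)

lemma emb_inverse: "emb (inverse x) = inverse (emb x)"
proof (cases "x = 0")
  case False
  then have "emb x * emb (inverse x) = 1" by (simp flip: is_arch_emb_D(2)[OF emb_is_arch_emb])
  then show ?thesis by (metis inverse_unique)
qed simp

lemma emb_sum: "emb (\<Sum>i\<in>I. f i) = (\<Sum>i\<in>I. emb (f i))"
  by (induction I rule: infinite_finite_induct) auto

lemma emb_prod: "emb (\<Prod>i\<in>I. f i) = (\<Prod>i\<in>I. emb (f i))"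
  by (induction I rule: infinite_finite_induct) auto

lemma emb_sign: "emb (of_int (sign p)) = of_int (sign p)"
  by (cases p rule: sign_cases) auto

lemma emb_det: "emb (det A) = (\<Sum>p | p permutes UNIV. of_int (sign p) * (\<Prod>i\<in>UNIV. emb (A $ i $ p i)))"
  by (simp add: det_def emb_sum emb_prod emb_sign)

lemma continuous_on_emb_iff: "continuous_on S f \<longleftrightarrow> continuous_on S (\<lambda>x. emb (f x))"
  unfolding continuous_on_def using arch_emb_tendsto_iff[OF emb_is_arch_emb] by blast

lemma continuous_on_emb [continuous_intros]:
  "continuous_on S f \<Longrightarrow> continuous_on S (\<lambda>x. emb (f x))"
  using continuous_on_emb_iff by blast

lemma continuous_on_inv_emb: "continuous_on (range emb) (inv emb)"
  unfolding continuous_on_emb_iff by (rule continuous_on_eq[OF continuous_on_id]) (auto simp: emb_inv)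

lemma continuous_on_real_emb [continuous_intros]:
  "continuous_on S r \<Longrightarrow> continuous_on S (\<lambda>x. real_emb (r x) :: 'a)"
  unfolding continuous_on_emb_iff by (auto intro!: continuous_intros)

text \<open>The exponent is \<open>1\<close> over a real field and \<open>2\<close> over a complex one.\<close>

lemma absF_eq_powr:
  obtains e where "e = 1 \<or> e = (2::real)" "\<And>x::'a. absF x = cmod (emb x) powr e"
proof (cases "range emb = \<real>")
  case True
  then show ?thesis using arch by (intro that[of 1]) (auto simp: absF_def)
next
  case False
  then show ?thesis using arch by (intro that[of 2]) (auto simp: absF_def)
qed

lemma absF_bounds:
  fixes x :: 'a
  shows "cmod (emb x) \<le> 1 + absF x" "0 \<le> absF x" "absF x \<le> (1 + cmod (emb x)) ^ 2"
proof -
  have "y \<le> 1 + y\<^sup>2" for y :: real using zero_le_power2[of "y - 1/2"] by (simp add: power2_eq_square field_simps)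
  then show "cmod (emb x) \<le> 1 + absF x" "0 \<le> absF x"
    using arch by (auto simp: absF_def)
  show "absF x \<le> (1 + cmod (emb x)) ^ 2"
    using arch by (auto simp: absF_def power2_eq_square algebra_simps)
qed

end

text \<open>The bounds below are in terms of the usual absolute value of the complex numbers, not of the normalized
  one, because the former satisfies the triangle inequality.\<close>

definition entry_norm :: "'a::local_field_char_0^'n^'n \<Rightarrow> real" where
  "entry_norm g = 1 + (\<Sum>i\<in>UNIV. \<Sum>j\<in>UNIV. cmod (arch_emb (g $ i $ j)))"

text \<open>Together with \<open>entry_norm\<close> this controls the inverse matrix, whose entries have denominator
  \<open>det g\<close>.\<close>

definition det_norm :: "'a::local_field_char_0^'n^'n \<Rightarrow> real" where
  "det_norm g = 1 + 1 / cmod (arch_emb (det g))"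

lemma det_norm_ge_1: "det_norm g \<ge> 1"
  by (simp add: det_norm_def)

lemma entry_norm_ge_1: "entry_norm g \<ge> 1"
  by (auto simp: entry_norm_def intro!: sum_nonneg)

lemma entry_le_entry_norm: "1 + cmod (arch_emb (g $ i $ j)) \<le> entry_norm g"
proof -
  have "cmod (arch_emb (g $ i $ j)) \<le> (\<Sum>j\<in>UNIV. cmod (arch_emb (g $ i $ j)))"
    by (rule member_le_sum) auto
  also have "\<dots> \<le> (\<Sum>i\<in>UNIV. \<Sum>j\<in>UNIV. cmod (arch_emb (g $ i $ j)))"
    by (rule member_le_sum) (auto intro!: sum_nonneg)
  finally show ?thesis by (simp add: entry_norm_def)
qed

text \<open>Cramer's rule for the \<open>j\<close>-th column of the inverse.\<close>

lemma matrix_inv_entry: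
  assumes "g \<in> GL"
  shows "matrix_inv g $ k $ j = det (\<chi> i j'. if j' = k then axis j 1 $ i else g $ i $ j') / det g"
proof -
  have "g *v (matrix_inv g *v axis j 1) = axis j 1"
    by (simp add: matrix_vector_mul_assoc matrix_inv_GL[OF assms])
  moreover have "det g \<noteq> 0" using assms by (simp add: GL_iff_det)
  ultimately have "matrix_inv g *v axis j 1 = (\<chi> k. det (\<chi> i j'. if j' = k then axis j 1 $ i else g $ i $ j') / det g)"
    by (simp add: cramer)
  then have "(matrix_inv g *v axis j 1) $ k = det (\<chi> i j'. if j' = k then axis j 1 $ i else g $ i $ j') / det g"
    by simp
  then show ?thesis by (simp add: matrix_vector_mult_def axis_def if_distrib cong: if_cong)
qed

context archimedean_local_field
begin

lemma norm_det_le: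
  fixes A :: "'a^'n^'n"
  assumes "\<And>i j. cmod (emb (A $ i $ j)) \<le> b"
  shows "cmod (emb (det A)) \<le> fact CARD('n) * b ^ CARD('n)"
proof -
  have "cmod (emb (det A)) \<le> (\<Sum>p | p permutes (UNIV :: 'n set). cmod (of_int (sign p) * (\<Prod>i\<in>UNIV. emb (A $ i $ p i))))"
    unfolding emb_det by (rule norm_sum)
  also have "\<dots> \<le> (\<Sum>p | p permutes (UNIV :: 'n set). b ^ CARD('n))"
  proof (rule sum_mono)
    fix p :: "'n \<Rightarrow> 'n"
    have "cmod (of_int (sign p)) = 1" by (cases p rule: sign_cases) auto
    moreover have "(\<Prod>i\<in>UNIV. cmod (emb (A $ i $ p i))) \<le> (\<Prod>i\<in>(UNIV::'n set). b)"
      by (rule prod_mono) (use assms in auto)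
    ultimately show "cmod (of_int (sign p) * (\<Prod>i\<in>UNIV. emb (A $ i $ p i))) \<le> b ^ CARD('n)"
      by (simp add: norm_mult prod_norm)
  qed
  also have "\<dots> = fact CARD('n) * b ^ CARD('n)"
    by (simp add: card_permutations)
  finally show ?thesis .
qed

lemma norm_matrix_inv_entry_le:
  fixes g :: "'a^'n^'n"
  assumes "g \<in> GL"
  shows "cmod (emb (matrix_inv g $ k $ j)) \<le> fact CARD('n) * entry_norm g ^ CARD('n) / cmod (emb (det g))"
proof -
  have "cmod (emb (det (\<chi> i j'. if j' = k then axis j 1 $ i else g $ i $ j'))) \<le> fact CARD('n) * entry_norm g ^ CARD('n)"
  proof (rule norm_det_le)
    fix i j'
    have "cmod (emb (g $ i $ j')) \<le> entry_norm g" using entry_le_entry_norm[of g i j'] by simp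
    then show "cmod (emb ((\<chi> i j'. if j' = k then axis j 1 $ i else g $ i $ j') $ i $ j')) \<le> entry_norm g"
      using entry_norm_ge_1[of g] by (auto simp: axis_def)
  qed
  then show ?thesis
    unfolding matrix_inv_entry[OF assms] by (simp add: divide_inverse emb_inverse norm_mult norm_inverse mult_right_mono)
qed

lemma real_emb_simps [simp]:
  "(real_emb 0 :: 'a) = 0" "(real_emb 1 :: 'a) = 1"
  "(real_emb (s + t) :: 'a) = real_emb s + real_emb t"
  "(real_emb (s * t) :: 'a) = real_emb s * real_emb t"
  by (simp_all flip: emb_eq_iff)

lemma scaleM_simps [simp]:
  fixes X Y :: "'a^'n^'n"
  shows "scaleM 0 X = 0" "scaleM 1 X = X" "scaleM s (scaleM t X) = scaleM (s * t) X"
    "scaleM t 0 = (0 :: 'a^'n^'n)"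
  by (simp_all add: scaleM_def vec_eq_iff)

lemma scaleM_add:
  fixes X Y :: "'a^'n^'n"
  shows "scaleM (s + t) X = scaleM s X + scaleM t X" "scaleM t (X + Y) = scaleM t X + scaleM t Y"
  by (simp_all add: scaleM_def vec_eq_iff algebra_simps)

lemma mult_scaleM: "g ** scaleM t (X :: 'a^'n^'n) = scaleM t (g ** X)"
  by (simp add: scaleM_def vec_eq_iff matrix_matrix_mult_def sum_distrib_left mult.left_commute)

end

lemma continuous_on_matI:
  assumes "\<And>i j. continuous_on S (\<lambda>x. f x $ i $ j)"
  shows "continuous_on S (f :: 'b::topological_space \<Rightarrow> 'c::topological_space^'n^'m)"
proof -
  have "continuous_on S (\<lambda>x. \<chi> i j. f x $ i $ j)"
    by (intro continuous_on_vec_lambda assms)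
  then show ?thesis by simp
qed

lemma continuous_on_mat_add [continuous_intros]:
  fixes f g :: "'b::topological_space \<Rightarrow> 'a::local_field_char_0^'n^'n"
  assumes "continuous_on S f" "continuous_on S g"
  shows "continuous_on S (\<lambda>x. f x + g x)"
  by (rule continuous_on_matI) (auto intro!: continuous_intros assms)

section \<open>Directional derivatives\<close>

definition has_dd :: "('a::local_field_char_0^'n^'n \<Rightarrow> complex) \<Rightarrow> 'a^'n^'n \<Rightarrow> 'a^'n^'n \<Rightarrow> complex \<Rightarrow> bool" where
  "has_dd f X g d \<longleftrightarrow> ((\<lambda>t. f (g + scaleM t X)) has_vector_derivative d) (at 0)"

lemma has_vector_derivative_iff_quotient:
  fixes u :: "real \<Rightarrow> complex"
  shows "(u has_vector_derivative d) (at a) \<longleftrightarrow> ((\<lambda>t. complex_of_real (1 / t) * (u (a + t) - u a)) \<longlongrightarrow> d) (at 0)"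
proof -
  have "(u has_vector_derivative d) (at a) \<longleftrightarrow> ((\<lambda>t. norm (u (a + t) - u a - t *\<^sub>R d) / norm t) \<longlongrightarrow> 0) (at 0)"
    by (auto simp: has_vector_derivative_def has_derivative_at bounded_linear_scaleR_left)
  also have "\<dots> \<longleftrightarrow> ((\<lambda>t. norm (complex_of_real (1 / t) * (u (a + t) - u a) - d)) \<longlongrightarrow> 0) (at 0)"
  proof (rule filterlim_cong[OF refl refl])
    show "\<forall>\<^sub>F t in at 0. norm (u (a + t) - u a - t *\<^sub>R d) / norm t = norm (complex_of_real (1 / t) * (u (a + t) - u a) - d)"
      unfolding eventually_at_topological
    proof (intro exI[of _ UNIV] conjI ballI impI open_UNIV UNIV_I)
      fix t :: real assume "t \<noteq> 0"
      then have "complex_of_real (1 / t) * (u (a + t) - u a) - d = complex_of_real (1 / t) * (u (a + t) - u a - t *\<^sub>R d)"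
        by (simp add: scaleR_conv_of_real algebra_simps)
      then show "norm (u (a + t) - u a - t *\<^sub>R d) / norm t = norm (complex_of_real (1 / t) * (u (a + t) - u a) - d)"
        by (simp only: norm_mult) (simp add: norm_divide)
    qed
  qed
  also have "\<dots> \<longleftrightarrow> ((\<lambda>t. complex_of_real (1 / t) * (u (a + t) - u a)) \<longlongrightarrow> d) (at 0)"
    unfolding tendsto_norm_zero_iff LIM_zero_iff ..
  finally show ?thesis .
qed

lemma shift_has_vector_derivative_iff:
  fixes u :: "real \<Rightarrow> complex"
  shows "((\<lambda>t. u (a + t)) has_vector_derivative d) (at b) \<longleftrightarrow> (u has_vector_derivative d) (at (a + b))"
  unfolding has_vector_derivative_iff_quotient by (simp add: add.assoc)

context archimedean_local_field
begin

lemma continuous_on_scaleM [continuous_intros]: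
  fixes f :: "'b::topological_space \<Rightarrow> 'a^'n^'n"
  assumes "continuous_on S r" "continuous_on S f"
  shows "continuous_on S (\<lambda>x. scaleM (r x) (f x))"
  unfolding scaleM_def by (rule continuous_on_matI) (auto intro!: continuous_intros assms)

lemma has_dirderiv_iff_has_dd:
  fixes f :: "'a^'n^'n \<Rightarrow> complex"
  shows "has_dirderiv scaleM (*) euclidean f X g d \<longleftrightarrow> has_dd f X g d"
  by (simp add: has_dirderiv_def has_dd_def has_vector_derivative_iff_quotient)

lemma has_dd_along_line:
  fixes f :: "'a^'n^'n \<Rightarrow> complex"
  assumes "has_dd f X (g + scaleM t X) d"
  shows "((\<lambda>t. f (g + scaleM t X)) has_vector_derivative d) (at t)"
  using assms shift_has_vector_derivative_iff[of "\<lambda>t. f (g + scaleM t X)" t d 0]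
  by (simp add: has_dd_def scaleM_add add.assoc)

lemma eventually_line_in_open:
  fixes g X :: "'a^'n^'n"
  assumes "open U" "g \<in> U"
  shows "eventually (\<lambda>t. g + scaleM t X \<in> U) (nhds 0)"
proof -
  have "open ((\<lambda>t::real. g + scaleM t X) -` U)"
    by (rule open_vimage[OF assms(1)]) (intro continuous_intros)
  then have "eventually (\<lambda>t. t \<in> (\<lambda>t::real. g + scaleM t X) -` U) (nhds 0)"
    by (rule eventually_nhds_in_open) (use assms in simp)
  then show ?thesis by simp
qed

text \<open>A line through a point of \<open>GL\<^sub>n(F)\<close> stays in this open set for small times, so values elsewhere do not
  matter.\<close>

lemma has_dd_cong:
  fixes f h :: "'a^'n^'n \<Rightarrow> complex"
  assumes "has_dd f X g d" "\<And>g. g \<in> GL \<Longrightarrow> f g = h g" "g \<in> GL"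
  shows "has_dd h X g d"
proof -
  have op: "open ((\<lambda>t::real. g + scaleM t X) -` GL)"
    by (rule open_vimage[OF open_GL]) (intro continuous_intros)
  show ?thesis using assms(1) unfolding has_dd_def
    by (rule has_vector_derivative_transform_within_open[OF _ op]) (use assms(2,3) in auto)
qed

end

section \<open>Slow growth and rapid decay\<close>

definition slow_growth :: "('a::local_field_char_0^'n^'n \<Rightarrow> complex) set" where
  "slow_growth = {f. \<exists>C M N. \<forall>g\<in>GL. cmod (f g) \<le> C * (det_norm g ^ M * entry_norm g ^ N)}"

text \<open>The power of \<open>det_norm\<close> may depend on \<open>N\<close>; near a fixed nonzero determinant all these powers are bounded,
  and the condition is decay faster than any power of the entries.\<close>

definition rapid_decay :: "('a::local_field_char_0^'n^'n \<Rightarrow> complex) set" where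
  "rapid_decay = {f. \<forall>N. \<exists>C M. \<forall>g\<in>GL. cmod (f g) * entry_norm g ^ N \<le> C * det_norm g ^ M}"

text \<open>The properties of \<open>slow_growth\<close> and \<open>rapid_decay\<close> on which the calculus of differentiable functions
  rests: being a module over the slowly growing functions, and depending only on the values on
  \<open>GL\<^sub>n(F)\<close>.\<close>

definition growth_module :: "('a::local_field_char_0^'n^'n \<Rightarrow> complex) set \<Rightarrow> bool" where
  "growth_module B \<longleftrightarrow>
     (\<forall>f\<in>B. \<forall>h. (\<forall>g\<in>GL. f g = h g) \<longrightarrow> h \<in> B) \<and>
     (\<forall>f\<in>B. \<forall>h\<in>B. (\<lambda>g. f g + h g) \<in> B) \<and>
     (\<forall>f\<in>slow_growth. \<forall>h\<in>B. (\<lambda>g. f g * h g) \<in> B)"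

lemma slow_growthE:
  assumes "f \<in> slow_growth"
  obtains C M N where "C \<ge> 0" "\<And>g. g \<in> GL \<Longrightarrow> cmod (f g) \<le> C * (det_norm g ^ M * entry_norm g ^ N)"
proof -
  obtain C M N where *: "\<forall>g\<in>GL. cmod (f g) \<le> C * (det_norm g ^ M * entry_norm g ^ N)"
    using assms unfolding slow_growth_def by blast
  have "cmod (f g) \<le> \<bar>C\<bar> * (det_norm g ^ M * entry_norm g ^ N)" if "g \<in> GL" for g
  proof -
    have "C * (det_norm g ^ M * entry_norm g ^ N) \<le> \<bar>C\<bar> * (det_norm g ^ M * entry_norm g ^ N)"
      using det_norm_ge_1[of g] entry_norm_ge_1[of g] by (intro mult_right_mono mult_nonneg_nonneg) auto
    then show ?thesis using * that by force
  qed
  then show ?thesis by (intro that[of "\<bar>C\<bar>"]) auto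
qed

lemma rapid_decayE:
  assumes "f \<in> rapid_decay"
  obtains C M where "C \<ge> 0" "\<And>g. g \<in> GL \<Longrightarrow> cmod (f g) * entry_norm g ^ N \<le> C * det_norm g ^ M"
proof -
  obtain C M where *: "\<forall>g\<in>GL. cmod (f g) * entry_norm g ^ N \<le> C * det_norm g ^ M"
    using assms unfolding rapid_decay_def by blast
  have "cmod (f g) * entry_norm g ^ N \<le> \<bar>C\<bar> * det_norm g ^ M" if "g \<in> GL" for g
  proof -
    have "C * det_norm g ^ M \<le> \<bar>C\<bar> * det_norm g ^ M"
      using det_norm_ge_1[of g] by (intro mult_right_mono) auto
    then show ?thesis using * that by force
  qed
  then show ?thesis by (intro that[of "\<bar>C\<bar>"]) auto
qed

lemma det_entry_norm_mono:
  assumes "C \<ge> 0" "M \<le> M'" "N \<le> N'"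
  shows "C * (det_norm g ^ M * entry_norm g ^ N) \<le> C * (det_norm g ^ M' * entry_norm g ^ N')"
  using assms det_norm_ge_1[of g] entry_norm_ge_1[of g]
  by (intro mult_left_mono mult_mono power_increasing) auto

lemma slow_growth_mult:
  assumes "f \<in> slow_growth" "h \<in> slow_growth"
  shows "(\<lambda>g. f g * h g) \<in> slow_growth"
proof -
  obtain C M N where f: "C \<ge> 0" "\<And>g. g \<in> GL \<Longrightarrow> cmod (f g) \<le> C * (det_norm g ^ M * entry_norm g ^ N)"
    by (rule slow_growthE[OF assms(1)], rule that)
  obtain C' M' N' where h: "C' \<ge> 0" "\<And>g. g \<in> GL \<Longrightarrow> cmod (h g) \<le> C' * (det_norm g ^ M' * entry_norm g ^ N')"
    by (rule slow_growthE[OF assms(2)], rule that)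
  have "cmod (f g * h g) \<le> (C * C') * (det_norm g ^ (M + M') * entry_norm g ^ (N + N'))" if g: "g \<in> GL" for g
  proof -
    have "cmod (f g * h g) \<le> (C * (det_norm g ^ M * entry_norm g ^ N)) * (C' * (det_norm g ^ M' * entry_norm g ^ N'))"
      unfolding norm_mult
      by (intro mult_mono f(2) h(2) g order_trans[OF norm_ge_zero f(2)]) auto
    then show ?thesis by (simp add: power_add mult_ac)
  qed
  then show ?thesis unfolding slow_growth_def by blast
qed

lemma growth_module_slow: "growth_module slow_growth"
  unfolding growth_module_def
proof (intro conjI ballI)
  fix f h :: "'a^'b^'b \<Rightarrow> complex" assume "f \<in> slow_growth" "h \<in> slow_growth"
  then show "(\<lambda>g. f g * h g) \<in> slow_growth" by (rule slow_growth_mult)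
  obtain C M N where f: "C \<ge> 0" "\<And>g. g \<in> GL \<Longrightarrow> cmod (f g) \<le> C * (det_norm g ^ M * entry_norm g ^ N)"
    by (rule slow_growthE[OF \<open>f \<in> _\<close>], rule that)
  obtain C' M' N' where h: "C' \<ge> 0" "\<And>g. g \<in> GL \<Longrightarrow> cmod (h g) \<le> C' * (det_norm g ^ M' * entry_norm g ^ N')"
    by (rule slow_growthE[OF \<open>h \<in> _\<close>], rule that)
  have "cmod (f g + h g) \<le> (C + C') * (det_norm g ^ (M + M') * entry_norm g ^ (N + N'))" if g: "g \<in> GL" for g
  proof -
    have "cmod (f g) \<le> C * (det_norm g ^ (M + M') * entry_norm g ^ (N + N'))"
      by (rule order_trans[OF f(2)[OF g] det_entry_norm_mono]) (use f(1) in auto)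
    moreover have "cmod (h g) \<le> C' * (det_norm g ^ (M + M') * entry_norm g ^ (N + N'))"
      by (rule order_trans[OF h(2)[OF g] det_entry_norm_mono]) (use h(1) in auto)
    ultimately show ?thesis
      using norm_triangle_ineq[of "f g" "h g"] by (simp only: ring_distribs)
  qed
  then show "(\<lambda>g. f g + h g) \<in> slow_growth" unfolding slow_growth_def by blast
next
  fix f :: "'a^'b^'b \<Rightarrow> complex" assume f: "f \<in> slow_growth"
  show "\<forall>h. (\<forall>g\<in>GL. f g = h g) \<longrightarrow> h \<in> slow_growth"
  proof (intro allI impI)
    fix h assume eq: "\<forall>g\<in>GL. f g = h g"
    obtain C M N where *: "C \<ge> 0" "\<And>g. g \<in> GL \<Longrightarrow> cmod (f g) \<le> C * (det_norm g ^ M * entry_norm g ^ N)"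
      by (rule slow_growthE[OF f], rule that)
    have "cmod (h g) \<le> C * (det_norm g ^ M * entry_norm g ^ N)" if "g \<in> GL" for g
      using *(2)[OF that] eq that by simp
    then show "h \<in> slow_growth" unfolding slow_growth_def by blast
  qed
qed

lemma growth_module_rapid: "growth_module rapid_decay"
  unfolding growth_module_def
proof (intro conjI ballI)
  fix f h :: "'a^'b^'b \<Rightarrow> complex" assume fh: "f \<in> rapid_decay" "h \<in> rapid_decay"
  show "(\<lambda>g. f g + h g) \<in> rapid_decay"
    unfolding rapid_decay_def
  proof (intro CollectI allI)
    fix N
    obtain C M where f: "C \<ge> 0" "\<And>g. g \<in> GL \<Longrightarrow> cmod (f g) * entry_norm g ^ N \<le> C * det_norm g ^ M"
      by (rule rapid_decayE[OF fh(1), where N = "N"], rule that)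
    obtain C' M' where h: "C' \<ge> 0" "\<And>g. g \<in> GL \<Longrightarrow> cmod (h g) * entry_norm g ^ N \<le> C' * det_norm g ^ M'"
      by (rule rapid_decayE[OF fh(2), where N = "N"], rule that)
    have "cmod (f g + h g) * entry_norm g ^ N \<le> (C + C') * det_norm g ^ (M + M')" if g: "g \<in> GL" for g
    proof -
      have "cmod (f g) * entry_norm g ^ N \<le> C * det_norm g ^ (M + M')"
        by (rule order_trans[OF f(2)[OF g]]) (use f(1) det_norm_ge_1[of g] in \<open>auto intro!: mult_left_mono power_increasing\<close>)
      moreover have "cmod (h g) * entry_norm g ^ N \<le> C' * det_norm g ^ (M + M')"
        by (rule order_trans[OF h(2)[OF g]]) (use h(1) det_norm_ge_1[of g] in \<open>auto intro!: mult_left_mono power_increasing\<close>)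
      moreover have "cmod (f g + h g) * entry_norm g ^ N \<le> (cmod (f g) + cmod (h g)) * entry_norm g ^ N"
        using entry_norm_ge_1[of g] by (intro mult_right_mono norm_triangle_ineq) auto
      ultimately show ?thesis by (simp only: ring_distribs)
    qed
    then show "\<exists>C M. \<forall>g\<in>GL. cmod (f g + h g) * entry_norm g ^ N \<le> C * det_norm g ^ M" by blast
  qed
next
  fix f h :: "'a^'b^'b \<Rightarrow> complex" assume fh: "f \<in> slow_growth" "h \<in> rapid_decay"
  show "(\<lambda>g. f g * h g) \<in> rapid_decay"
    unfolding rapid_decay_def
  proof (intro CollectI allI)
    fix N
    obtain C' M' N' where f: "C' \<ge> 0" "\<And>g. g \<in> GL \<Longrightarrow> cmod (f g) \<le> C' * (det_norm g ^ M' * entry_norm g ^ N')"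
      by (rule slow_growthE[OF fh(1)], rule that)
    obtain C M where h: "C \<ge> 0" "\<And>g. g \<in> GL \<Longrightarrow> cmod (h g) * entry_norm g ^ (N' + N) \<le> C * det_norm g ^ M"
      by (rule rapid_decayE[OF fh(2), where N = "N' + N"], rule that)
    have "cmod (f g * h g) * entry_norm g ^ N \<le> (C * C') * det_norm g ^ (M + M')" if g: "g \<in> GL" for g
    proof -
      have "cmod (f g * h g) * entry_norm g ^ N = cmod (f g) * (cmod (h g) * entry_norm g ^ N)"
        by (simp add: norm_mult)
      also have "\<dots> \<le> (C' * (det_norm g ^ M' * entry_norm g ^ N')) * (cmod (h g) * entry_norm g ^ N)"
        using entry_norm_ge_1[of g] by (intro mult_right_mono f(2) g) auto
      also have "\<dots> = (C' * det_norm g ^ M') * (cmod (h g) * entry_norm g ^ (N' + N))"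
        by (simp add: power_add)
      also have "\<dots> \<le> (C' * det_norm g ^ M') * (C * det_norm g ^ M)"
        using det_norm_ge_1[of g] f(1) by (intro mult_left_mono h(2) g) auto
      finally show ?thesis by (simp add: power_add mult_ac)
    qed
    then show "\<exists>C M. \<forall>g\<in>GL. cmod (f g * h g) * entry_norm g ^ N \<le> C * det_norm g ^ M" by blast
  qed
qed (auto simp: rapid_decay_def)

lemma slow_growth_of_bound:
  assumes "\<And>g. g \<in> GL \<Longrightarrow> cmod (f g) \<le> C * (det_norm g ^ M * entry_norm g ^ N)"
  shows "f \<in> slow_growth"
  using assms unfolding slow_growth_def by blast

section \<open>Differentiability with growth conditions\<close>

text \<open>The recursion asks for some function that is the derivative on \<open>GL\<^sub>n(F)\<close>, instead of naming the derivative;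
  thus the values of the functions at singular matrices are irrelevant at every order. Derivatives are taken
  along constant directions, because these generate straight lines.\<close>

primrec Ck_in :: "('a::local_field_char_0^'n^'n \<Rightarrow> complex) set \<Rightarrow> nat \<Rightarrow> ('a^'n^'n \<Rightarrow> complex) \<Rightarrow> bool" where
  "Ck_in B 0 f \<longleftrightarrow> continuous_on GL f \<and> f \<in> B"
| "Ck_in B (Suc k) f \<longleftrightarrow> continuous_on GL f \<and> f \<in> B \<and>
     (\<forall>X. \<exists>f'. Ck_in B k f' \<and> (\<forall>g\<in>GL. has_dd f X g (f' g)))"

lemma Ck_in_D: "Ck_in B k f \<Longrightarrow> continuous_on GL f" "Ck_in B k f \<Longrightarrow> f \<in> B"
  by (cases k; simp)+

lemma Ck_in_Suc_D: "Ck_in B (Suc k) f \<Longrightarrow> Ck_in B k f"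
proof (induction k arbitrary: f)
  case (Suc k)
  show ?case
    unfolding Ck_in.simps(2)[of B k]
  proof (intro conjI allI)
    fix X
    obtain f' where "Ck_in B (Suc k) f'" "\<forall>g\<in>GL. has_dd f X g (f' g)"
      using Suc.prems unfolding Ck_in.simps(2)[of B "Suc k" f] by metis
    then show "\<exists>f'. Ck_in B k f' \<and> (\<forall>g\<in>GL. has_dd f X g (f' g))" using Suc.IH by blast
  qed (use Suc.prems in auto)
qed simp

lemma Ck_in_SucI:
  assumes "continuous_on GL f" "f \<in> B" "\<And>X. \<exists>f'. Ck_in B k f' \<and> (\<forall>g\<in>GL. has_dd f X g (f' g))"
  shows "Ck_in B (Suc k) f"
  using assms by auto

lemma Ck_in_SucE:
  assumes "Ck_in B (Suc k) f"
  obtains f' where "Ck_in B k f'" "\<And>g. g \<in> GL \<Longrightarrow> has_dd f X g (f' g)"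
  using assms unfolding Ck_in.simps by metis

text \<open>The mean value inequality, for segments with endpoints in either order.\<close>

lemma norm_diff_le_vector_derivative:
  fixes u :: "real \<Rightarrow> complex"
  assumes "\<And>\<theta>. \<theta> \<in> closed_segment a b \<Longrightarrow> (u has_vector_derivative u' \<theta>) (at \<theta>)"
    and "\<And>\<theta>. \<theta> \<in> closed_segment a b \<Longrightarrow> norm (u' \<theta>) \<le> B"
  shows "norm (u b - u a) \<le> B * \<bar>b - a\<bar>"
proof -
  have "norm (u b - u a) \<le> B * norm (b - a)"
  proof (rule differentiable_bound[of "closed_segment a b" u "\<lambda>\<theta> h. h *\<^sub>R u' \<theta>"])
    fix \<theta> assume \<theta>: "\<theta> \<in> closed_segment a b"
    show "(u has_derivative (\<lambda>h. h *\<^sub>R u' \<theta>)) (at \<theta> within closed_segment a b)"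
      using assms(1)[OF \<theta>] by (auto simp: has_vector_derivative_def intro: has_derivative_at_withinI)
    have "norm (h *\<^sub>R u' \<theta>) \<le> B * norm h" for h
      using mult_right_mono[OF assms(2)[OF \<theta>], of "\<bar>h\<bar>"] by (simp add: mult.commute)
    then show "onorm (\<lambda>h. h *\<^sub>R u' \<theta>) \<le> B" by (rule onorm_le)
  qed auto
  then show ?thesis by simp
qed

context archimedean_local_field
begin

lemma has_dd_scale:
  fixes f :: "'a^'n^'n \<Rightarrow> complex"
  assumes "has_dd f X g d"
  shows "has_dd f (scaleM r X) g (of_real r * d)"
proof -
  have "((\<lambda>t. t * r) has_vector_derivative r) (at 0)"
    by (auto intro!: derivative_eq_intros simp: has_real_derivative_iff_has_vector_derivative[symmetric])
  moreover have "((\<lambda>t. f (g + scaleM t X)) has_vector_derivative d) (at (0 * r))"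
    using assms by (simp add: has_dd_def)
  ultimately have "((\<lambda>t. f (g + scaleM t X)) \<circ> (\<lambda>t. t * r) has_vector_derivative (r *\<^sub>R d)) (at 0)"
    by (rule vector_diff_chain_at)
  then show ?thesis by (simp add: has_dd_def o_def scaleR_conv_of_real)
qed

text \<open>Move first along \<open>t X\<close>, then along \<open>t Y\<close>: by the mean value inequality the second increment is
  \<open>t D(g)\<close> up to \<open>o(t)\<close>, because the derivative along \<open>Y\<close> is continuous at \<open>g\<close>.\<close>

lemma has_dd_add_direction:
  fixes f :: "'a^'n^'n \<Rightarrow> complex"
  assumes X: "has_dd f X g p" and Y: "\<And>g. g \<in> GL \<Longrightarrow> has_dd f Y g (D g)"
    and D: "continuous_on GL D" and g: "g \<in> GL"
  shows "has_dd f (X + Y) g (p + D g)"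
proof -
  define w where "w = (\<lambda>t. f (g + scaleM t X + scaleM t Y) - f (g + scaleM t X))"
  have "(w has_vector_derivative D g) (at 0)"
    unfolding has_vector_derivative_def has_derivative_at_alt
  proof (intro conjI allI impI)
    show "bounded_linear (\<lambda>x. x *\<^sub>R D g)" by (rule bounded_linear_scaleR_left)
    fix e :: real assume e: "e > 0"
    define P where "P = (\<lambda>ab. g + scaleM (fst ab) X + scaleM (snd ab) Y)"
    have Pc: "continuous_on UNIV P" unfolding P_def by (intro continuous_intros)
    have "open (P -` GL)" by (rule open_vimage[OF open_GL Pc])
    moreover have "continuous_on (P -` GL) (\<lambda>ab. D (P ab))"
      by (rule continuous_on_compose2[OF D continuous_on_subset[OF Pc]]) auto
    ultimately have "open ((\<lambda>ab. D (P ab)) -` ball (D g) e \<inter> P -` GL)"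
      using continuous_on_open_vimage[of "P -` GL" "\<lambda>ab. D (P ab)"] by auto
    moreover have "(0, 0) \<in> (\<lambda>ab. D (P ab)) -` ball (D g) e \<inter> P -` GL"
      using e g by (simp add: P_def)
    ultimately obtain S T where ST: "open S" "open T" "(0, 0) \<in> S \<times> T" "S \<times> T \<subseteq> (\<lambda>ab. D (P ab)) -` ball (D g) e \<inter> P -` GL"
      by (rule open_prod_elim)
    then have "open (S \<inter> T)" "0 \<in> S \<inter> T" by auto
    then obtain \<delta> where \<delta>: "\<delta> > 0" "ball 0 \<delta> \<subseteq> S \<inter> T" by (meson open_contains_ball)
    have near: "P (t, \<theta>) \<in> GL" "norm (D (P (t, \<theta>)) - D g) \<le> e" if "\<bar>t\<bar> < \<delta>" "\<bar>\<theta>\<bar> < \<delta>" for t \<theta>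
    proof -
      have "(t, \<theta>) \<in> S \<times> T" using that \<delta> by (auto simp: subset_iff dist_norm)
      then show "P (t, \<theta>) \<in> GL" "norm (D (P (t, \<theta>)) - D g) \<le> e"
        using ST(4) by (auto simp: subset_iff dist_norm norm_minus_commute less_imp_le)
    qed
    show "\<exists>d>0. \<forall>y. norm (y - 0) < d \<longrightarrow> norm (w y - w 0 - (y - 0) *\<^sub>R D g) \<le> e * norm (y - 0)"
    proof (intro exI conjI allI impI, rule \<delta>(1))
      fix t :: real assume t: "norm (t - 0) < \<delta>"
      define u where "u = (\<lambda>\<theta>. f (P (t, \<theta>)) - \<theta> *\<^sub>R D g)"
      have seg: "\<bar>\<theta>\<bar> < \<delta>" if "\<theta> \<in> closed_segment 0 t" for \<theta>
        using that t by (auto simp: closed_segment_eq_real_ivl split: if_splits)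
      have "norm (u t - u 0) \<le> e * \<bar>t - 0\<bar>"
      proof (rule norm_diff_le_vector_derivative)
        fix \<theta> assume "\<theta> \<in> closed_segment 0 t"
        then have \<theta>: "P (t, \<theta>) \<in> GL" "norm (D (P (t, \<theta>)) - D g) \<le> e" using near seg t by auto
        then show "norm (D (P (t, \<theta>)) - D g) \<le> e" by simp
        have "has_dd f Y (g + scaleM t X + scaleM \<theta> Y) (D (P (t, \<theta>)))" using Y[OF \<theta>(1)] by (simp add: P_def)
        from has_dd_along_line[OF this]
        show "(u has_vector_derivative D (P (t, \<theta>)) - D g) (at \<theta>)"
          unfolding u_def by (auto simp: P_def intro!: derivative_eq_intros)
      qed
      then show "norm (w t - w 0 - (t - 0) *\<^sub>R D g) \<le> e * norm (t - 0)"
        by (simp add: u_def w_def P_def algebra_simps)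
    qed
  qed
  from has_vector_derivative_add[OF X[unfolded has_dd_def] this]
  show ?thesis by (simp add: has_dd_def w_def scaleM_add add.assoc)
qed

lemma has_dd_zero_direction: "has_dd (f :: 'a^'n^'n \<Rightarrow> complex) 0 g 0"
  by (simp add: has_dd_def)

lemma has_dd_linear_combination:
  fixes f :: "'a^'n^'n \<Rightarrow> complex"
  assumes "finite I" "\<And>i g. i \<in> I \<Longrightarrow> g \<in> GL \<Longrightarrow> has_dd f (X i) g (D i g)"
    and "\<And>i. i \<in> I \<Longrightarrow> continuous_on GL (D i)" and g: "g \<in> GL"
  shows "has_dd f (\<Sum>i\<in>I. scaleM (c i) (X i)) g (\<Sum>i\<in>I. of_real (c i) * D i g)"
  using assms(1-3)
proof (induction I rule: finite_induct)
  case empty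
  then show ?case by (simp add: has_dd_zero_direction)
next
  case (insert i I)
  have "has_dd f ((\<Sum>i\<in>I. scaleM (c i) (X i)) + scaleM (c i) (X i)) g ((\<Sum>i\<in>I. of_real (c i) * D i g) + of_real (c i) * D i g)"
    by (rule has_dd_add_direction[where D = "\<lambda>g. of_real (c i) * D i g"])
       (use insert g in \<open>auto intro!: has_dd_scale continuous_intros\<close>)
  then show ?case using insert.hyps by (simp add: add.commute)
qed

end

section \<open>The total derivative in real coordinates\<close>

text \<open>Over a real field the imaginary unit is not in the range of the embedding and this is an arbitrary element;
  its coefficient is then always zero. This allows the same real coordinates in both cases.\<close>

definition imag_unit :: "'a::local_field_char_0" where
  "imag_unit = inv arch_emb \<i>"

definition coord_basis :: "'n \<times> 'n \<times> bool \<Rightarrow> 'a::local_field_char_0^'n^'n" where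
  "coord_basis = (\<lambda>(k, l, b). \<chi> i j. if i = k \<and> j = l then (if b then imag_unit else 1) else 0)"

definition coord :: "'a::local_field_char_0^'n^'n \<Rightarrow> 'n \<times> 'n \<times> bool \<Rightarrow> real" where
  "coord X = (\<lambda>(k, l, b). (if b then Im else Re) (arch_emb (X $ k $ l)))"

context archimedean_local_field
begin

lemma real_imag_decomposition:
  "(x :: 'a) = real_emb (Re (emb x)) + real_emb (Im (emb x)) * imag_unit"
proof -
  have "emb x = complex_of_real (Re (emb x)) + complex_of_real (Im (emb x)) * emb imag_unit"
    using emb_range
  proof
    assume "range emb = \<real>"
    then have "emb x \<in> \<real>" by blast
    then show ?thesis by (auto simp: complex_is_Real_iff complex_eq_iff)
  next
    assume "range emb = UNIV"
    then have "emb imag_unit = \<i>" unfolding imag_unit_def by (intro emb_inv) auto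
    then show ?thesis by (simp add: complex_eq mult.commute)
  qed
  then show ?thesis unfolding emb_eq_iff[symmetric] by simp
qed

lemma coord_decomposition:
  fixes X :: "'a^'n^'n"
  shows "X = (\<Sum>e\<in>UNIV. scaleM (coord X e) (coord_basis e))"
proof -
  have "(\<Sum>e\<in>UNIV. scaleM (coord X e) (coord_basis e)) $ i $ j = X $ i $ j" for i j
  proof -
    have "(\<Sum>e\<in>UNIV. scaleM (coord X e) (coord_basis e)) $ i $ j = (\<Sum>e\<in>UNIV. real_emb (coord X e) * coord_basis e $ i $ j)"
      by (simp add: sum_component scaleM_def)
    also have "\<dots> = (\<Sum>k\<in>UNIV. \<Sum>l\<in>UNIV. \<Sum>b\<in>UNIV. real_emb (coord X (k, l, b)) * coord_basis (k, l, b) $ i $ j)"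
      by (simp add: UNIV_Times_UNIV[symmetric] sum.cartesian_product' del: UNIV_Times_UNIV)
    also have "\<dots> = (\<Sum>k\<in>UNIV. \<Sum>l\<in>UNIV. if i = k then if j = l then X $ k $ l else 0 else 0)"
    proof (intro sum.cong refl)
      fix k l
      show "(\<Sum>b\<in>UNIV. real_emb (coord X (k, l, b)) * coord_basis (k, l, b) $ i $ j) = (if i = k then if j = l then X $ k $ l else 0 else 0)"
        using real_imag_decomposition[of "X $ k $ l"]
        by (auto simp: UNIV_bool coord_def coord_basis_def add.commute)
    qed
    also have "\<dots> = (\<Sum>k\<in>UNIV. if i = k then X $ k $ j else 0)"
      by (intro sum.cong refl) auto
    finally show ?thesis by simp
  qed
  then show ?thesis by (simp add: vec_eq_iff)
qed

text \<open>The derivative is linear in the direction, with coefficients given by finitely many functions of the class.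
  This is what makes derivatives along directions that vary with the point accessible.\<close>

lemma Ck_in_total_derivative:
  fixes f :: "'a^'n^'n \<Rightarrow> complex"
  assumes "Ck_in B (Suc k) f"
  obtains D where "\<And>e. Ck_in B k (D e)"
    "\<And>g X. g \<in> GL \<Longrightarrow> has_dd f X g (\<Sum>e\<in>UNIV. of_real (coord X e) * D e g)"
proof -
  have "\<exists>f'. Ck_in B k f' \<and> (\<forall>g\<in>GL. has_dd f (coord_basis e) g (f' g))" for e
    using assms by auto
  then obtain D where D: "\<And>e. Ck_in B k (D e)" "\<And>e g. g \<in> GL \<Longrightarrow> has_dd f (coord_basis e) g (D e g)"
    by metis
  have "has_dd f X g (\<Sum>e\<in>UNIV. of_real (coord X e) * D e g)" if g: "g \<in> GL" for g X
    by (subst coord_decomposition[of X], rule has_dd_linear_combination) (use D(2) g Ck_in_D(1)[OF D(1)] in auto)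
  then show ?thesis using D that by blast
qed

end

section \<open>Calculus of slowly growing functions\<close>

lemma slow_growth_const [simp]: "(\<lambda>g. c) \<in> slow_growth"
  by (rule slow_growth_of_bound[of _ "cmod c" 0 0]) simp

lemma slow_growth_add:
  "f \<in> slow_growth \<Longrightarrow> h \<in> slow_growth \<Longrightarrow> (\<lambda>g. f g + h g) \<in> slow_growth"
  using growth_module_slow unfolding growth_module_def by blast

text \<open>Only the absolute value counts, so a bound by an expression built from slowly growing functions
  suffices.\<close>

lemma slow_growth_dominated:
  assumes "h \<in> slow_growth" "\<And>g. g \<in> GL \<Longrightarrow> cmod (f g) \<le> cmod (h g)"
  shows "f \<in> slow_growth"
proof -
  obtain C M N where *: "C \<ge> 0" "\<And>g. g \<in> GL \<Longrightarrow> cmod (h g) \<le> C * (det_norm g ^ M * entry_norm g ^ N)"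
    by (rule slow_growthE[OF assms(1)], rule that)
  show ?thesis
    by (rule slow_growth_of_bound, rule order_trans[OF assms(2) *(2)])
qed

lemma slow_growth_sum:
  assumes "\<And>i. i \<in> I \<Longrightarrow> f i \<in> slow_growth"
  shows "(\<lambda>g. \<Sum>i\<in>I. f i g) \<in> slow_growth"
  using assms by (induction I rule: infinite_finite_induct) (auto intro: slow_growth_add)

lemma slow_growth_power:
  assumes "f \<in> slow_growth"
  shows "(\<lambda>g. f g ^ n) \<in> slow_growth"
  using assms by (induction n) (auto intro: slow_growth_mult)

lemma slow_growth_norm:
  assumes "f \<in> slow_growth"
  shows "(\<lambda>g. complex_of_real (cmod (f g))) \<in> slow_growth"
  using assms by (rule slow_growth_dominated) simp

context archimedean_local_field
begin

lemma Ck_in_cong: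
  fixes f :: "'a^'n^'n \<Rightarrow> complex"
  assumes "growth_module B" "Ck_in B k f" "\<And>g. g \<in> GL \<Longrightarrow> f g = h g"
  shows "Ck_in B k h"
proof -
  have c: "continuous_on GL h"
    by (rule continuous_on_eq[OF Ck_in_D(1)[OF assms(2)] assms(3)])
  have B: "h \<in> B"
    using assms(1,3) Ck_in_D(2)[OF assms(2)] unfolding growth_module_def by metis
  show ?thesis
  proof (cases k)
    case 0 then show ?thesis using c B by simp
  next
    case (Suc k')
    show ?thesis unfolding Suc
    proof (rule Ck_in_SucI[OF c B])
      fix X
      obtain f' where f': "Ck_in B k' f'" "\<And>g. g \<in> GL \<Longrightarrow> has_dd f X g (f' g)"
        by (rule Ck_in_SucE[OF assms(2)[unfolded Suc], of X], rule that)
      have "has_dd h X g (f' g)" if "g \<in> GL" for g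
        by (rule has_dd_cong[OF f'(2)[OF that] assms(3) that])
      then show "\<exists>f'. Ck_in B k' f' \<and> (\<forall>g\<in>GL. has_dd h X g (f' g))" using f'(1) by blast
    qed
  qed
qed

lemma Ck_in_add:
  fixes f h :: "'a^'n^'n \<Rightarrow> complex"
  assumes "growth_module B" "Ck_in B k f" "Ck_in B k h"
  shows "Ck_in B k (\<lambda>g. f g + h g)"
  using assms(2,3)
proof (induction k arbitrary: f h)
  case 0
  then show ?case using assms(1) by (auto simp: growth_module_def intro!: continuous_intros)
next
  case (Suc k)
  show ?case
  proof (rule Ck_in_SucI)
    show "continuous_on GL (\<lambda>g. f g + h g)"
      by (intro continuous_intros Ck_in_D(1)[OF Suc.prems(1)] Ck_in_D(1)[OF Suc.prems(2)])
    show "(\<lambda>g. f g + h g) \<in> B"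
      using assms(1) Ck_in_D(2)[OF Suc.prems(1)] Ck_in_D(2)[OF Suc.prems(2)] unfolding growth_module_def by blast
    fix X
    obtain f' where f': "Ck_in B k f'" "\<And>g. g \<in> GL \<Longrightarrow> has_dd f X g (f' g)"
      by (rule Ck_in_SucE[OF Suc.prems(1), of X], rule that)
    obtain h' where h': "Ck_in B k h'" "\<And>g. g \<in> GL \<Longrightarrow> has_dd h X g (h' g)"
      by (rule Ck_in_SucE[OF Suc.prems(2), of X], rule that)
    show "\<exists>d. Ck_in B k d \<and> (\<forall>g\<in>GL. has_dd (\<lambda>g. f g + h g) X g (d g))"
      using Suc.IH[OF f'(1) h'(1)] f'(2) h'(2) unfolding has_dd_def
      by (intro exI[of _ "\<lambda>g. f' g + h' g"]) (auto intro: has_vector_derivative_add)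
  qed
qed

text \<open>One Leibniz rule serves both growth classes; the second factor decides the class of the product.\<close>

lemma Ck_in_mult:
  fixes f h :: "'a^'n^'n \<Rightarrow> complex"
  assumes "growth_module B" "Ck_in slow_growth k f" "Ck_in B k h"
  shows "Ck_in B k (\<lambda>g. f g * h g)"
  using assms(2,3)
proof (induction k arbitrary: f h)
  case 0
  then show ?case using assms(1) by (auto simp: growth_module_def intro!: continuous_intros)
next
  case (Suc k)
  show ?case
  proof (rule Ck_in_SucI)
    show "continuous_on GL (\<lambda>g. f g * h g)"
      by (intro continuous_intros Ck_in_D(1)[OF Suc.prems(1)] Ck_in_D(1)[OF Suc.prems(2)])
    show "(\<lambda>g. f g * h g) \<in> B"
      using assms(1) Ck_in_D(2)[OF Suc.prems(1)] Ck_in_D(2)[OF Suc.prems(2)] unfolding growth_module_def by blast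
    fix X
    obtain f' where f': "Ck_in slow_growth k f'" "\<And>g. g \<in> GL \<Longrightarrow> has_dd f X g (f' g)"
      by (rule Ck_in_SucE[OF Suc.prems(1), of X], rule that)
    obtain h' where h': "Ck_in B k h'" "\<And>g. g \<in> GL \<Longrightarrow> has_dd h X g (h' g)"
      by (rule Ck_in_SucE[OF Suc.prems(2), of X], rule that)
    have "Ck_in B k (\<lambda>g. f g * h' g + f' g * h g)"
      by (intro Ck_in_add assms(1) Suc.IH f'(1) h'(1) Ck_in_Suc_D[OF Suc.prems(1)] Ck_in_Suc_D[OF Suc.prems(2)])
    moreover have "has_dd (\<lambda>g. f g * h g) X g (f g * h' g + f' g * h g)" if "g \<in> GL" for g
      using has_vector_derivative_mult[OF f'(2)[OF that, unfolded has_dd_def] h'(2)[OF that, unfolded has_dd_def]]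
      by (simp add: has_dd_def)
    ultimately show "\<exists>d. Ck_in B k d \<and> (\<forall>g\<in>GL. has_dd (\<lambda>g. f g * h g) X g (d g))"
      by (intro exI[of _ "\<lambda>g. f g * h' g + f' g * h g"] conjI ballI)
  qed
qed

lemma Ck_in_const: "Ck_in slow_growth k (\<lambda>g :: 'a^'n^'n. c)"
proof (induction k arbitrary: c)
  case (Suc k)
  show ?case
    by (rule Ck_in_SucI) (use Suc in \<open>auto simp: has_dd_def intro!: exI[of _ "\<lambda>g. 0"]\<close>)
qed simp

lemma Ck_in_cnj:
  fixes f :: "'a^'n^'n \<Rightarrow> complex"
  assumes "Ck_in slow_growth k f"
  shows "Ck_in slow_growth k (\<lambda>g. cnj (f g))"
  using assms
proof (induction k arbitrary: f)
  case 0
  then show ?case by (auto intro!: continuous_intros intro: slow_growth_dominated)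
next
  case (Suc k)
  show ?case
  proof (rule Ck_in_SucI)
    show "continuous_on GL (\<lambda>g. cnj (f g))"
      by (intro continuous_intros Ck_in_D(1)[OF Suc.prems])
    show "(\<lambda>g. cnj (f g)) \<in> slow_growth"
      by (rule slow_growth_dominated[OF Ck_in_D(2)[OF Suc.prems]]) simp
    fix X
    obtain f' where f': "Ck_in slow_growth k f'" "\<And>g. g \<in> GL \<Longrightarrow> has_dd f X g (f' g)"
      by (rule Ck_in_SucE[OF Suc.prems, of X], rule that)
    show "\<exists>d. Ck_in slow_growth k d \<and> (\<forall>g\<in>GL. has_dd (\<lambda>g. cnj (f g)) X g (d g))"
      using Suc.IH[OF f'(1)] f'(2) unfolding has_dd_def
      by (intro exI[of _ "\<lambda>g. cnj (f' g)"]) (auto intro: bounded_linear.has_vector_derivative[OF bounded_linear_cnj])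
  qed
qed

lemmas Ck_in_slow_add = Ck_in_add[OF growth_module_slow]
  and Ck_in_slow_mult = Ck_in_mult[OF growth_module_slow]
  and Ck_in_slow_cong = Ck_in_cong[OF growth_module_slow]

text \<open>Real coordinates of matrices enter through real and imaginary parts, which are combinations of a function
  and its conjugate.\<close>

lemma Ck_in_Re_Im:
  fixes f :: "'a^'n^'n \<Rightarrow> complex"
  assumes "Ck_in slow_growth k f"
  shows "Ck_in slow_growth k (\<lambda>g. of_real (Re (f g)))" "Ck_in slow_growth k (\<lambda>g. of_real (Im (f g)))"
proof -
  have "Ck_in slow_growth k (\<lambda>g. (1/2) * (f g + cnj (f g)))"
    by (intro Ck_in_slow_mult Ck_in_slow_add Ck_in_const Ck_in_cnj assms)
  then show "Ck_in slow_growth k (\<lambda>g. of_real (Re (f g)))"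
    by (rule Ck_in_slow_cong) (simp add: complex_eq_iff)
  have "Ck_in slow_growth k (\<lambda>g. (- \<i> / 2) * (f g + (- 1) * cnj (f g)))"
    by (intro Ck_in_slow_mult Ck_in_slow_add Ck_in_const Ck_in_cnj assms)
  then show "Ck_in slow_growth k (\<lambda>g. of_real (Im (f g)))"
    by (rule Ck_in_slow_cong) (simp add: complex_eq_iff)
qed

lemma Ck_in_sum:
  fixes f :: "'i \<Rightarrow> 'a^'n^'n \<Rightarrow> complex"
  assumes B: "growth_module B" "(\<lambda>g. 0) \<in> B" and f: "\<And>i. i \<in> I \<Longrightarrow> Ck_in B k (f i)"
  shows "Ck_in B k (\<lambda>g. \<Sum>i\<in>I. f i g)"
proof -
  have z: "Ck_in B k (\<lambda>g. 0)"
  proof (induction k)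
    case 0 then show ?case using B(2) by simp
  next
    case (Suc k)
    show ?case by (rule Ck_in_SucI) (use Suc B(2) in \<open>auto simp: has_dd_def intro!: exI[of _ "\<lambda>g. 0"]\<close>)
  qed
  show ?thesis
    using f by (induction I rule: infinite_finite_induct) (auto intro!: Ck_in_add[OF B(1)] z)
qed

lemmas Ck_in_slow_sum = Ck_in_sum[OF growth_module_slow slow_growth_const]

lemma Ck_in_slow_prod:
  fixes f :: "'i \<Rightarrow> 'a^'n^'n \<Rightarrow> complex"
  assumes "\<And>i. i \<in> I \<Longrightarrow> Ck_in slow_growth k (f i)"
  shows "Ck_in slow_growth k (\<lambda>g. \<Prod>i\<in>I. f i g)"
  using assms by (induction I rule: infinite_finite_induct) (auto intro!: Ck_in_slow_mult Ck_in_const)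

lemma slow_growth_entry: "(\<lambda>g :: 'a^'n^'n. emb (g $ i $ j)) \<in> slow_growth"
proof (rule slow_growth_of_bound[of _ 1 0 1])
  fix g :: "'a^'n^'n"
  show "cmod (emb (g $ i $ j)) \<le> 1 * (det_norm g ^ 0 * entry_norm g ^ 1)"
    using entry_le_entry_norm[of g i j] by simp
qed

lemma Ck_in_entry: "Ck_in slow_growth k (\<lambda>g :: 'a^'n^'n. emb (g $ i $ j))"
proof (cases k)
  case 0
  then show ?thesis using slow_growth_entry by (auto intro!: continuous_intros)
next
  case (Suc k')
  show ?thesis unfolding Suc
  proof (rule Ck_in_SucI)
    show "continuous_on GL (\<lambda>g :: 'a^'n^'n. emb (g $ i $ j))" by (intro continuous_intros)
    fix X :: "'a^'n^'n"
    have "has_dd (\<lambda>g. emb (g $ i $ j)) X g (emb (X $ i $ j))" for g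
      unfolding has_dd_def by (auto simp: scaleM_def intro!: derivative_eq_intros)
    then show "\<exists>d. Ck_in slow_growth k' d \<and> (\<forall>g\<in>GL. has_dd (\<lambda>g. emb (g $ i $ j)) X g (d g))"
      using Ck_in_const by (intro exI[of _ "\<lambda>g. emb (X $ i $ j)"]) blast
  qed (rule slow_growth_entry)
qed

lemma Ck_in_det:
  fixes A :: "'a^'n^'n \<Rightarrow> 'a^'n^'n"
  assumes "\<And>i j. Ck_in slow_growth k (\<lambda>g. emb (A g $ i $ j))"
  shows "Ck_in slow_growth k (\<lambda>g. emb (det (A g)))"
  unfolding emb_det by (intro Ck_in_slow_sum Ck_in_slow_mult Ck_in_slow_prod Ck_in_const assms)

text \<open>The derivative of \<open>1/u\<close> is \<open>- u' (1/u)\<^sup>2\<close>, so induction on the order needs the growth of \<open>1/u\<close> itself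
  only.\<close>

lemma Ck_in_inverse:
  fixes u :: "'a^'n^'n \<Rightarrow> complex"
  assumes "Ck_in slow_growth k u" "\<And>g. g \<in> GL \<Longrightarrow> u g \<noteq> 0" "(\<lambda>g. inverse (u g)) \<in> slow_growth"
  shows "Ck_in slow_growth k (\<lambda>g. inverse (u g))"
  using assms(1)
proof (induction k)
  case 0
  then show ?case using assms by (auto intro!: continuous_intros)
next
  case (Suc k)
  have IH: "Ck_in slow_growth k (\<lambda>g. inverse (u g))" by (rule Suc.IH[OF Ck_in_Suc_D[OF Suc.prems]])
  show ?case
  proof (rule Ck_in_SucI[OF _ assms(3)])
    show "continuous_on GL (\<lambda>g. inverse (u g))"
      by (intro continuous_intros Ck_in_D(1)[OF Suc.prems]) (use assms(2) in auto)
    fix X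
    obtain u' where u': "Ck_in slow_growth k u'" "\<And>g. g \<in> GL \<Longrightarrow> has_dd u X g (u' g)"
      by (rule Ck_in_SucE[OF Suc.prems, of X], rule that)
    have "Ck_in slow_growth k (\<lambda>g. (- 1) * (u' g * (inverse (u g) * inverse (u g))))"
      by (intro Ck_in_slow_mult Ck_in_const u'(1) IH)
    moreover have "has_dd (\<lambda>g. inverse (u g)) X g ((- 1) * (u' g * (inverse (u g) * inverse (u g))))" if g: "g \<in> GL" for g
    proof -
      have "(inverse has_field_derivative (- (inverse (u g) * inverse (u g)))) (at (u (g + scaleM 0 X)))"
        using DERIV_inverse[OF assms(2)[OF g], of UNIV] by simp
      from field_vector_diff_chain_at[OF u'(2)[OF g, unfolded has_dd_def] this]
      show ?thesis by (simp add: has_dd_def o_def)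
    qed
    ultimately show "\<exists>d. Ck_in slow_growth k d \<and> (\<forall>g\<in>GL. has_dd (\<lambda>g. inverse (u g)) X g (d g))"
      by (intro exI[of _ "\<lambda>g. (- 1) * (u' g * (inverse (u g) * inverse (u g)))"] conjI ballI)
  qed
qed

lemma emb_det_nonzero: "g \<in> GL \<Longrightarrow> emb (det (g :: 'a^'n^'n)) \<noteq> 0"
  by (simp add: GL_iff_det)

lemma Ck_in_inverse_det: "Ck_in slow_growth k (\<lambda>g :: 'a^'n^'n. inverse (emb (det g)))"
proof (rule Ck_in_inverse)
  show "Ck_in slow_growth k (\<lambda>g :: 'a^'n^'n. emb (det g))"
    by (intro Ck_in_det Ck_in_entry)
  show "(\<lambda>g :: 'a^'n^'n. inverse (emb (det g))) \<in> slow_growth"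
    by (rule slow_growth_of_bound[of _ 1 1 0]) (simp add: det_norm_def norm_inverse divide_inverse)
qed (rule emb_det_nonzero)

lemma Ck_in_matrix_inv_entry: "Ck_in slow_growth k (\<lambda>g :: 'a^'n^'n. emb (matrix_inv g $ i $ j))"
proof -
  let ?A = "\<lambda>g :: 'a^'n^'n. \<chi> i' j'. if j' = i then axis j 1 $ i' else g $ i' $ j'"
  have "Ck_in slow_growth k (\<lambda>g. emb (?A g $ i' $ j'))" for i' j'
    by (cases "j' = i") (simp_all add: Ck_in_const Ck_in_entry)
  then have "Ck_in slow_growth k (\<lambda>g. emb (det (?A g)) * inverse (emb (det g)))"
    by (intro Ck_in_slow_mult Ck_in_det Ck_in_inverse_det)
  then show ?thesis
    by (rule Ck_in_slow_cong) (simp add: matrix_inv_entry divide_inverse emb_inverse)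
qed

lemma slow_growth_norm_det_powr:
  assumes "e \<ge> 0"
  shows "(\<lambda>g :: 'a^'n^'n. complex_of_real (cmod (emb (det g)) powr e)) \<in> slow_growth"
proof -
  define m where "m = nat \<lceil>e\<rceil>"
  have "e \<le> real m" unfolding m_def by linarith
  have "(\<lambda>g :: 'a^'n^'n. (1 + complex_of_real (cmod (emb (det g)))) ^ m) \<in> slow_growth"
    by (intro slow_growth_power slow_growth_add slow_growth_const slow_growth_norm Ck_in_D(2)[OF Ck_in_det[of 0]] Ck_in_entry)
  then show ?thesis
  proof (rule slow_growth_dominated)
    fix g :: "'a^'n^'n"
    define d where "d = cmod (emb (det g))"
    have "d \<ge> 0" by (simp add: d_def)
    have "d powr e \<le> (1 + d) powr e" using \<open>d \<ge> 0\<close> assms by (intro powr_mono2) auto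
    also have "\<dots> \<le> (1 + d) powr real m" using \<open>d \<ge> 0\<close> \<open>e \<le> real m\<close> by (intro powr_mono) auto
    also have "\<dots> = (1 + d) ^ m" using \<open>d \<ge> 0\<close> by (simp add: powr_realpow)
    finally have "d powr e \<le> (1 + d) ^ m" .
    moreover have "cmod ((1 + complex_of_real d) ^ m) = (1 + d) ^ m"
    proof -
      have "1 + complex_of_real d = complex_of_real (1 + d)" by simp
      then have "cmod (1 + complex_of_real d) = 1 + d" using \<open>d \<ge> 0\<close> by (simp only: norm_of_real)
      then show ?thesis by (simp only: norm_power)
    qed
    ultimately show "cmod (complex_of_real (cmod (emb (det g)) powr e)) \<le> cmod ((1 + complex_of_real (cmod (emb (det g)))) ^ m)"
      by (simp add: d_def)
  qed
qed

text \<open>The absolute value is not complex differentiable. With \<open>w = |u|\<^sup>2 = (Re u)\<^sup>2 + (Im u)\<^sup>2\<close> the function is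
  \<open>w\<close> to the power \<open>e/2\<close>; its derivative is rewritten so that the function itself reappears as a factor.\<close>

lemma has_dd_norm_powr:
  fixes u :: "'a^'n^'n \<Rightarrow> complex"
  assumes "has_dd u X g u'" "u g \<noteq> 0"
  shows "has_dd (\<lambda>g. complex_of_real (cmod (u g) powr e)) X g
    (of_real e * (of_real (cmod (u g) powr e) * ((inverse (u g) * inverse (cnj (u g))) *
      (of_real (Re (u g)) * of_real (Re u') + of_real (Im (u g)) * of_real (Im u')))))"
proof -
  define w where "w = (\<lambda>z. (Re z)\<^sup>2 + (Im z)\<^sup>2)"
  have wn: "w z = (cmod z)\<^sup>2" for z by (simp add: w_def cmod_power2)
  have wpos: "w (u g) > 0" using assms(2) by (simp add: wn)
  have pw: "cmod z powr e = w z powr (e / 2)" for z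
    by (simp add: wn powr_powr flip: powr_numeral)
  let ?u = "\<lambda>t. u (g + scaleM t X)"
  have "((\<lambda>t. Re (?u t)) has_real_derivative Re u') (at 0)" "((\<lambda>t. Im (?u t)) has_real_derivative Im u') (at 0)"
    unfolding has_real_derivative_iff_has_vector_derivative using assms(1)[unfolded has_dd_def]
    by (auto intro: bounded_linear.has_vector_derivative[OF bounded_linear_Re] bounded_linear.has_vector_derivative[OF bounded_linear_Im])
  moreover have "((\<lambda>t. w (?u t)) has_real_derivative (2 * (Re (u g) * Re u' + Im (u g) * Im u'))) (at 0)"
    if "((\<lambda>t. Re (?u t)) has_real_derivative Re u') (at 0)" "((\<lambda>t. Im (?u t)) has_real_derivative Im u') (at 0)"
  proof -
    have "((\<lambda>t. (r t)\<^sup>2 + (i t)\<^sup>2) has_real_derivative (2 * (r 0 * r' + i 0 * i'))) (at 0)"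
      if "(r has_real_derivative r') (at 0)" "(i has_real_derivative i') (at 0)" for r i r' i'
      using that by (auto intro!: derivative_eq_intros simp: algebra_simps)
    from this[OF that] show ?thesis unfolding w_def by simp
  qed
  ultimately have w': "((\<lambda>t. w (?u t)) has_real_derivative (2 * (Re (u g) * Re u' + Im (u g) * Im u'))) (at 0)"
    by blast
  have pw': "((\<lambda>y. y powr (e / 2)) has_real_derivative (e / 2) * w (u g) powr (e / 2 - 1)) (at (w (?u 0)))"
    using has_real_derivative_powr[OF wpos, of "e / 2"] by simp
  have cancel: "(e / 2) * P * (2 * Q) = e * (P * Q)" for P Q :: real by simp
  from DERIV_chain2[OF pw' w']
  have "((\<lambda>t. w (?u t) powr (e / 2)) has_real_derivative
      (e / 2) * w (u g) powr (e / 2 - 1) * (2 * (Re (u g) * Re u' + Im (u g) * Im u'))) (at 0)"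
    .
  then have "((\<lambda>t. complex_of_real (w (?u t) powr (e / 2))) has_vector_derivative
      complex_of_real (e * (w (u g) powr (e / 2 - 1) * (Re (u g) * Re u' + Im (u g) * Im u')))) (at 0)"
    unfolding has_real_derivative_iff_has_vector_derivative cancel
    by (rule bounded_linear.has_vector_derivative[OF bounded_linear_of_real])
  moreover have "w (u g) powr (e / 2 - 1) = w (u g) powr (e / 2) * inverse (w (u g))"
    unfolding powr_diff powr_one[OF less_imp_le[OF wpos]] divide_inverse ..
  moreover have "complex_of_real (inverse (w (u g))) = inverse (u g) * inverse (cnj (u g))"
  proof -
    have "inverse (u g) * inverse (cnj (u g)) = inverse (u g * cnj (u g))" by (simp only: inverse_mult_distrib)
    also have "u g * cnj (u g) = complex_of_real (w (u g))" by (simp add: w_def complex_mult_cnj)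
    finally show ?thesis by (simp only: of_real_inverse)
  qed
  ultimately show ?thesis
    by (simp add: has_dd_def pw mult_ac)
qed

text \<open>The derivative is the function itself times slowly growing functions, which the induction on the order uses.\<close>

lemma Ck_in_norm_det_powr:
  assumes "e \<ge> 0"
  shows "Ck_in slow_growth k (\<lambda>g :: 'a^'n^'n. complex_of_real (cmod (emb (det g)) powr e))"
proof (induction k)
  case 0
  then show ?case using slow_growth_norm_det_powr[OF assms]
    by (auto simp: GL_iff_det intro!: continuous_intros)
next
  case (Suc k)
  have det: "Ck_in slow_growth m (\<lambda>g :: 'a^'n^'n. emb (det g))" for m
    by (intro Ck_in_det Ck_in_entry)
  show ?case
  proof (rule Ck_in_SucI[OF Ck_in_D(1)[OF Suc] slow_growth_norm_det_powr[OF assms]])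
    fix X :: "'a^'n^'n"
    obtain u' where u': "Ck_in slow_growth k u'" "\<And>g. g \<in> GL \<Longrightarrow> has_dd (\<lambda>g :: 'a^'n^'n. emb (det g)) X g (u' g)"
      by (rule Ck_in_SucE[OF det[of "Suc k"], of X], rule that)
    have "Ck_in slow_growth k (\<lambda>g. of_real e * (of_real (cmod (emb (det g)) powr e) *
        ((inverse (emb (det g)) * cnj (inverse (emb (det g)))) *
      (of_real (Re (emb (det g))) * of_real (Re (u' g)) + of_real (Im (emb (det g))) * of_real (Im (u' g))))))"
      by (intro Ck_in_slow_mult Ck_in_slow_add Ck_in_const Suc Ck_in_cnj Ck_in_inverse_det Ck_in_Re_Im u'(1) det)
    then show "\<exists>d. Ck_in slow_growth k d \<and> (\<forall>g\<in>GL. has_dd (\<lambda>g :: 'a^'n^'n. complex_of_real (cmod (emb (det g)) powr e)) X g (d g))"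
      using has_dd_norm_powr[OF u'(2) emb_det_nonzero, of _ e]
      by (intro exI conjI) (assumption, simp)
  qed
qed

section \<open>Schwartz functions\<close>

lemma dirderiv_eq:
  fixes f :: "'a^'n^'n \<Rightarrow> complex"
  assumes "has_dd f X g d"
  shows "dirderiv scaleM (*) euclidean X f g = d"
  unfolding dirderiv_def has_dirderiv_iff_has_dd
  using assms by (intro the_equality) (auto simp: has_dd_def intro: vector_derivative_unique_at)

lemma entry_norm_le_absF:
  fixes g :: "'a^'n^'n"
  shows "entry_norm g \<le> (1 + (real CARD('n))\<^sup>2) * (1 + (\<Sum>i\<in>UNIV. \<Sum>j\<in>UNIV. absF (g $ i $ j)))"
proof -
  have "entry_norm g \<le> 1 + (\<Sum>i\<in>UNIV. \<Sum>j\<in>UNIV. 1 + absF (g $ i $ j))"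
    unfolding entry_norm_def by (intro add_left_mono sum_mono absF_bounds)
  also have "\<dots> = 1 + (real CARD('n))\<^sup>2 + (\<Sum>i\<in>UNIV. \<Sum>j\<in>UNIV. absF (g $ i $ j))"
    by (simp add: sum.distrib power2_eq_square)
  also have "\<dots> \<le> (1 + (real CARD('n))\<^sup>2) * (1 + (\<Sum>i\<in>UNIV. \<Sum>j\<in>UNIV. absF (g $ i $ j)))"
    by (simp add: algebra_simps absF_bounds sum_nonneg)
  finally show ?thesis .
qed

text \<open>The Schwartz condition bounds all iterated derivatives, so the induction runs over all of them at once.\<close>

lemma schwartz_bruhat_Ck:
  fixes f :: "'a^'n^'n \<Rightarrow> complex"
  assumes f: "f \<in> schwartz_bruhat"
  shows "Ck_in rapid_decay k (iter_dirderiv scaleM (*) euclidean Xs f)"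
proof (induction k arbitrary: Xs)
  have sm: "cinf_on scaleM (*) euclidean UNIV f"
    and bd: "\<exists>C. \<forall>x. (1 + (\<Sum>i\<in>UNIV. \<Sum>j\<in>UNIV. absF (x $ i $ j))) ^ N * cmod (iter_dirderiv scaleM (*) euclidean Xs f x) \<le> C" for Xs N
    using f arch by (auto simp: schwartz_bruhat_def smooth_onM_def)
  have cont: "continuous_on GL (iter_dirderiv scaleM (*) euclidean Xs f)" for Xs
    using sm by (auto simp: cinf_on_def intro: continuous_on_subset)
  have rapid: "iter_dirderiv scaleM (*) euclidean Xs f \<in> rapid_decay" for Xs
    unfolding rapid_decay_def
  proof (intro CollectI allI)
    fix N
    obtain C where C: "\<And>x. (1 + (\<Sum>i\<in>UNIV. \<Sum>j\<in>UNIV. absF (x $ i $ j))) ^ N * cmod (iter_dirderiv scaleM (*) euclidean Xs f x) \<le> C"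
      using bd by blast
    have "cmod (iter_dirderiv scaleM (*) euclidean Xs f g) * entry_norm g ^ N \<le> ((1 + (real CARD('n))\<^sup>2) ^ N * C) * det_norm g ^ 0" for g
    proof -
      have "entry_norm g ^ N \<le> ((1 + (real CARD('n))\<^sup>2) * (1 + (\<Sum>i\<in>UNIV. \<Sum>j\<in>UNIV. absF (g $ i $ j)))) ^ N"
        using entry_norm_ge_1[of g] by (intro power_mono entry_norm_le_absF) auto
      then have "cmod (iter_dirderiv scaleM (*) euclidean Xs f g) * entry_norm g ^ N \<le>
        cmod (iter_dirderiv scaleM (*) euclidean Xs f g) * ((1 + (real CARD('n))\<^sup>2) * (1 + (\<Sum>i\<in>UNIV. \<Sum>j\<in>UNIV. absF (g $ i $ j)))) ^ N"
        by (rule mult_left_mono) simp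
      also have "\<dots> = (1 + (real CARD('n))\<^sup>2) ^ N * ((1 + (\<Sum>i\<in>UNIV. \<Sum>j\<in>UNIV. absF (g $ i $ j))) ^ N * cmod (iter_dirderiv scaleM (*) euclidean Xs f g))"
        by (simp add: power_mult_distrib)
      also have "\<dots> \<le> (1 + (real CARD('n))\<^sup>2) ^ N * C"
        by (intro mult_left_mono C) simp
      finally show ?thesis by simp
    qed
    then show "\<exists>C M. \<forall>g\<in>GL. cmod (iter_dirderiv scaleM (*) euclidean Xs f g) * entry_norm g ^ N \<le> C * det_norm g ^ M"
      by blast
  qed
  {
    case 0
    then show ?case using cont rapid by simp
  next
    case (Suc k)
    show ?case
    proof (rule Ck_in_SucI[OF cont rapid])
      fix X
      have "has_dd (iter_dirderiv scaleM (*) euclidean Xs f) X g (iter_dirderiv scaleM (*) euclidean (X # Xs) f g)" for g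
      proof -
        obtain d where d: "has_dd (iter_dirderiv scaleM (*) euclidean Xs f) X g d"
          using sm unfolding cinf_on_def has_dirderiv_iff_has_dd by (metis UNIV_I)
        moreover have "iter_dirderiv scaleM (*) euclidean (X # Xs) f g = d"
          using dirderiv_eq[OF d] by (simp add: iter_dirderiv_def)
        ultimately show ?thesis by simp
      qed
      then show "\<exists>d. Ck_in rapid_decay k d \<and> (\<forall>g\<in>GL. has_dd (iter_dirderiv scaleM (*) euclidean Xs f) X g (d g))"
        using Suc by blast
    qed
  }
qed

text \<open>A function of the standard Schwartz space is a Schwartz function times \<open>|det|\<close> to the power \<open>n/2\<close> in the
  normalized absolute value.\<close>

lemma schwartz_std_Ck:
  fixes \<xi> :: "'a^'n^'n \<Rightarrow> complex"
  assumes \<xi>: "\<xi> \<in> schwartz_std"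
  shows "Ck_in rapid_decay k \<xi>"
proof -
  obtain f where f: "f \<in> schwartz_bruhat"
      "\<And>g. g \<in> GL \<Longrightarrow> complex_of_real (absF (det g) powr (- real CARD('n) / 2)) * \<xi> g = f g"
    using \<xi> by (auto simp: schwartz_std_def)
  obtain e where e: "e = 1 \<or> e = (2::real)" "\<And>x::'a. absF x = cmod (emb x) powr e"
    by (rule absF_eq_powr, rule that)
  define a where "a = e * (real CARD('n) / 2)"
  have "a \<ge> 0" using e(1) by (auto simp: a_def)
  have "Ck_in rapid_decay k f"
    using schwartz_bruhat_Ck[OF f(1), of k "[]"] by (simp add: iter_dirderiv_def)
  then have "Ck_in rapid_decay k (\<lambda>g. complex_of_real (cmod (emb (det g)) powr a) * f g)"
    by (rule Ck_in_mult[OF growth_module_rapid Ck_in_norm_det_powr[OF \<open>a \<ge> 0\<close>]])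
  then show ?thesis
  proof (rule Ck_in_cong[OF growth_module_rapid])
    fix g :: "'a^'n^'n" assume g: "g \<in> GL"
    have "absF (det g) powr (- real CARD('n) / 2) = cmod (emb (det g)) powr (- a)"
      by (simp add: e(2) powr_powr a_def)
    moreover have "cmod (emb (det g)) powr a * cmod (emb (det g)) powr (- a) = 1"
      using emb_det_nonzero[OF g] by (simp flip: powr_add)
    ultimately show "complex_of_real (cmod (emb (det g)) powr a) * f g = \<xi> g"
      unfolding f(2)[OF g, symmetric] by (metis mult.assoc mult_1 of_real_1 of_real_mult)
  qed
qed

end

section \<open>Matrix coefficients\<close>

lemma frechet_topspace:
  assumes "frechet_space s V T"
  shows "topspace T = V"
proof -
  obtain p :: "nat \<Rightarrow> 'a \<Rightarrow> real" where p: "\<And>U. openin T U \<longleftrightarrow>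
      U \<subseteq> V \<and> (\<forall>v\<in>U. \<exists>N. \<exists>\<epsilon>>0. \<forall>w\<in>V. (\<forall>k\<le>N. p k (w - v) < \<epsilon>) \<longrightarrow> w \<in> U)"
    using assms unfolding frechet_space_def by metis
  have "openin T V" unfolding p by (auto intro: exI[of _ 1])
  moreover have "topspace T \<subseteq> V" using p[of "topspace T"] by simp
  ultimately show ?thesis using openin_subset by blast
qed

text \<open>The seminorms separate points. Uniqueness of limits is needed to identify the derivatives of the orbit maps,
  which are defined by description.\<close>

lemma frechet_Hausdorff:
  assumes F: "frechet_space s V T"
  shows "Hausdorff_space T"
  unfolding Hausdorff_space_def frechet_topspace[OF F]
proof (intro allI impI, elim conjE)
  fix x y assume xy: "x \<in> V" "y \<in> V" "x \<noteq> y"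
  obtain p :: "nat \<Rightarrow> 'a \<Rightarrow> real" where s: "vector_space s" "module.subspace s V"
    and sn: "\<And>k. seminorm_on s V (p k)" and sep: "\<forall>v\<in>V. (\<forall>k. p k v = 0) \<longrightarrow> v = 0"
    and p: "\<And>U. openin T U \<longleftrightarrow>
      U \<subseteq> V \<and> (\<forall>v\<in>U. \<exists>N. \<exists>\<epsilon>>0. \<forall>w\<in>V. (\<forall>k\<le>N. p k (w - v) < \<epsilon>) \<longrightarrow> w \<in> U)"
    using F unfolding frechet_space_def by metis
  have m: "module s" using s(1) by (simp add: module_iff_vector_space)
  have diff: "a - b \<in> V" if "a \<in> V" "b \<in> V" for a b
    using module.subspace_diff[OF m s(2)] that by blast
  have tri: "p k (a - c) \<le> p k (a - b) + p k (b - c)" if "a \<in> V" "b \<in> V" "c \<in> V" for a b c k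
  proof -
    have "p k ((a - b) + (b - c)) \<le> p k (a - b) + p k (b - c)"
      using sn[of k] diff that unfolding seminorm_on_def by blast
    then show ?thesis by simp
  qed
  have sym: "p k (a - b) = p k (b - a)" if "a \<in> V" "b \<in> V" for a b k
  proof -
    have "s (- 1) (b - a) = a - b"
      using module.scale_minus_left[OF m, of 1 "b - a"] module.scale_one[OF m] by simp
    moreover have "p k (s (- 1) (b - a)) = cmod (- 1) * p k (b - a)"
      using sn[of k] diff[OF that(2,1)] unfolding seminorm_on_def by blast
    ultimately show ?thesis by simp
  qed
  obtain k where k: "p k (x - y) \<noteq> 0" using sep diff[OF xy(1,2)] xy(3) by (metis eq_iff_diff_eq_0)
  define e where "e = p k (x - y) / 2"
  have "p k (x - y) \<ge> 0" using sn[of k] diff[OF xy(1,2)] unfolding seminorm_on_def by blast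
  then have e: "e > 0" using k by (simp add: e_def)
  define B where "B = (\<lambda>c. {w \<in> V. p k (w - c) < e})"
  have op: "openin T (B c)" if c: "c \<in> V" for c
    unfolding p
  proof (intro conjI ballI)
    fix v assume v: "v \<in> B c"
    show "\<exists>N. \<exists>\<epsilon>>0. \<forall>w\<in>V. (\<forall>k\<le>N. p k (w - v) < \<epsilon>) \<longrightarrow> w \<in> B c"
    proof (intro exI[of _ k] exI[of _ "e - p k (v - c)"] conjI ballI impI)
      fix w assume w: "w \<in> V" "\<forall>j\<le>k. p j (w - v) < e - p k (v - c)"
      then show "w \<in> B c" using tri[of w v c k] v c by (force simp: B_def)
    qed (use v in \<open>simp add: B_def\<close>)
  qed (auto simp: B_def)
  have p0: "p k (a - a) = 0" if "a \<in> V" for a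
  proof -
    have "p k (s 0 a) = cmod 0 * p k a" using sn[of k] that unfolding seminorm_on_def by blast
    then show ?thesis using module.scale_zero_left[OF m] by simp
  qed
  have "disjnt (B x) (B y)"
  proof (rule ccontr)
    assume "\<not> disjnt (B x) (B y)"
    then obtain w where w: "w \<in> V" "p k (w - x) < e" "p k (w - y) < e" by (auto simp: disjnt_def B_def)
    then have "p k (x - y) < e + e" using tri[of x w y k] sym[of x w k] xy by force
    then show False by (simp add: e_def)
  qed
  moreover have "x \<in> B x" "y \<in> B y" using xy e p0 by (auto simp: B_def)
  ultimately show "\<exists>U Va. openin T U \<and> openin T Va \<and> x \<in> U \<and> y \<in> Va \<and> disjnt U Va"
    using op xy by blast
qed

definition continuous_functional ::
  "(complex \<Rightarrow> 'v \<Rightarrow> 'v) \<Rightarrow> 'v set \<Rightarrow> 'v::ab_group_add topology \<Rightarrow> ('v \<Rightarrow> complex) \<Rightarrow> bool" where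
  "continuous_functional s V T l \<longleftrightarrow> lin_on s (*) V l \<and> continuous_map T euclidean l"

context archimedean_local_field
begin

context
  fixes s :: "complex \<Rightarrow> 'v \<Rightarrow> 'v::ab_group_add"
    and V :: "'v set" and T :: "'v topology"
    and \<pi> :: "'a^'n^'n \<Rightarrow> 'v \<Rightarrow> 'v"
  assumes CW: "casselman_wallach s V T \<pi>"
begin

lemma casselman_wallach_facts:
  "is_rep s V \<pi>" "frechet_space s V T" "moderate_growth s V T \<pi>"
  "continuous_map (prod_topology (top_of_set GL) T) T (\<lambda>(g, v). \<pi> g v)"
  "v \<in> V \<Longrightarrow> cinf_on scaleM s T GL (\<lambda>g. \<pi> g v)"
  using CW unfolding casselman_wallach_def by auto

lemma cw_module: "module s" and cw_subspace: "module.subspace s V"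
  using casselman_wallach_facts(1) by (auto simp: is_rep_def module_iff_vector_space)

lemma cw_action:
  assumes "g \<in> GL" "v \<in> V"
  shows "\<pi> g v \<in> V" "h \<in> GL \<Longrightarrow> \<pi> (h ** g) v = \<pi> h (\<pi> g v)" "\<pi> (mat 1) v = v"
  using casselman_wallach_facts(1) assms by (auto simp: is_rep_def)

lemma functional_linear:
  assumes l: "lin_on s (*) V l" and "v \<in> V" "w \<in> V"
  shows "l (v + w) = l v + l w" "l (s c v) = c * l v" "l (v - w) = l v - l w"
proof -
  show "l (v + w) = l v + l w" "l (s c v) = c * l v" using assms by (auto simp: lin_on_def)
  have "v - w \<in> V" using module.subspace_diff[OF cw_module cw_subspace] assms by blast
  then have "l ((v - w) + w) = l (v - w) + l w" using l assms(3) unfolding lin_on_def by blast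
  then show "l (v - w) = l v - l w" by simp
qed

lemma continuous_functional_translate:
  assumes l: "continuous_functional s V T l" and g: "g \<in> GL"
  shows "continuous_functional s V T (\<lambda>v. l (\<pi> g v))"
  unfolding continuous_functional_def
proof
  have lg: "lin_on s s V (\<pi> g)" "\<pi> g ` V \<subseteq> V" using casselman_wallach_facts(1) g by (auto simp: is_rep_def)
  show "lin_on s (*) V (\<lambda>v. l (\<pi> g v))"
    using lg l unfolding continuous_functional_def lin_on_def by (simp add: image_subset_iff)
  have "continuous_map T (prod_topology (top_of_set GL) T) (\<lambda>v. (g, v))"
    using g by (intro continuous_map_pairedI) auto
  from continuous_map_compose[OF this casselman_wallach_facts(4)]
  have "continuous_map T T (\<lambda>v. \<pi> g v)" by (simp add: o_def)
  from continuous_map_compose[OF this, of euclidean l] l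
  show "continuous_map T euclidean (\<lambda>v. l (\<pi> g v))"
    by (simp add: o_def continuous_functional_def)
qed

definition orbit_derivative :: "'v \<Rightarrow> 'a^'n^'n \<Rightarrow> 'a^'n^'n \<Rightarrow> 'v" where
  "orbit_derivative v X = dirderiv scaleM s T X (\<lambda>g. \<pi> g v)"

lemma orbit_derivative:
  assumes v: "v \<in> V"
  shows "g \<in> GL \<Longrightarrow> has_dirderiv scaleM s T (\<lambda>g. \<pi> g v) X g (orbit_derivative v X g)"
    "continuous_map (top_of_set GL) T (orbit_derivative v X)"
    "continuous_map (top_of_set GL) T (\<lambda>g. \<pi> g v)"
    "g \<in> GL \<Longrightarrow> orbit_derivative v X g \<in> V"
proof -
  have sm: "continuous_map (top_of_set GL) T (iter_dirderiv scaleM s T Xs (\<lambda>g. \<pi> g v))"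
    "g \<in> GL \<Longrightarrow> \<exists>d. has_dirderiv scaleM s T (iter_dirderiv scaleM s T Xs (\<lambda>g. \<pi> g v)) X g d" for Xs X g
    using casselman_wallach_facts(5)[OF v] unfolding cinf_on_def by blast+
  show c: "continuous_map (top_of_set GL) T (orbit_derivative v X)"
    using sm(1)[of "[X]"] by (simp add: iter_dirderiv_def orbit_derivative_def)
  show "continuous_map (top_of_set GL) T (\<lambda>g. \<pi> g v)"
    using sm(1)[of "[]"] by (simp add: iter_dirderiv_def)
  assume g: "g \<in> GL"
  obtain d where d: "has_dirderiv scaleM s T (\<lambda>g. \<pi> g v) X g d"
    using sm(2)[OF g, of "[]" X] by (auto simp: iter_dirderiv_def)
  have "orbit_derivative v X g = d"
    unfolding orbit_derivative_def dirderiv_def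
  proof (rule the_equality)
    show "has_dirderiv scaleM s T (\<lambda>g. \<pi> g v) X g d" by (rule d)
    fix d' assume "has_dirderiv scaleM s T (\<lambda>g. \<pi> g v) X g d'"
    then show "d' = d"
      using d unfolding has_dirderiv_def
      by (rule limitin_Hausdorff_unique) (auto simp: frechet_Hausdorff[OF casselman_wallach_facts(2)])
  qed
  then show "has_dirderiv scaleM s T (\<lambda>g. \<pi> g v) X g (orbit_derivative v X g)" using d by simp
  then show "orbit_derivative v X g \<in> V"
    unfolding has_dirderiv_def frechet_topspace[OF casselman_wallach_facts(2), symmetric] by (rule limitin_topspace)
qed

text \<open>A continuous functional may be applied to the difference quotients.\<close>

lemma matrix_coeff_has_dd:
  assumes l: "continuous_functional s V T l" and v: "v \<in> V" and g: "g \<in> GL"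
  shows "has_dd (\<lambda>h. l (\<pi> h v)) X g (l (orbit_derivative v X g))"
proof -
  have "limitin T (\<lambda>t. s (complex_of_real (1 / t)) (\<pi> (g + scaleM t X) v - \<pi> g v)) (orbit_derivative v X g) (at 0)"
    using orbit_derivative(1)[OF v g] by (simp add: has_dirderiv_def)
  then have "limitin euclidean (l \<circ> (\<lambda>t. s (complex_of_real (1 / t)) (\<pi> (g + scaleM t X) v - \<pi> g v))) (l (orbit_derivative v X g)) (at 0)"
    by (rule continuous_map_limit[rotated]) (use l in \<open>simp add: continuous_functional_def\<close>)
  then have lim: "((\<lambda>t. l (s (complex_of_real (1 / t)) (\<pi> (g + scaleM t X) v - \<pi> g v))) \<longlongrightarrow> l (orbit_derivative v X g)) (at 0)"
    by (simp add: o_def)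
  have "eventually (\<lambda>t. g + scaleM t X \<in> GL) (at 0)"
    using eventually_line_in_open[OF open_GL g, of X] unfolding eventually_at_filter by (rule eventually_mono) blast
  then have "eventually (\<lambda>t. l (s (complex_of_real (1 / t)) (\<pi> (g + scaleM t X) v - \<pi> g v)) =
      complex_of_real (1 / t) * (l (\<pi> (g + scaleM t X) v) - l (\<pi> g v))) (at 0)"
  proof eventually_elim
    case (elim t)
    have ll: "lin_on s (*) V l" using l by (simp add: continuous_functional_def)
    have "\<pi> (g + scaleM t X) v \<in> V" "\<pi> g v \<in> V" using cw_action(1) elim g v by auto
    moreover from this have "\<pi> (g + scaleM t X) v - \<pi> g v \<in> V"
      using module.subspace_diff[OF cw_module cw_subspace] by blast
    ultimately show ?case using functional_linear[OF ll] by simp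
  qed
  from tendsto_cong[OF this] lim
  have "((\<lambda>t. complex_of_real (1 / t) * (l (\<pi> (g + scaleM t X) v) - l (\<pi> g v))) \<longlongrightarrow> l (orbit_derivative v X g)) (at 0)"
    by simp
  then show ?thesis by (simp add: has_dd_def has_vector_derivative_iff_quotient)
qed

text \<open>Since \<open>g + t X = g (1 + t g\<^sup>-\<^sup>1 X)\<close>, this is the derivative at the identity, along \<open>g\<^sup>-\<^sup>1 X\<close>, of the coefficient
  for the translated functional \<open>w \<mapsto> l(\<pi>(g) w)\<close>. Linearity in the direction at the identity expresses it by
  the fixed vectors of derivatives along basis directions.\<close>

lemma matrix_coeff_has_dd_left_translate:
  assumes l: "continuous_functional s V T l" and v: "v \<in> V" and g: "g \<in> GL"
  shows "has_dd (\<lambda>h. l (\<pi> h v)) X g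
    (\<Sum>e\<in>UNIV. of_real (coord (matrix_inv g ** X) e) * l (\<pi> g (orbit_derivative v (coord_basis e) (mat 1))))"
proof -
  let ?l = "\<lambda>w. l (\<pi> g w)"
  have one: "mat 1 \<in> (GL :: ('a^'n^'n) set)" by (simp add: GL_iff_det)
  have l': "continuous_functional s V T ?l" by (rule continuous_functional_translate[OF l g])
  have cont: "continuous_on GL (\<lambda>h. ?l (orbit_derivative v X h))" for X
    using continuous_map_compose[OF orbit_derivative(2)[OF v], of euclidean ?l X] l'
    by (simp add: o_def continuous_functional_def)
  have "has_dd (\<lambda>h. ?l (\<pi> h v)) (\<Sum>e\<in>UNIV. scaleM (coord (matrix_inv g ** X) e) (coord_basis e)) (mat 1)
      (\<Sum>e\<in>UNIV. of_real (coord (matrix_inv g ** X) e) * ?l (orbit_derivative v (coord_basis e) (mat 1)))"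
    by (rule has_dd_linear_combination[where D = "\<lambda>e h. ?l (orbit_derivative v (coord_basis e) h)"])
       (auto intro: matrix_coeff_has_dd[OF l' v] cont one)
  then have dd: "has_dd (\<lambda>h. ?l (\<pi> h v)) (matrix_inv g ** X) (mat 1)
      (\<Sum>e\<in>UNIV. of_real (coord (matrix_inv g ** X) e) * ?l (orbit_derivative v (coord_basis e) (mat 1)))"
    by (simp flip: coord_decomposition)
  let ?line = "\<lambda>t::real. mat 1 + scaleM t (matrix_inv g ** X)"
  have op: "open (?line -` GL)"
    by (rule open_vimage[OF open_GL]) (intro continuous_intros)
  show ?thesis
    using dd unfolding has_dd_def
  proof (rule has_vector_derivative_transform_within_open[OF _ op])
    show "0 \<in> ?line -` GL" using one by simp
    fix t assume "t \<in> ?line -` GL"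
    then have "\<pi> (g ** ?line t) v = \<pi> g (\<pi> (?line t) v)" using g v cw_action(2) by simp
    moreover have "g ** ?line t = g + scaleM t X"
      by (simp add: matrix_add_ldistrib mult_scaleM matrix_mul_assoc matrix_inv_GL[OF g])
    ultimately show "?l (\<pi> (?line t) v) = l (\<pi> (g + scaleM t X) v)" by simp
  qed
qed

lemma slow_growth_gl_norm: "(\<lambda>g :: 'a^'n^'n. complex_of_real (gl_norm g)) \<in> slow_growth"
proof -
  have abs: "(\<lambda>g. complex_of_real (absF (f g))) \<in> slow_growth"
    if f: "(\<lambda>g :: 'a^'n^'n. emb (f g)) \<in> slow_growth" for f
  proof -
    have "(\<lambda>g. (1 + complex_of_real (cmod (emb (f g)))) ^ 2) \<in> slow_growth"
      by (intro slow_growth_power slow_growth_add slow_growth_const slow_growth_norm f)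
    then show ?thesis
    proof (rule slow_growth_dominated)
      fix g :: "'a^'n^'n"
      have "1 + complex_of_real (cmod (emb (f g))) = complex_of_real (1 + cmod (emb (f g)))" by simp
      then have "cmod ((1 + complex_of_real (cmod (emb (f g)))) ^ 2) = (1 + cmod (emb (f g))) ^ 2"
        by (simp only: norm_power norm_of_real) simp
      then show "cmod (complex_of_real (absF (f g))) \<le> cmod ((1 + complex_of_real (cmod (emb (f g)))) ^ 2)"
        using absF_bounds(2,3)[of "f g"] by simp
    qed
  qed
  show ?thesis
    unfolding gl_norm_def of_real_add of_real_sum
    by (intro slow_growth_add slow_growth_const slow_growth_sum abs slow_growth_entry Ck_in_D(2)[OF Ck_in_matrix_inv_entry[of 0]])
qed

text \<open>Moderate growth, applied to the continuous seminorm \<open>v \<mapsto> |l(v)|\<close>.\<close>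

lemma matrix_coeff_slow_growth:
  assumes l: "continuous_functional s V T l" and v: "v \<in> V"
  shows "(\<lambda>g. l (\<pi> g v)) \<in> slow_growth"
proof -
  have ll: "lin_on s (*) V l" and lc: "continuous_map T euclidean l"
    using l by (auto simp: continuous_functional_def)
  have "seminorm_on s V (\<lambda>v. cmod (l v))"
    unfolding seminorm_on_def using functional_linear[OF ll] by (auto simp: norm_mult intro: norm_triangle_ineq)
  moreover have "continuous_map T euclideanreal (\<lambda>v. cmod (l v))"
    using lc by (rule continuous_map_norm)
  ultimately obtain q N where q: "\<And>g v. g \<in> GL \<Longrightarrow> v \<in> V \<Longrightarrow> cmod (l (\<pi> g v)) \<le> gl_norm g ^ N * q v"
    using casselman_wallach_facts(3) unfolding moderate_growth_def by metis
  have "(\<lambda>g :: 'a^'n^'n. complex_of_real (gl_norm g) ^ N * complex_of_real (q v)) \<in> slow_growth"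
    by (intro slow_growth_mult slow_growth_power slow_growth_gl_norm slow_growth_const)
  then show ?thesis
  proof (rule slow_growth_dominated)
    fix g :: "'a^'n^'n" assume "g \<in> GL"
    then have "cmod (l (\<pi> g v)) \<le> \<bar>gl_norm g ^ N * q v\<bar>" using q[of g v] v by force
    then show "cmod (l (\<pi> g v)) \<le> cmod (complex_of_real (gl_norm g) ^ N * complex_of_real (q v))"
      by (simp add: norm_mult norm_power abs_mult power_abs)
  qed
qed

lemma Ck_in_coord_matrix_inv:
  "Ck_in slow_growth k (\<lambda>g :: 'a^'n^'n. of_real (coord (matrix_inv g ** X) e))"
proof -
  obtain i j b where e: "e = (i, j, b)" by (cases e)
  have "Ck_in slow_growth k (\<lambda>g :: 'a^'n^'n. \<Sum>r\<in>UNIV. emb (matrix_inv g $ i $ r) * emb (X $ r $ j))"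
    by (intro Ck_in_slow_sum Ck_in_slow_mult Ck_in_matrix_inv_entry Ck_in_const)
  then have "Ck_in slow_growth k (\<lambda>g :: 'a^'n^'n. emb ((matrix_inv g ** X) $ i $ j))"
    by (simp add: matrix_matrix_mult_def emb_sum)
  then show ?thesis using Ck_in_Re_Im[of k "\<lambda>g. emb ((matrix_inv g ** X) $ i $ j)"]
    by (cases b) (simp_all add: e coord_def)
qed

text \<open>The derivative is a combination of coefficients of the same functional at other vectors of \<open>V\<close>, so the
  induction has to range over all vectors.\<close>

lemma matrix_coeff_Ck:
  assumes l: "continuous_functional s V T l" and v: "v \<in> V"
  shows "Ck_in slow_growth k (\<lambda>g. l (\<pi> g v))"
  using v
proof (induction k arbitrary: v)
  have cont: "continuous_on GL (\<lambda>g. l (\<pi> g v))" if "v \<in> V" for v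
    using continuous_map_compose[OF orbit_derivative(3)[OF that], of euclidean l] l
    by (simp add: o_def continuous_functional_def)
  {
    case 0
    then show ?case using cont matrix_coeff_slow_growth[OF l] by simp
  next
    case (Suc k)
    show ?case
    proof (rule Ck_in_SucI[OF cont[OF Suc.prems] matrix_coeff_slow_growth[OF l Suc.prems]])
      fix X
      have "orbit_derivative v (coord_basis e) (mat 1) \<in> V" for e
        by (rule orbit_derivative(4)[OF Suc.prems]) (simp add: GL_iff_det)
      then have "Ck_in slow_growth k (\<lambda>g. \<Sum>e\<in>UNIV. of_real (coord (matrix_inv g ** X) e) * l (\<pi> g (orbit_derivative v (coord_basis e) (mat 1))))"
        by (intro Ck_in_slow_sum Ck_in_slow_mult Ck_in_coord_matrix_inv Suc.IH)
      then show "\<exists>d. Ck_in slow_growth k d \<and> (\<forall>g\<in>GL. has_dd (\<lambda>g. l (\<pi> g v)) X g (d g))"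
        using matrix_coeff_has_dd_left_translate[OF l Suc.prems] by blast
    qed
  }
qed

end

lemma matrix_coeffs_Ck:
  fixes \<pi> :: "'a^'n^'n \<Rightarrow> 'v \<Rightarrow> 'v::ab_group_add"
  assumes \<pi>: "in_PiF s V T \<pi>" and \<phi>: "\<phi> \<in> matrix_coeffs s V T \<pi>"
  shows "Ck_in slow_growth k \<phi>"
proof -
  have CW: "casselman_wallach s V T \<pi>"
    using \<pi> arch by (simp add: in_PiF_def irreducible_casselman_wallach_def)
  obtain m :: nat and w l where wl: "\<forall>i<m. w i \<in> V \<and> l i \<in> smooth_contragredient s V T \<pi>"
      "\<forall>g\<in>GL. \<phi> g = (\<Sum>i<m. l i (\<pi> g (w i)))"
    using \<phi> unfolding matrix_coeffs_def by blast
  have "continuous_functional s V T (l i)" if "i < m" for i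
    using wl(1) that arch
    by (auto simp: smooth_contragredient_def cont_dual_def dual_space_def continuous_functional_def)
  then have "Ck_in slow_growth k (\<lambda>g. \<Sum>i<m. l i (\<pi> g (w i)))"
    using wl(1) by (intro Ck_in_slow_sum matrix_coeff_Ck[OF CW]) auto
  then show ?thesis by (rule Ck_in_slow_cong) (use wl(2) in simp)
qed

end

context archimedean_local_field
begin

section \<open>The volume growth of the special linear group\<close>

text \<open>The set is the intersection of a closed set of matrices with the image of a bounded closed set of complex
  matrices.\<close>

lemma compact_bounded_entries:
  "\<exists>U. compact U \<and> U \<subseteq> (SL :: ('a^'n^'n) set) \<and> (\<forall>u\<in>SL. (\<forall>i j. cmod (emb (u $ i $ j)) \<le> 2) \<longrightarrow> u \<in> U)"
proof -
  define Box where "Box = {A :: complex^'n^'n. \<forall>i j. A $ i $ j \<in> range emb \<inter> cball 0 2}"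
  define J where "J = (\<lambda>A :: complex^'n^'n. \<chi> i j. inv emb (A $ i $ j))"
  have "closed (range emb)" using emb_range closed_complex_Reals by auto
  then have "closed (range emb \<inter> cball 0 2)" by (intro closed_Int closed_cball)
  then have "closed ((\<lambda>A :: complex^'n^'n. A $ i $ j) -` (range emb \<inter> cball 0 2))" for i j
    by (rule closed_vimage) (intro continuous_intros)
  then have "closed {A :: complex^'n^'n. A $ i $ j \<in> range emb \<inter> cball 0 2}" for i j
    by (simp add: vimage_def)
  then have "closed Box" unfolding Box_def by (intro closed_Collect_all)
  moreover have "bounded Box"
    unfolding bounded_iff
  proof (intro exI ballI)
    fix A assume "A \<in> Box"
    then have A: "norm (A $ i $ j) \<le> 2" for i j by (auto simp: Box_def)
    have "norm A \<le> (\<Sum>i\<in>UNIV. norm (A $ i))" unfolding norm_vec_def[of A] by (rule L2_set_le_sum) simp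
    also have "\<dots> \<le> (\<Sum>i\<in>UNIV. \<Sum>j\<in>UNIV. norm (A $ i $ j))"
    proof (rule sum_mono)
      fix i show "norm (A $ i) \<le> (\<Sum>j\<in>UNIV. norm (A $ i $ j))"
        unfolding norm_vec_def[of "A $ i"] by (rule L2_set_le_sum) simp
    qed
    also have "\<dots> \<le> (\<Sum>i\<in>(UNIV :: 'n set). \<Sum>j\<in>(UNIV :: 'n set). 2)" by (intro sum_mono A)
    finally show "norm A \<le> (\<Sum>i\<in>(UNIV :: 'n set). \<Sum>j\<in>(UNIV :: 'n set). 2)" .
  qed
  ultimately have "compact Box" by (simp add: compact_eq_bounded_closed)
  moreover have "continuous_on Box J"
    unfolding J_def
    by (intro continuous_on_vec_lambda continuous_on_compose2[OF continuous_on_inv_emb])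
       (auto simp: Box_def intro!: continuous_intros)
  ultimately have "compact (J ` Box)" by (intro compact_continuous_image)
  then have "compact (J ` Box \<inter> SL)" unfolding SL_def by (intro compact_Int_closed closed_det_fiber)
  moreover have "u \<in> J ` Box \<inter> SL" if "u \<in> SL" "\<forall>i j. cmod (emb (u $ i $ j)) \<le> 2" for u
  proof -
    have "J (\<chi> i j. emb (u $ i $ j)) = u" by (simp add: J_def vec_eq_iff)
    moreover have "(\<chi> i j. emb (u $ i $ j)) \<in> Box" using that by (simp add: Box_def)
    ultimately show ?thesis using that(1) by (metis IntI imageI)
  qed
  ultimately show ?thesis by (intro exI[of _ "J ` Box \<inter> SL"]) auto
qed

text \<open>The entries of \<open>h\<^sup>-\<^sup>1 g = 1 + h\<^sup>-\<^sup>1 (g - h)\<close> are within \<open>1\<close> of those of the identity when \<open>g\<close> and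
  \<open>h\<close> agree up to \<open>2/D\<close>, because the inverse of \<open>h\<close> has entries of size at most \<open>n! R\<^sup>n\<close>.\<close>

lemma translate_bounded_entries:
  fixes g h :: "'a^'n^'n"
  assumes h: "h \<in> SL" "entry_norm h \<le> R" and D: "D > 0" "2 * real CARD('n) * fact CARD('n) * R ^ CARD('n) \<le> D"
    and close: "\<And>i j. cmod (emb (g $ i $ j) - emb (h $ i $ j)) \<le> 2 / D"
  shows "cmod (emb ((matrix_inv h ** g) $ i $ j)) \<le> 2"
proof -
  let ?c = "fact CARD('n) * R ^ CARD('n)"
  have hGL: "h \<in> GL" using h(1) SL_subset_GL by blast
  have inv: "cmod (emb (matrix_inv h $ i $ l)) \<le> ?c" for l
  proof -
    have "cmod (emb (matrix_inv h $ i $ l)) \<le> fact CARD('n) * entry_norm h ^ CARD('n)"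
      using norm_matrix_inv_entry_le[OF hGL, of i l] h(1) by (simp add: SL_def)
    also have "\<dots> \<le> ?c" using h(2) entry_norm_ge_1[of h] by (intro mult_left_mono power_mono) auto
    finally show ?thesis .
  qed
  have c0: "?c \<ge> 0" using h(2) entry_norm_ge_1[of h] by simp
  have "(mat 1 :: 'a^'n^'n) $ i $ j = (\<Sum>l\<in>UNIV. matrix_inv h $ i $ l * h $ l $ j)"
    by (subst matrix_inv_GL(2)[OF hGL, symmetric]) (simp add: matrix_matrix_mult_def)
  then have "emb ((matrix_inv h ** g) $ i $ j) = emb ((mat 1 :: 'a^'n^'n) $ i $ j) +
      (\<Sum>l\<in>UNIV. emb (matrix_inv h $ i $ l) * (emb (g $ l $ j) - emb (h $ l $ j)))"
    by (simp add: matrix_matrix_mult_def emb_sum right_diff_distrib sum_subtractf)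
  then have "cmod (emb ((matrix_inv h ** g) $ i $ j)) \<le> cmod (emb ((mat 1 :: 'a^'n^'n) $ i $ j)) +
      cmod (\<Sum>l\<in>UNIV. emb (matrix_inv h $ i $ l) * (emb (g $ l $ j) - emb (h $ l $ j)))"
    by (simp only: norm_triangle_ineq)
  also have "\<dots> \<le> 1 + (\<Sum>l\<in>(UNIV :: 'n set). ?c * (2 / D))"
  proof (intro add_mono sum_norm_le)
    show "cmod (emb ((mat 1 :: 'a^'n^'n) $ i $ j)) \<le> 1" by (simp add: mat_def)
    fix l show "cmod (emb (matrix_inv h $ i $ l) * (emb (g $ l $ j) - emb (h $ l $ j))) \<le> ?c * (2 / D)"
      unfolding norm_mult by (intro mult_mono inv close c0) simp
  qed
  also have "(\<Sum>l\<in>(UNIV :: 'n set). ?c * (2 / D)) \<le> 1"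
    using D by (simp add: divide_le_eq mult_ac)
  finally show ?thesis by simp
qed

text \<open>Round the real and imaginary parts of \<open>D g\<close> to integers, where \<open>D\<close> is of the order \<open>k\<^sup>n\<close>. If two
  elements \<open>g\<close>, \<open>h\<close> of the ball have the same rounding, then \<open>h\<^sup>-\<^sup>1 g\<close> lies in one fixed compact set \<open>U\<close>; so
  the ball is covered by as many translates of \<open>U\<close> as there are values of the rounding, and these are
  polynomially many.\<close>

lemma haar_ball_le:
  fixes \<mu> :: "('a^'n^'n) measure"
  assumes \<mu>: "haar_measure_SL \<mu>"
  shows "\<exists>C Q. \<forall>k::nat. emeasure \<mu> {g \<in> SL. entry_norm g \<le> real k + 1} \<le> ennreal (C * (real k + 1) ^ Q)"
proof -
  obtain U where U: "compact U" "U \<subseteq> (SL :: ('a^'n^'n) set)"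
      "\<And>u. u \<in> SL \<Longrightarrow> (\<And>i j. cmod (emb (u $ i $ j)) \<le> 2) \<Longrightarrow> u \<in> U"
    using compact_bounded_entries[where 'n='n] by metis
  note Us = haar_compact[OF \<mu> U(1,2)]
  define c where "c = 2 * CARD('n) * fact CARD('n)"
  have "c \<ge> 1" unfolding c_def by (simp add: Suc_le_eq)
  define I where "I = 2 * CARD('n \<times> 'n)"
  have main: "emeasure \<mu> {g \<in> SL. entry_norm g \<le> real k + 1} \<le>
      ennreal (((2 * real c) ^ I * measure \<mu> U) * (real k + 1) ^ ((CARD('n) + 1) * I))" for k
  proof -
    \<comment> \<open>Large enough for \<open>translate_bounded_entries\<close> at radius \<open>k + 1\<close>.\<close>
    define D where "D = c * (k + 1) ^ CARD('n)"
    have "D \<ge> 1" using \<open>c \<ge> 1\<close> by (simp add: D_def Suc_le_eq)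
    define Bk where "Bk = {g \<in> (SL :: ('a^'n^'n) set). entry_norm g \<le> real k + 1}"
    define S where "S = {- int (D * k)..int (D * k)} \<times> {- int (D * k)..int (D * k)}"
    define \<rho> where "\<rho> = (\<lambda>(g :: 'a^'n^'n) (i, j). (\<lfloor>real D * Re (emb (g $ i $ j))\<rfloor>, \<lfloor>real D * Im (emb (g $ i $ j))\<rfloor>))"
    define R where "R = PiE (UNIV :: ('n \<times> 'n) set) (\<lambda>_. S)"
    have fR: "finite R" unfolding R_def S_def by (intro finite_PiE) auto
    \<comment> \<open>A representative of each rounding value that occurs in the ball; the identity matrix for the values that do not occur.\<close>
    define pt where "pt = (\<lambda>r. if \<exists>g\<in>Bk. \<rho> g = r then SOME g. g \<in> Bk \<and> \<rho> g = r else mat 1)"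
    have pt: "pt (\<rho> g) \<in> Bk" "\<rho> (pt (\<rho> g)) = \<rho> g" if "g \<in> Bk" for g
    proof -
      have "\<exists>h. h \<in> Bk \<and> \<rho> h = \<rho> g" using that by blast
      from someI_ex[OF this] that show "pt (\<rho> g) \<in> Bk" "\<rho> (pt (\<rho> g)) = \<rho> g"
        by (auto simp: pt_def)
    qed
    have ptSL: "pt r \<in> SL" for r
    proof (cases "\<exists>g\<in>Bk. \<rho> g = r")
      case True then show ?thesis using pt(1) by (auto simp: Bk_def)
    next
      case False then show ?thesis by (simp add: pt_def SL_def)
    qed
    have \<rho>R: "\<rho> g \<in> R" if g: "g \<in> Bk" for g
    proof -
      have "\<lfloor>real D * x\<rfloor> \<in> {- int (D * k)..int (D * k)}" if "\<bar>x\<bar> \<le> real k" for x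
      proof -
        have "real D * x \<le> real D * real k" "- (real D * real k) \<le> real D * x"
          using that mult_left_mono[of x "real k" "real D"] mult_left_mono[of "- real k" x "real D"] by auto
        then show ?thesis by (simp add: le_floor_iff floor_le_iff)
      qed
      moreover have "\<bar>Re (emb (g $ i $ j))\<bar> \<le> real k" "\<bar>Im (emb (g $ i $ j))\<bar> \<le> real k" for i j
        using entry_le_entry_norm[of g i j] g abs_Re_le_cmod[of "emb (g $ i $ j)"] abs_Im_le_cmod[of "emb (g $ i $ j)"]
        by (auto simp: Bk_def)
      ultimately show ?thesis by (auto simp: R_def S_def \<rho>_def)
    qed
    have cover: "Bk \<subseteq> (\<Union>r\<in>R. (\<lambda>u. pt r ** u) ` U)"
    proof
      fix g assume g: "g \<in> Bk"
      define h where "h = pt (\<rho> g)"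
      have h: "h \<in> Bk" "\<rho> h = \<rho> g" using pt[OF g] by (auto simp: h_def)
      have close: "cmod (emb (g $ i $ j) - emb (h $ i $ j)) \<le> 2 / real D" for i j
      proof -
        have fl: "\<bar>x - y\<bar> \<le> 1 / real D" if "\<lfloor>real D * x\<rfloor> = \<lfloor>real D * y\<rfloor>" for x y
        proof -
          have "\<bar>real D * x - real D * y\<bar> \<le> 1" using that by linarith
          then have "real D * \<bar>x - y\<bar> \<le> 1" by (simp add: abs_mult flip: right_diff_distrib)
          then show ?thesis using \<open>D \<ge> 1\<close> by (simp add: field_simps)
        qed
        have "\<rho> h (i, j) = \<rho> g (i, j)" using h(2) by simp
        then have "\<bar>Re (emb (g $ i $ j)) - Re (emb (h $ i $ j))\<bar> \<le> 1 / real D" "\<bar>Im (emb (g $ i $ j)) - Im (emb (h $ i $ j))\<bar> \<le> 1 / real D"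
          by (auto simp: \<rho>_def intro!: fl)
        then show ?thesis using cmod_le[of "emb (g $ i $ j) - emb (h $ i $ j)"] by simp
      qed
      have hSL: "h \<in> SL" "entry_norm h \<le> real k + 1" using h by (auto simp: Bk_def)
      have hGL: "h \<in> GL" using hSL SL_subset_GL by blast
      have "cmod (emb ((matrix_inv h ** g) $ i $ j)) \<le> 2" for i j
        by (rule translate_bounded_entries[OF hSL _ _ close])
           (use \<open>D \<ge> 1\<close> in \<open>auto simp: D_def c_def\<close>)
      moreover have "matrix_inv h ** g \<in> SL"
      proof -
        have "det (matrix_inv h) * det h = 1" using arg_cong[OF matrix_inv_GL(2)[OF hGL], of det] by (simp add: det_mul)
        then show ?thesis using g hSL by (simp add: SL_def Bk_def det_mul)
      qed
      ultimately have "matrix_inv h ** g \<in> U" by (intro U(3))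
      then have "h ** (matrix_inv h ** g) \<in> (\<lambda>u. pt (\<rho> g) ** u) ` U" by (auto simp: h_def)
      moreover have "h ** (matrix_inv h ** g) = g" by (simp add: matrix_mul_assoc matrix_inv_GL[OF hGL])
      ultimately show "g \<in> (\<Union>r\<in>R. (\<lambda>u. pt r ** u) ` U)" using \<rho>R[OF g] by auto
    qed
    have ptU: "(\<lambda>u. pt r ** u) ` U \<in> sets \<mu>" "emeasure \<mu> ((\<lambda>u. pt r ** u) ` U) = emeasure \<mu> U" for r
    proof -
      have "compact ((\<lambda>u. pt r ** u) ` U)" by (intro compact_continuous_image U continuous_intros)
      moreover have "(\<lambda>u. pt r ** u) ` U \<subseteq> SL" using U(2) ptSL[of r] by (auto simp: SL_def det_mul)
      ultimately show "(\<lambda>u. pt r ** u) ` U \<in> sets \<mu>" by (rule haar_compact[OF \<mu>])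
      show "emeasure \<mu> ((\<lambda>u. pt r ** u) ` U) = emeasure \<mu> U"
        using \<mu> ptSL[of r] Us(1) by (auto simp: haar_measure_SL_def)
    qed
    have "emeasure \<mu> Bk \<le> emeasure \<mu> (\<Union>r\<in>R. (\<lambda>u. pt r ** u) ` U)"
      by (intro emeasure_mono cover sets.finite_UN fR ptU)
    also have "\<dots> \<le> (\<Sum>r\<in>R. emeasure \<mu> ((\<lambda>u. pt r ** u) ` U))"
      using fR ptU by (intro emeasure_subadditive_finite) auto
    also have "\<dots> = of_nat (card R) * emeasure \<mu> U" by (simp add: ptU)
    also have "\<dots> = ennreal (real (card R) * measure \<mu> U)"
      using Us(2) by (simp add: emeasure_eq_ennreal_measure ennreal_mult' ennreal_of_nat_eq_real_of_nat)
    also have "\<dots> \<le> ennreal (((2 * real c) ^ I * measure \<mu> U) * (real k + 1) ^ ((CARD('n) + 1) * I))"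
    proof (rule ennreal_leI)
      have "card R = card S ^ CARD('n \<times> 'n)" unfolding R_def by (subst card_PiE) auto
      also have "card S = (2 * (D * k) + 1) ^ 2" by (simp add: S_def power2_eq_square nat_add_distrib nat_mult_distrib)
      finally have "card R = (2 * (D * k) + 1) ^ I" by (simp add: I_def power_mult)
      also have "\<dots> \<le> (2 * D * (k + 1)) ^ I" using \<open>D \<ge> 1\<close> by (intro power_mono) auto
      also have "2 * D * (k + 1) = (2 * c) * (k + 1) ^ (CARD('n) + 1)"
        by (simp only: D_def power_add power_one_right mult_ac)
      also have "\<dots> ^ I = (2 * c) ^ I * (k + 1) ^ ((CARD('n) + 1) * I)"
        by (simp only: power_mult_distrib power_mult)
      finally have "real (card R) \<le> real ((2 * c) ^ I * (k + 1) ^ ((CARD('n) + 1) * I))" by (simp only: of_nat_le_iff)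
      then have "real (card R) \<le> (2 * real c) ^ I * (real k + 1) ^ ((CARD('n) + 1) * I)" by (simp add: add.commute)
      then have "real (card R) * measure \<mu> U \<le> ((2 * real c) ^ I * (real k + 1) ^ ((CARD('n) + 1) * I)) * measure \<mu> U"
        by (rule mult_right_mono) simp
      then show "real (card R) * measure \<mu> U \<le> ((2 * real c) ^ I * measure \<mu> U) * (real k + 1) ^ ((CARD('n) + 1) * I)"
        by (simp only: mult_ac)
    qed
    finally show ?thesis by (simp add: Bk_def)
  qed
  then show ?thesis by blast
qed

lemma continuous_on_entry_norm: "continuous_on S (entry_norm :: 'a^'n^'n \<Rightarrow> real)"
  unfolding entry_norm_def by (intro continuous_intros)

text \<open>On the shell between the radii \<open>k\<close> and \<open>k + 1\<close> the integrand is at most \<open>(2/(k + 1))\<^sup>N\<close>, and the volume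
  is \<open>O((k + 1)\<^sup>Q)\<close>; for \<open>N = Q + 2\<close> the sum over the shells converges.\<close>

lemma integrable_inverse_entry_norm:
  fixes \<mu> :: "('a^'n^'n) measure"
  assumes \<mu>: "haar_measure_SL \<mu>"
  shows "\<exists>N. integrable \<mu> (\<lambda>g. 1 / entry_norm g ^ N)"
proof -
  obtain C Q where CQ: "\<And>k::nat. emeasure \<mu> {g \<in> SL. entry_norm g \<le> real k + 1} \<le> ennreal (C * (real k + 1) ^ Q)"
    using haar_ball_le[OF \<mu>] by blast
  define N where "N = Q + 2"
  have sp: "space \<mu> = SL" using \<mu> by (simp add: haar_measure_SL_def)
  have em: "entry_norm \<in> borel_measurable \<mu>"
    by (rule haar_borel_measurable[OF \<mu> continuous_on_entry_norm])
  define B where "B = (\<lambda>k::nat. {g \<in> space \<mu>. entry_norm g \<le> real k + 1})"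
  have Bm: "B k \<in> sets \<mu>" for k unfolding B_def using em by measurable
  have pw: "ennreal (1 / entry_norm g ^ N) \<le> (\<Sum>k. ennreal (2 ^ N / (real k + 1) ^ N) * indicator (B k) g)" if g: "g \<in> space \<mu>" for g
  proof -
    \<comment> \<open>The index of the shell of \<open>g\<close>: here \<open>k < entry_norm g \<le> k + 1\<close>.\<close>
    define k where "k = nat \<lceil>entry_norm g\<rceil> - 1"
    have E: "entry_norm g \<ge> 1" by (rule entry_norm_ge_1)
    have k: "entry_norm g \<le> real k + 1" "real k < entry_norm g" using E unfolding k_def by linarith+
    have "(real k + 1) / 2 \<le> entry_norm g" using k E by (cases "k = 0") auto
    then have "((real k + 1) / 2) ^ N \<le> entry_norm g ^ N" by (intro power_mono) auto
    then have "1 / entry_norm g ^ N \<le> 1 / ((real k + 1) / 2) ^ N" using E by (intro divide_left_mono) auto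
    also have "\<dots> = 2 ^ N / (real k + 1) ^ N" by (simp add: power_divide)
    finally have "ennreal (1 / entry_norm g ^ N) \<le> ennreal (2 ^ N / (real k + 1) ^ N) * indicator (B k) g"
      using k(1) g by (simp add: B_def ennreal_leI)
    also have "\<dots> \<le> (\<Sum>k. ennreal (2 ^ N / (real k + 1) ^ N) * indicator (B k) g)"
    proof -
      have "f k \<le> (\<Sum>k. f k)" for f :: "nat \<Rightarrow> ennreal"
        using sum_le_suminf[of f "{k}"] by simp
      then show ?thesis .
    qed
    finally show ?thesis .
  qed
  have "(\<integral>\<^sup>+ g. ennreal (1 / entry_norm g ^ N) \<partial>\<mu>) \<le> (\<integral>\<^sup>+ g. (\<Sum>k. ennreal (2 ^ N / (real k + 1) ^ N) * indicator (B k) g) \<partial>\<mu>)"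
    by (rule nn_integral_mono) (rule pw)
  also have "\<dots> = (\<Sum>k. \<integral>\<^sup>+ g. ennreal (2 ^ N / (real k + 1) ^ N) * indicator (B k) g \<partial>\<mu>)"
    by (intro nn_integral_suminf borel_measurable_times_ennreal borel_measurable_const borel_measurable_indicator Bm)
  also have "\<dots> = (\<Sum>k. ennreal (2 ^ N / (real k + 1) ^ N) * emeasure \<mu> (B k))"
    using Bm by (simp add: nn_integral_cmult_indicator)
  also have "\<dots> \<le> (\<Sum>k. ennreal (2 ^ N * \<bar>C\<bar> * inverse (real (Suc k) ^ 2)))"
  proof (intro suminf_le summableI)
    fix k
    have "emeasure \<mu> (B k) \<le> ennreal (\<bar>C\<bar> * (real k + 1) ^ Q)"
      using CQ[of k] by (auto simp: B_def sp intro!: order_trans[OF CQ[of k]] ennreal_leI mult_right_mono)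
    then have "ennreal (2 ^ N / (real k + 1) ^ N) * emeasure \<mu> (B k) \<le> ennreal (2 ^ N / (real k + 1) ^ N) * ennreal (\<bar>C\<bar> * (real k + 1) ^ Q)"
      by (rule mult_left_mono) simp
    also have "\<dots> = ennreal (2 ^ N * \<bar>C\<bar> * ((real k + 1) ^ Q / (real k + 1) ^ N))"
      by (simp add: mult_ac flip: ennreal_mult)
    also have "(real k + 1) ^ Q / (real k + 1) ^ N = inverse (real (Suc k) ^ 2)"
    proof -
      have "x ^ Q / x ^ N = inverse (x ^ 2)" if "x > 0" for x :: real
        unfolding N_def power_add using that
        by (subst divide_divide_eq_left[symmetric]) (simp add: inverse_eq_divide)
      from this[of "real k + 1"] show ?thesis by (simp add: add.commute)
    qed
    finally show "ennreal (2 ^ N / (real k + 1) ^ N) * emeasure \<mu> (B k) \<le> ennreal (2 ^ N * \<bar>C\<bar> * inverse (real (Suc k) ^ 2))" .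
  qed
  also have "\<dots> < \<infinity>"
  proof -
    have "summable (\<lambda>k. inverse (real (Suc k) ^ 2))"
      using inverse_power_summable[of 2, where 'a=real] by (subst summable_Suc_iff) simp
    then have "summable (\<lambda>k. 2 ^ N * \<bar>C\<bar> * inverse (real (Suc k) ^ 2))" by (rule summable_mult)
    then show ?thesis by (simp add: ennreal_suminf_neq_top less_top)
  qed
  finally have "(\<integral>\<^sup>+ g. ennreal (1 / entry_norm g ^ N) \<partial>\<mu>) < \<infinity>" .
  moreover have "(\<lambda>g. 1 / entry_norm g ^ N) \<in> borel_measurable \<mu>" using em by measurable
  ultimately have "integrable \<mu> (\<lambda>g. 1 / entry_norm g ^ N)"
    using order_trans[OF zero_le_one entry_norm_ge_1] by (intro integrableI_nonneg) (auto intro!: AE_I2 zero_le_power)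
  then show ?thesis by blast
qed

end

section \<open>Differentiation under the integral sign\<close>

definition slice_integral :: "('a::local_field_char_0^'n^'n) measure \<Rightarrow> ('a^'n^'n \<Rightarrow> complex) \<Rightarrow> 'a \<Rightarrow> complex" where
  "slice_integral \<mu> \<Psi> x = (\<integral>g. \<Psi> (diag_one x ** g) \<partial>\<mu>)"

text \<open>The velocity of \<open>d(x) g\<close> when \<open>x\<close> moves with velocity \<open>X\<close>.\<close>

definition row_direction :: "'a::local_field_char_0 \<Rightarrow> 'a^'n^'n \<Rightarrow> 'a^'n^'n" where
  "row_direction X g = (\<chi> i j. if i = distinguished_index then X * g $ i $ j else 0)"

context archimedean_local_field
begin

lemma diag_one_line:
  "diag_one (x + scaleF t X) ** g = diag_one x ** g + scaleM t (row_direction X (g :: 'a^'n^'n))"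
  by (simp add: vec_eq_iff diag_one_mult_entry row_direction_def scaleM_def scaleF_def algebra_simps)

text \<open>The velocity as a function of the moving point \<open>d(x) g\<close> alone: \<open>x\<close> is recovered as its determinant.\<close>

lemma row_direction_diag_one:
  assumes "x \<noteq> 0" "g \<in> SL"
  shows "row_direction (X / det (diag_one x ** g)) (diag_one x ** g) = row_direction X (g :: 'a^'n^'n)"
  using assms by (simp add: vec_eq_iff row_direction_def diag_one_mult_entry SL_def)

lemma diag_one_mult_in_GL: "x \<noteq> 0 \<Longrightarrow> g \<in> SL \<Longrightarrow> diag_one x ** g \<in> GL"
  by (simp add: GL_iff_det SL_def)

lemma entry_norm_diag_one:
  assumes x: "(x::'a) \<noteq> 0"
  shows "entry_norm (g :: 'a^'n^'n) \<le> (1 + 1 / cmod (emb x)) * entry_norm (diag_one x ** g)"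
proof -
  let ?b = "1 + 1 / cmod (emb x)"
  have b: "?b \<ge> 1" by simp
  have "cmod (emb (g $ i $ j)) \<le> ?b * cmod (emb ((diag_one x ** g) $ i $ j))" for i j
    using x by (simp add: diag_one_mult_entry norm_mult field_simps)
  then have "entry_norm g \<le> 1 + (\<Sum>i\<in>UNIV. \<Sum>j\<in>UNIV. ?b * cmod (emb ((diag_one x ** g) $ i $ j)))"
    unfolding entry_norm_def by (intro add_left_mono sum_mono) simp
  also have "\<dots> \<le> ?b + (\<Sum>i\<in>UNIV. \<Sum>j\<in>UNIV. ?b * cmod (emb ((diag_one x ** g) $ i $ j)))"
    using b by (rule add_right_mono)
  also have "\<dots> = ?b * entry_norm (diag_one x ** g)"
    unfolding entry_norm_def by (simp only: distrib_left mult_1_right sum_distrib_left)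
  finally show ?thesis .
qed

text \<open>The bound \<open>b\<close> stands for a neighbourhood of a nonzero point \<open>x\<close>, on which it makes the estimate uniform.\<close>

lemma rapid_decay_on_slices:
  fixes \<Psi> :: "'a^'n^'n \<Rightarrow> complex"
  assumes "\<Psi> \<in> rapid_decay"
  obtains C M where "C \<ge> 0"
    "\<And>x g b. x \<noteq> 0 \<Longrightarrow> g \<in> SL \<Longrightarrow> 1 + 1 / cmod (emb x) \<le> b \<Longrightarrow>
       cmod (\<Psi> (diag_one x ** g)) \<le> (C * b ^ M) * (1 / entry_norm g ^ N)"
proof -
  obtain C M where C: "C \<ge> 0" "\<And>g. g \<in> GL \<Longrightarrow> cmod (\<Psi> g) * entry_norm g ^ N \<le> C * det_norm g ^ M"
    by (rule rapid_decayE[OF assms, where N = N], rule that)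
  have "cmod (\<Psi> (diag_one x ** g)) \<le> (C * b ^ (M + N)) * (1 / entry_norm g ^ N)"
    if x: "x \<noteq> 0" and g: "g \<in> SL" and b: "1 + 1 / cmod (emb x) \<le> b" for x b and g :: "'a^'n^'n"
  proof -
    let ?h = "diag_one x ** g" and ?b = "1 + 1 / cmod (emb x)"
    have b1: "?b \<ge> 1" by simp
    have dn: "det_norm ?h = ?b" using g by (simp add: det_norm_def SL_def)
    have "cmod (\<Psi> ?h) * entry_norm g ^ N \<le> cmod (\<Psi> ?h) * (?b * entry_norm ?h) ^ N"
      using entry_norm_ge_1[of g] by (intro mult_left_mono power_mono entry_norm_diag_one x) auto
    also have "\<dots> = (cmod (\<Psi> ?h) * entry_norm ?h ^ N) * ?b ^ N"
      by (simp only: power_mult_distrib mult_ac)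
    also have "\<dots> \<le> (C * ?b ^ M) * ?b ^ N"
      using C(2)[OF diag_one_mult_in_GL[OF x g]] b1 unfolding dn by (intro mult_right_mono) auto
    also have "\<dots> = C * ?b ^ (M + N)" by (simp add: power_add)
    also have "\<dots> \<le> C * b ^ (M + N)" using C(1) b b1 by (intro mult_left_mono power_mono) auto
    finally have "cmod (\<Psi> ?h) * entry_norm g ^ N \<le> C * b ^ (M + N)" .
    moreover have "entry_norm g ^ N > 0" using entry_norm_ge_1[of g] by (intro zero_less_power) linarith
    ultimately show ?thesis by (simp add: field_simps)
  qed
  then show ?thesis using C(1) that by blast
qed

text \<open>A small displacement at most halves the absolute value of \<open>x\<close>.\<close>

lemma emb_perturbation_bound:
  assumes x: "(x::'a) \<noteq> 0"
  obtains \<tau> where "\<tau> > 0"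
    "\<And>t. \<bar>t\<bar> \<le> \<tau> \<Longrightarrow> x + scaleF t X \<noteq> 0"
    "\<And>t. \<bar>t\<bar> \<le> \<tau> \<Longrightarrow> 1 + 1 / cmod (emb (x + scaleF t X)) \<le> 1 + 2 / cmod (emb x)"
proof -
  \<comment> \<open>The summand \<open>1\<close> avoids dividing by zero when \<open>X = 0\<close>.\<close>
  define \<tau> where "\<tau> = cmod (emb x) / (2 * (cmod (emb X) + 1))"
  have ex: "cmod (emb x) > 0" using x by simp
  have "\<tau> > 0" using ex by (simp add: \<tau>_def add_nonneg_pos)
  have low: "cmod (emb (x + scaleF t X)) \<ge> cmod (emb x) / 2" if t: "\<bar>t\<bar> \<le> \<tau>" for t
  proof -
    have "\<bar>t\<bar> * cmod (emb X) \<le> \<tau> * (cmod (emb X) + 1)"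
      using t \<open>\<tau> > 0\<close> by (intro mult_mono) auto
    also have "\<dots> = cmod (emb x) / 2"
      unfolding \<tau>_def by (simp add: field_simps add_nonneg_eq_0_iff)
    finally have "cmod (emb (scaleF t X)) \<le> cmod (emb x) / 2" by (simp add: scaleF_def norm_mult)
    then show ?thesis using norm_diff_ineq[of "emb x" "emb (scaleF t X)"] by simp
  qed
  show ?thesis
  proof (rule that[OF \<open>\<tau> > 0\<close>])
    fix t assume t: "\<bar>t\<bar> \<le> \<tau>"
    have pos: "cmod (emb (x + scaleF t X)) > 0" using low[OF t] ex by linarith
    then show "x + scaleF t X \<noteq> 0" by (metis emb_simps(4) norm_zero order_less_irrefl)
    have "1 / cmod (emb (x + scaleF t X)) \<le> 1 / (cmod (emb x) / 2)"
      using low[OF t] ex by (intro frac_le) auto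
    then show "1 + 1 / cmod (emb (x + scaleF t X)) \<le> 1 + 2 / cmod (emb x)" by simp
  qed
qed

lemma continuous_on_slice:
  fixes \<Psi> :: "'a^'n^'n \<Rightarrow> complex"
  assumes "continuous_on GL \<Psi>"
  shows "x \<noteq> 0 \<Longrightarrow> continuous_on SL (\<lambda>g. \<Psi> (diag_one x ** g))"
    "g \<in> SL \<Longrightarrow> continuous_on {x. x \<noteq> 0} (\<lambda>x. \<Psi> (diag_one x ** g))"
  by (rule continuous_on_compose2[OF assms]; auto intro!: continuous_intros diag_one_mult_in_GL)+

context
  fixes \<mu> :: "('a^'n^'n) measure"
  assumes \<mu>: "haar_measure_SL \<mu>"
begin

lemma space_haar: "space \<mu> = SL"
  using \<mu> by (simp add: haar_measure_SL_def)

lemma slice_integrable: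
  assumes "continuous_on GL \<Psi>" "\<Psi> \<in> rapid_decay" "x \<noteq> 0"
  shows "integrable \<mu> (\<lambda>g. \<Psi> (diag_one x ** g))"
proof -
  obtain N where N: "integrable \<mu> (\<lambda>g. 1 / entry_norm g ^ N)"
    using integrable_inverse_entry_norm[OF \<mu>] by blast
  obtain C M where C: "C \<ge> 0" "\<And>x g b. x \<noteq> 0 \<Longrightarrow> g \<in> SL \<Longrightarrow> 1 + 1 / cmod (emb x) \<le> b \<Longrightarrow>
       cmod (\<Psi> (diag_one x ** g)) \<le> (C * b ^ M) * (1 / entry_norm g ^ N)"
    by (rule rapid_decay_on_slices[OF assms(2), where N = N], rule that)
  show ?thesis
  proof (rule Bochner_Integration.integrable_bound)
    show "integrable \<mu> (\<lambda>g. (C * (1 + 1 / cmod (emb x)) ^ M) * (1 / entry_norm g ^ N))"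
      using N by (rule integrable_mult_right)
    show "(\<lambda>g. \<Psi> (diag_one x ** g)) \<in> borel_measurable \<mu>"
      by (rule haar_borel_measurable[OF \<mu> continuous_on_slice(1)[OF assms(1,3)]])
    show "AE g in \<mu>. norm (\<Psi> (diag_one x ** g)) \<le> norm ((C * (1 + 1 / cmod (emb x)) ^ M) * (1 / entry_norm g ^ N))"
    proof (rule AE_I2)
      fix g assume "g \<in> space \<mu>"
      then have "norm (\<Psi> (diag_one x ** g)) \<le> (C * (1 + 1 / cmod (emb x)) ^ M) * (1 / entry_norm g ^ N)"
        using C(2)[OF assms(3)] by (simp add: space_haar)
      then show "norm (\<Psi> (diag_one x ** g)) \<le> norm ((C * (1 + 1 / cmod (emb x)) ^ M) * (1 / entry_norm g ^ N))"
        by (simp only: real_norm_def)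
    qed
  qed
qed

lemma slice_integral_tendsto:
  assumes \<Psi>: "continuous_on GL \<Psi>" "\<Psi> \<in> rapid_decay"
    and x: "x \<noteq> 0" "\<And>i. X i \<noteq> 0" "X \<longlonglongrightarrow> x"
  shows "(\<lambda>i::nat. slice_integral \<mu> \<Psi> (X i)) \<longlonglongrightarrow> slice_integral \<mu> \<Psi> x"
proof -
  obtain N where N: "integrable \<mu> (\<lambda>g. 1 / entry_norm g ^ N)"
    using integrable_inverse_entry_norm[OF \<mu>] by blast
  obtain C M where C: "C \<ge> 0" "\<And>x g b. x \<noteq> 0 \<Longrightarrow> g \<in> SL \<Longrightarrow> 1 + 1 / cmod (emb x) \<le> b \<Longrightarrow>
       cmod (\<Psi> (diag_one x ** g)) \<le> (C * b ^ M) * (1 / entry_norm g ^ N)"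
    by (rule rapid_decay_on_slices[OF \<Psi>(2), where N = N], rule that)
  have "(\<lambda>i. emb (X i)) \<longlonglongrightarrow> emb x" using x(3) arch_emb_tendsto_iff[OF emb_is_arch_emb] by blast
  then have "(\<lambda>i. 1 / cmod (emb (X i))) \<longlonglongrightarrow> 1 / cmod (emb x)"
    using x(1) by (intro tendsto_intros) auto
  \<comment> \<open>A bound valid along the whole sequence gives a common majorant.\<close>
  then have "Bseq (\<lambda>i. 1 / cmod (emb (X i)))" by (intro convergent_imp_Bseq convergentI)
  then obtain b where b: "\<And>i. norm (1 / cmod (emb (X i))) \<le> b" unfolding Bseq_def by blast
  have b': "1 + 1 / cmod (emb (X i)) \<le> 1 + b" for i using b[of i] by simp
  show ?thesis unfolding slice_integral_def
  proof (rule integral_dominated_convergence)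
    show "integrable \<mu> (\<lambda>g. (C * (1 + b) ^ M) * (1 / entry_norm g ^ N))"
      using N by (rule integrable_mult_right)
    show "(\<lambda>g. \<Psi> (diag_one x ** g)) \<in> borel_measurable \<mu>" "(\<lambda>g. \<Psi> (diag_one (X i) ** g)) \<in> borel_measurable \<mu>" for i
      using x by (auto intro!: haar_borel_measurable[OF \<mu> continuous_on_slice(1)[OF \<Psi>(1)]])
    show "AE g in \<mu>. (\<lambda>i. \<Psi> (diag_one (X i) ** g)) \<longlonglongrightarrow> \<Psi> (diag_one x ** g)"
    proof (rule AE_I2)
      fix g assume "g \<in> space \<mu>"
      then have "continuous_on {x. x \<noteq> 0} (\<lambda>x. \<Psi> (diag_one x ** g))"
        by (intro continuous_on_slice(2)[OF \<Psi>(1)]) (simp add: space_haar)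
      from continuous_on_tendsto_compose[OF this x(3)]
      show "(\<lambda>i. \<Psi> (diag_one (X i) ** g)) \<longlonglongrightarrow> \<Psi> (diag_one x ** g)" using x by simp
    qed
    show "AE g in \<mu>. norm (\<Psi> (diag_one (X i) ** g)) \<le> (C * (1 + b) ^ M) * (1 / entry_norm g ^ N)" for i
      using C(2)[OF x(2) _ b'] by (intro AE_I2) (simp add: space_haar)
  qed
qed

text \<open>Dominated convergence concerns sequences; sequences suffice after transport to a subset of the complex
  plane.\<close>

lemma continuous_on_slice_integral:
  assumes \<Psi>: "continuous_on GL \<Psi>" "\<Psi> \<in> rapid_decay"
  shows "continuous_on {x. x \<noteq> 0} (slice_integral \<mu> \<Psi>)"
proof -
  let ?S = "range emb - {0}"
  have "continuous_on ?S (\<lambda>c. slice_integral \<mu> \<Psi> (inv emb c))"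
    unfolding continuous_on_sequentially
  proof (intro allI ballI impI, elim conjE)
    fix c z assume z: "z \<in> ?S" and c: "\<forall>n. c n \<in> ?S" "c \<longlonglongrightarrow> z"
    have e: "emb (inv emb z) = z" "\<And>n. emb (inv emb (c n)) = c n" using z c(1) by (auto simp: emb_inv)
    have nz: "inv emb y \<noteq> 0" if "y \<in> ?S" for y
      using that emb_inv[of y] by auto
    have "(\<lambda>n. inv emb (c n)) \<longlonglongrightarrow> inv emb z"
      unfolding arch_emb_tendsto_iff[OF emb_is_arch_emb] using c(2) by (simp add: e)
    then show "((\<lambda>c. slice_integral \<mu> \<Psi> (inv emb c)) \<circ> c) \<longlonglongrightarrow> slice_integral \<mu> \<Psi> (inv emb z)"
      using slice_integral_tendsto[OF \<Psi> nz[OF z], of "\<lambda>n. inv emb (c n)"] nz c(1) by (simp add: o_def)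
  qed
  then have "continuous_on {x. x \<noteq> 0} (\<lambda>x. slice_integral \<mu> \<Psi> (inv emb (emb x)))"
    by (rule continuous_on_compose2) (auto intro!: continuous_intros)
  then show ?thesis by simp
qed

text \<open>By the mean value inequality the difference quotients of the integrand are bounded by values of
  \<open>\<Psi>'\<close> at nearby points, hence by one integrable function; dominated convergence applies.\<close>

lemma slice_integral_has_dirderiv:
  assumes \<Psi>: "continuous_on GL \<Psi>" "\<Psi> \<in> rapid_decay"
    and \<Psi>': "continuous_on GL \<Psi>'" "\<Psi>' \<in> rapid_decay"
    and dd: "\<And>x g. x \<noteq> 0 \<Longrightarrow> g \<in> SL \<Longrightarrow> has_dd \<Psi> (row_direction X g) (diag_one x ** g) (\<Psi>' (diag_one x ** g))"
    and x: "x \<noteq> 0"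
  shows "has_dirderiv scaleF (*) euclidean (slice_integral \<mu> \<Psi>) X x (slice_integral \<mu> \<Psi>' x)"
proof -
  obtain \<tau> where \<tau>: "\<tau> > 0"
    "\<And>t. \<bar>t\<bar> \<le> \<tau> \<Longrightarrow> x + scaleF t X \<noteq> 0"
    "\<And>t. \<bar>t\<bar> \<le> \<tau> \<Longrightarrow> 1 + 1 / cmod (emb (x + scaleF t X)) \<le> 1 + 2 / cmod (emb x)"
    by (rule emb_perturbation_bound[OF x, of X], rule that)
  obtain N where N: "integrable \<mu> (\<lambda>g. 1 / entry_norm g ^ N)"
    using integrable_inverse_entry_norm[OF \<mu>] by blast
  obtain C M where C: "C \<ge> 0" "\<And>x g b. x \<noteq> 0 \<Longrightarrow> g \<in> SL \<Longrightarrow> 1 + 1 / cmod (emb x) \<le> b \<Longrightarrow>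
       cmod (\<Psi>' (diag_one x ** g)) \<le> (C * b ^ M) * (1 / entry_norm g ^ N)"
    by (rule rapid_decay_on_slices[OF \<Psi>'(2), where N = N], rule that)
  let ?B = "\<lambda>g. (C * (1 + 2 / cmod (emb x)) ^ M) * (1 / entry_norm g ^ N)"
  let ?u = "\<lambda>g t. \<Psi> (diag_one (x + scaleF t X) ** g)"
  have sF0: "x + scaleF 0 X = x" by (simp add: scaleF_def)
  have der: "(?u g has_vector_derivative \<Psi>' (diag_one (x + scaleF t X) ** g)) (at t)"
    if t: "\<bar>t\<bar> \<le> \<tau>" and g: "g \<in> SL" for t g
    using has_dd_along_line[of \<Psi> "row_direction X g" "diag_one x ** g" t "\<Psi>' (diag_one (x + scaleF t X) ** g)"]
      dd[OF \<tau>(2)[OF t] g] by (simp add: diag_one_line)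
  have bound: "norm (?u g t - ?u g 0) \<le> ?B g * \<bar>t\<bar>" if t: "\<bar>t\<bar> \<le> \<tau>" and g: "g \<in> SL" for t g
  proof -
    have "norm (?u g t - ?u g 0) \<le> ?B g * \<bar>t - 0\<bar>"
    proof (rule norm_diff_le_vector_derivative)
      fix \<theta> assume "\<theta> \<in> closed_segment 0 t"
      then have \<theta>: "\<bar>\<theta>\<bar> \<le> \<tau>" using t by (auto simp: closed_segment_eq_real_ivl split: if_splits)
      show "(?u g has_vector_derivative \<Psi>' (diag_one (x + scaleF \<theta> X) ** g)) (at \<theta>)" by (rule der[OF \<theta> g])
      show "norm (\<Psi>' (diag_one (x + scaleF \<theta> X) ** g)) \<le> ?B g" by (rule C(2)[OF \<tau>(2)[OF \<theta>] g \<tau>(3)[OF \<theta>]])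
    qed
    then show ?thesis by simp
  qed
  let ?q = "\<lambda>t. complex_of_real (1 / t) * (slice_integral \<mu> \<Psi> (x + scaleF t X) - slice_integral \<mu> \<Psi> x)"
  let ?S = "{- \<tau> <..< \<tau>}"
  have "(?q \<longlongrightarrow> slice_integral \<mu> \<Psi>' x) (at 0 within ?S)"
    unfolding tendsto_at_iff_sequentially
  proof (intro allI impI)
    fix h :: "nat \<Rightarrow> real" assume hS: "\<forall>i. h i \<in> ?S - {0}" and h0: "h \<longlonglongrightarrow> 0"
    have h: "\<bar>h i\<bar> \<le> \<tau>" "h i \<noteq> 0" for i using hS[rule_format, of i] by auto
    have eq: "?q (h i) = (\<integral>g. complex_of_real (1 / h i) * (?u g (h i) - ?u g 0) \<partial>\<mu>)" for i
      unfolding slice_integral_def sF0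
      using slice_integrable[OF \<Psi> \<tau>(2)[OF h(1)[of i]]] slice_integrable[OF \<Psi> x] by simp
    have "(\<lambda>i. \<integral>g. complex_of_real (1 / h i) * (?u g (h i) - ?u g 0) \<partial>\<mu>) \<longlonglongrightarrow> (\<integral>g. \<Psi>' (diag_one x ** g) \<partial>\<mu>)"
    proof (rule integral_dominated_convergence)
      show "integrable \<mu> ?B" using N by (rule integrable_mult_right)
      show "(\<lambda>g. \<Psi>' (diag_one x ** g)) \<in> borel_measurable \<mu>"
        by (rule haar_borel_measurable[OF \<mu> continuous_on_slice(1)[OF \<Psi>'(1) x]])
      show "(\<lambda>g. complex_of_real (1 / h i) * (?u g (h i) - ?u g 0)) \<in> borel_measurable \<mu>" for i
        unfolding sF0
        by (intro borel_measurable_times borel_measurable_const borel_measurable_diff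
            haar_borel_measurable[OF \<mu> continuous_on_slice(1)[OF \<Psi>(1)]] x \<tau>(2) h)
      show "AE g in \<mu>. (\<lambda>i. complex_of_real (1 / h i) * (?u g (h i) - ?u g 0)) \<longlonglongrightarrow> \<Psi>' (diag_one x ** g)"
      proof (rule AE_I2)
        fix g assume "g \<in> space \<mu>"
        then have "(?u g has_vector_derivative \<Psi>' (diag_one x ** g)) (at 0)"
          using der[of 0 g] \<tau>(1) by (simp add: space_haar sF0)
        then have "((\<lambda>t. complex_of_real (1 / t) * (?u g t - ?u g 0)) \<longlongrightarrow> \<Psi>' (diag_one x ** g)) (at 0)"
          by (simp add: has_vector_derivative_iff_quotient)
        then show "(\<lambda>i. complex_of_real (1 / h i) * (?u g (h i) - ?u g 0)) \<longlonglongrightarrow> \<Psi>' (diag_one x ** g)"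
          using h0 h(2) unfolding tendsto_at_iff_sequentially by (auto simp: o_def)
      qed
      show "AE g in \<mu>. norm (complex_of_real (1 / h i) * (?u g (h i) - ?u g 0)) \<le> ?B g" for i
      proof (rule AE_I2)
        fix g assume "g \<in> space \<mu>"
        then have "norm (?u g (h i) - ?u g 0) \<le> ?B g * \<bar>h i\<bar>" using bound[OF h(1)] by (simp add: space_haar)
        then show "norm (complex_of_real (1 / h i) * (?u g (h i) - ?u g 0)) \<le> ?B g"
          using h(2)[of i] by (simp only: norm_mult norm_of_real) (simp add: divide_le_eq mult.commute)
      qed
    qed
    then show "(?q \<circ> h) \<longlonglongrightarrow> slice_integral \<mu> \<Psi>' x"
      unfolding o_def eq by (simp only: slice_integral_def)
  qed
  \<comment> \<open>Restricting to \<open>?S\<close> makes the bounds hold along entire sequences, not just eventually.\<close>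
  moreover have "at 0 within ?S = at 0" using \<tau>(1) by (intro at_within_open) auto
  ultimately show ?thesis by (simp add: has_dirderiv_def)
qed

lemma Ck_in_coord_row_direction:
  "Ck_in slow_growth k (\<lambda>g :: 'a^'n^'n. of_real (coord (row_direction (X / det g) g) e))"
proof -
  obtain i j b where e: "e = (i, j, b)" by (cases e)
  have "Ck_in slow_growth k (\<lambda>g :: 'a^'n^'n. emb (row_direction (X / det g) g $ i $ j))"
  proof (cases "i = distinguished_index")
    case True
    have "Ck_in slow_growth k (\<lambda>g :: 'a^'n^'n. (emb X * inverse (emb (det g))) * emb (g $ i $ j))"
      by (intro Ck_in_slow_mult Ck_in_const Ck_in_inverse_det Ck_in_entry)
    then show ?thesis using True by (simp add: row_direction_def divide_inverse emb_inverse)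
  next
    case False
    then show ?thesis by (simp add: row_direction_def Ck_in_const)
  qed
  from Ck_in_Re_Im[OF this] show ?thesis by (cases b) (simp_all add: e coord_def)
qed

text \<open>The derivative of \<open>\<Psi>(d(x) g)\<close> in \<open>x\<close> is the derivative of \<open>\<Psi>\<close> along a direction depending on the point, whose
  real coordinates grow slowly; evaluating the total derivative along it gives another function of the class.\<close>

lemma slice_integral_dirderiv:
  assumes \<Psi>: "Ck_in rapid_decay (Suc k) \<Psi>"
  obtains \<Psi>' where "Ck_in rapid_decay k \<Psi>'"
    "\<And>x. x \<noteq> 0 \<Longrightarrow> has_dirderiv scaleF (*) euclidean (slice_integral \<mu> \<Psi>) X x (slice_integral \<mu> \<Psi>' x)"
proof -
  obtain D where D: "\<And>e. Ck_in rapid_decay k (D e)"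
    "\<And>g X. g \<in> GL \<Longrightarrow> has_dd \<Psi> X g (\<Sum>e\<in>UNIV. of_real (coord X e) * D e g)"
    by (rule Ck_in_total_derivative[OF \<Psi>], rule that)
  define \<Psi>' where "\<Psi>' = (\<lambda>g. \<Sum>e\<in>UNIV. of_real (coord (row_direction (X / det g) g) e) * D e g)"
  have "(\<lambda>g. 0) \<in> (rapid_decay :: ('a^'n^'n \<Rightarrow> complex) set)"
    by (auto simp: rapid_decay_def intro!: exI[of _ 0])
  then have C: "Ck_in rapid_decay k \<Psi>'"
    unfolding \<Psi>'_def
    by (intro Ck_in_sum Ck_in_mult growth_module_rapid Ck_in_coord_row_direction D(1))
  show ?thesis
  proof (rule that[OF C], rule slice_integral_has_dirderiv)
    fix x :: 'a and g :: "'a^'n^'n" assume xg: "x \<noteq> 0" "g \<in> SL"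
    show "has_dd \<Psi> (row_direction X g) (diag_one x ** g) (\<Psi>' (diag_one x ** g))"
      unfolding \<Psi>'_def row_direction_diag_one[OF xg]
      by (rule D(2)[OF diag_one_mult_in_GL[OF xg]])
  qed (rule Ck_in_D[OF \<Psi>] Ck_in_D[OF C] | assumption)+
qed

lemma has_dirderiv_scaleF_cong:
  fixes H G :: "'a \<Rightarrow> complex"
  assumes "has_dirderiv scaleF (*) euclidean H X x d" "\<And>x. x \<noteq> 0 \<Longrightarrow> H x = G x" "x \<noteq> 0"
  shows "has_dirderiv scaleF (*) euclidean G X x d"
proof -
  obtain \<tau> where \<tau>: "\<tau> > 0" "\<And>t. \<bar>t\<bar> \<le> \<tau> \<Longrightarrow> x + scaleF t X \<noteq> 0"
    "\<And>t. \<bar>t\<bar> \<le> \<tau> \<Longrightarrow> 1 + 1 / cmod (emb (x + scaleF t X)) \<le> 1 + 2 / cmod (emb x)"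
    by (rule emb_perturbation_bound[OF assms(3), of X], rule that)
  have "eventually (\<lambda>t. t \<in> {- \<tau> <..< \<tau>}) (at 0)"
    using \<tau>(1) by (intro eventually_at_in_open') auto
  then have "eventually (\<lambda>t. complex_of_real (1 / t) * (H (x + scaleF t X) - H x) = complex_of_real (1 / t) * (G (x + scaleF t X) - G x)) (at 0)"
    by eventually_elim (use \<tau>(2) assms(2,3) in auto)
  from tendsto_cong[OF this] assms(1) show ?thesis by (simp add: has_dirderiv_def)
qed

text \<open>Each derivative costs one order of differentiability, so the order \<open>k\<close> has to be arbitrary in the
  induction.\<close>

lemma iter_dirderiv_slice_integral:
  assumes H: "\<And>x. x \<noteq> 0 \<Longrightarrow> H x = slice_integral \<mu> \<Psi> x" and \<Psi>: "\<And>k. Ck_in rapid_decay k \<Psi>"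
  shows "\<exists>\<Psi>'. Ck_in rapid_decay k \<Psi>' \<and>
    (\<forall>x. x \<noteq> 0 \<longrightarrow> iter_dirderiv scaleF (*) euclidean Xs H x = slice_integral \<mu> \<Psi>' x)"
proof (induction Xs arbitrary: k)
  case Nil
  show ?case using H \<Psi> by (intro exI[of _ \<Psi>]) (simp add: iter_dirderiv_def)
next
  case (Cons X Xs)
  obtain \<Psi>1 where 1: "Ck_in rapid_decay (Suc k) \<Psi>1"
    "\<And>x. x \<noteq> 0 \<Longrightarrow> iter_dirderiv scaleF (*) euclidean Xs H x = slice_integral \<mu> \<Psi>1 x"
    using Cons.IH[of "Suc k"] by blast
  obtain \<Psi>2 where 2: "Ck_in rapid_decay k \<Psi>2"
    "\<And>x. x \<noteq> 0 \<Longrightarrow> has_dirderiv scaleF (*) euclidean (slice_integral \<mu> \<Psi>1) X x (slice_integral \<mu> \<Psi>2 x)"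
    by (rule slice_integral_dirderiv[OF 1(1), of X], rule that)
  have "iter_dirderiv scaleF (*) euclidean (X # Xs) H x = slice_integral \<mu> \<Psi>2 x" if x: "x \<noteq> 0" for x
  proof -
    have d: "has_dirderiv scaleF (*) euclidean (iter_dirderiv scaleF (*) euclidean Xs H) X x (slice_integral \<mu> \<Psi>2 x)"
      by (rule has_dirderiv_scaleF_cong[OF 2(2)[OF x] 1(2)[symmetric] x])
    have "dirderiv scaleF (*) euclidean X (iter_dirderiv scaleF (*) euclidean Xs H) x = slice_integral \<mu> \<Psi>2 x"
      unfolding dirderiv_def
    proof (rule the_equality)
      show "has_dirderiv scaleF (*) euclidean (iter_dirderiv scaleF (*) euclidean Xs H) X x (slice_integral \<mu> \<Psi>2 x)" by (rule d)
      fix d' assume "has_dirderiv scaleF (*) euclidean (iter_dirderiv scaleF (*) euclidean Xs H) X x d'"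
      then show "d' = slice_integral \<mu> \<Psi>2 x"
        using d unfolding has_dirderiv_def limitin_canonical_iff by (intro tendsto_unique) auto
    qed
    then show ?thesis by (simp add: iter_dirderiv_def)
  qed
  then show ?case using 2(1) by blast
qed

lemma slice_integral_smooth:
  assumes H: "\<And>x. x \<noteq> 0 \<Longrightarrow> H x = slice_integral \<mu> \<Psi> x" and \<Psi>: "\<And>k. Ck_in rapid_decay k \<Psi>"
  shows "smooth_onF {x. x \<noteq> 0} H"
proof -
  have "continuous_on {x. x \<noteq> 0} (iter_dirderiv scaleF (*) euclidean Xs H)"
    and "x \<noteq> 0 \<Longrightarrow> \<exists>d. has_dirderiv scaleF (*) euclidean (iter_dirderiv scaleF (*) euclidean Xs H) X x d" for Xs X x
  proof -
    obtain \<Psi>1 where 1: "Ck_in rapid_decay (Suc 0) \<Psi>1"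
      "\<And>x. x \<noteq> 0 \<Longrightarrow> iter_dirderiv scaleF (*) euclidean Xs H x = slice_integral \<mu> \<Psi>1 x"
      using iter_dirderiv_slice_integral[OF H \<Psi>, of "Suc 0" Xs] by blast
    show "continuous_on {x. x \<noteq> 0} (iter_dirderiv scaleF (*) euclidean Xs H)"
      by (rule continuous_on_eq[OF continuous_on_slice_integral[OF Ck_in_D[OF 1(1)]]]) (simp add: 1(2))
    assume x: "x \<noteq> 0"
    obtain \<Psi>2 where 2: "Ck_in rapid_decay 0 \<Psi>2"
      "\<And>x. x \<noteq> 0 \<Longrightarrow> has_dirderiv scaleF (*) euclidean (slice_integral \<mu> \<Psi>1) X x (slice_integral \<mu> \<Psi>2 x)"
      by (rule slice_integral_dirderiv[OF 1(1), of X], rule that)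
    show "\<exists>d. has_dirderiv scaleF (*) euclidean (iter_dirderiv scaleF (*) euclidean Xs H) X x d"
      using has_dirderiv_scaleF_cong[OF 2(2)[OF x] 1(2)[symmetric] x] by blast
  qed
  then show ?thesis using arch by (simp add: smooth_onF_def cinf_on_def)
qed

section \<open>The fiber integral\<close>

lemma arch_fiber_integral:
  fixes \<pi> :: "'a^'n^'n \<Rightarrow> 'v \<Rightarrow> 'v::ab_group_add"
  assumes "in_PiF s V T \<pi>" "\<xi> \<in> schwartz_std" "\<phi> \<in> matrix_coeffs s V T \<pi>"
  shows "(\<forall>x. x \<noteq> 0 \<longrightarrow> integrable (fiber_measure \<mu> x) (\<lambda>g. \<xi> g * \<phi> g)) \<and>
         smooth_onF {x. x \<noteq> 0} (\<lambda>x. \<integral>g. \<xi> g * \<phi> g \<partial>fiber_measure \<mu> x)"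
proof -
  define \<Psi> where "\<Psi> = (\<lambda>g. \<phi> g * \<xi> g)"
  have \<Psi>: "Ck_in rapid_decay k \<Psi>" for k
    unfolding \<Psi>_def
    by (rule Ck_in_mult[OF growth_module_rapid matrix_coeffs_Ck[OF assms(1,3)] schwartz_std_Ck[OF assms(2)]])
  have eq: "(\<lambda>g. \<xi> g * \<phi> g) = \<Psi>" by (simp add: \<Psi>_def mult.commute fun_eq_iff)
  have "integrable (fiber_measure \<mu> x) \<Psi>" if "x \<noteq> 0" for x
    using slice_integrable[OF Ck_in_D[OF \<Psi>] that] fiber_integral_eq(1)[OF \<mu> that Ck_in_D(1)[OF \<Psi>]] by blast
  moreover have "smooth_onF {x. x \<noteq> 0} (\<lambda>x. \<integral>g. \<Psi> g \<partial>fiber_measure \<mu> x)"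
    by (rule slice_integral_smooth[OF _ \<Psi>]) (simp add: slice_integral_def fiber_integral_eq(2)[OF \<mu> _ Ck_in_D(1)[OF \<Psi>]])
  ultimately show ?thesis unfolding eq by blast
qed

end

end

theorem proposition3p2:
  fixes s :: "complex \<Rightarrow> 'v \<Rightarrow> 'v::ab_group_add"
    and V :: "'v set" and T :: "'v topology"
    and \<pi> :: "'a::local_field_char_0^'n^'n \<Rightarrow> 'v \<Rightarrow> 'v"
    and \<mu> :: "('a^'n^'n) measure"
    and \<xi> \<phi> :: "'a^'n^'n \<Rightarrow> complex"
  assumes "in_PiF s V T \<pi>"
    and "haar_measure_SL \<mu>"
    and "\<xi> \<in> schwartz_std"
    and "\<phi> \<in> matrix_coeffs s V T \<pi>"
  shows "(\<forall>x. x \<noteq> 0 \<longrightarrow> integrable (fiber_measure \<mu> x) (\<lambda>g. \<xi> g * \<phi> g)) \<and>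
         smooth_onF {x. x \<noteq> 0} (\<lambda>x. \<integral>g. \<xi> g * \<phi> g \<partial>fiber_measure \<mu> x)"
proof (cases "archimedean TYPE('a)")
  case True
  then interpret archimedean_local_field "TYPE('a)" by unfold_locales
  show ?thesis by (rule arch_fiber_integral[OF assms(2,1,3,4)])
next
  case False
  then show ?thesis using assms by (rule nonarch_fiber_integral)
qed

end
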